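(* Assume the Riemann hypothesis. Let $A\geqslant 1$ be an arbitrary (arbitrarily large) fixed constant. Then there exist constants $c_{0}=c_{0}(A)>0$ and $T_{0}=T_{0}(A)$ such that for every $T>T_{0}$ the interval $(T-H,T+H)$, where $H=\frac{1}{\pi}\ln\ln\ln T+c_{0}$, contains at least one point $t$ with $|\zeta(0.5+it)|>A$.
   Context: $\zeta(s)$ denotes the Riemann zeta function. *)

theory Defs
  imports "HOL-Complex_Analysis.Complex_Analysis"
begin

(* The Riemann zeta function as the analytic continuation of the Dirichlet series.  By the
   identity theorem the continuation is determined at every s \<noteq> 1; the value at the
   pole s = 1 is left unspecified and is never used. *)
definition zeta :: "complex \<Rightarrow> complex" where
  "zeta = (SOME f. f holomorphic_on (- {1}) \<and>
             (\<forall>s. Re s > 1 \<longrightarrow> (\<lambda>n. 1 / (of_nat (Suc n) powr s)) sums f s))"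

(* The zeros outside the open critical strip are exactly the trivial ones s = -2, -4, ... *)
definition riemann_hypothesis :: bool where
  "riemann_hypothesis \<longleftrightarrow>
     (\<forall>s. 0 < Re s \<and> Re s < 1 \<and> zeta s = 0 \<longrightarrow> Re s = 1 / 2)"

end

theory Submission
  imports Defs "HOL-Number_Theory.Prime_Powers" "HOL-Probability.Characteristic_Functions"
    "HOL-Real_Asymp.Real_Asymp"
begin

text \<open>
  Under the Riemann hypothesis \<open>log \<zeta>\<close> is holomorphic to the right of the critical line (away from
  the pole), so only \<^emph>\<open>upper\<close> bounds for \<open>log |\<zeta>|\<close> are needed to control an average of it against
  a positive kernel. Take the kernel \<open>k(u) = exp(-\<eta> cosh(\<pi> u) - B u\<^sup>2)\<close>: it is bounded by a Gaussian
  in the strip \<open>|Im u| \<le> 1/2\<close>, which is exactly what is needed to move the line of integration from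
  the critical line into the half plane of absolute convergence, and on the real line it decays
  doubly exponentially, so that beyond \<open>|u| = (1/\<pi>) ln ln ln T + O(1)\<close> it is smaller than
  \<open>(ln T)\<^bsup>-2\<^esup>\<close> and kills the trivial bound \<open>log |\<zeta>| \<le> O(ln T)\<close>. Hence, if \<open>|\<zeta>| \<le> A\<close> on the interval,
  then \<open>\<integral> log |\<zeta>(1/2 + i(\<tau> + x))| k(x) dx \<le> (ln (A + 1) + o(1)) \<integral> exp(-B x\<^sup>2) dx\<close> for \<open>\<tau>\<close> within
  \<open>O(1)\<close> of \<open>T\<close>.

  After the shift the same integral is \<open>Re \<Sum> \<Lambda>(n) / ln n \<cdot> n\<^bsup>-1/2-i\<tau>\<^esup> K(ln n)\<close> up to a negligible
  contribution of the pole, where \<open>K\<close> is the Fourier transform of \<open>k\<close>. Two integrations by parts on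
  \<open>Im u = -1/2\<close> give \<open>K(\<xi>) = O(exp(-\<xi>/2) / \<xi>\<^sup>2)\<close> uniformly in \<open>\<eta> \<le> 1\<close>, so the tail of the series is
  small; for \<open>\<eta> \<rightarrow> 0\<close> the function \<open>K\<close> tends to the transform of a Gaussian, which is positive.
  Since \<open>\<Sum> \<Lambda>(n) / (\<surd>n ln n)\<close> diverges, a narrow enough Gaussian makes the sum as large as desired
  as soon as \<open>n\<^bsup>-i\<tau>\<^esup> \<approx> 1\<close> for finitely many \<open>n\<close>, and such \<open>\<tau>\<close> are relatively dense by pigeonhole.
  This contradicts the upper bound.
\<close>

section \<open>Analytic continuation of the zeta function\<close>

lemma norm_Suc_powr: "cmod (of_nat (Suc n) powr s) = real (Suc n) powr Re s"
  by (subst norm_powr_real_powr) auto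

lemma summable_Suc_powr_iff: "summable (\<lambda>n. real (Suc n) powr a) \<longleftrightarrow> a < -1"
  using summable_Suc_iff[of "\<lambda>n. real n powr a"] by (simp add: summable_real_powr_iff)

lemma halfplane_Re_gt_neighbourhood:
  assumes "Re s > a"
  obtains d where "d > 0" and "cball s d \<subseteq> {w. a + d \<le> Re w}"
proof
  show "(Re s - a) / 2 > 0" using assms by simp
  show "cball s ((Re s - a) / 2) \<subseteq> {w. a + (Re s - a) / 2 \<le> Re w}"
  proof safe
    fix w assume "w \<in> cball s ((Re s - a) / 2)"
    hence "\<bar>Re s - Re w\<bar> \<le> (Re s - a) / 2"
      using abs_Re_le_cmod[of "s - w"] by (simp add: dist_norm)
    hence "Re s - Re w \<le> (Re s - a) / 2" by linarith
    thus "a + (Re s - a) / 2 \<le> Re w" by (simp add: field_simps)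
  qed
qed

lemma holomorphic_on_suminf:
  fixes f :: "nat \<Rightarrow> complex \<Rightarrow> complex"
  assumes "open S" and hol: "\<And>n. f n holomorphic_on S"
    and majorant: "\<And>x. x \<in> S \<Longrightarrow> \<exists>d M. d > 0 \<and> cball x d \<subseteq> S \<and> summable M \<and>
               (\<forall>n. \<forall>y\<in>cball x d. norm (f n y) \<le> M n)"
  shows "(\<lambda>s. \<Sum>n. f n s) holomorphic_on S"
proof (rule holomorphic_uniform_sequence[OF \<open>open S\<close>, where f="\<lambda>N s. \<Sum>n<N. f n s"])
  show "(\<lambda>s. \<Sum>n<N. f n s) holomorphic_on S" for N
    by (intro holomorphic_intros hol)
next
  fix x assume "x \<in> S"
  from majorant[OF this] obtain d M where d: "d > 0" "cball x d \<subseteq> S" "summable M"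
    "\<And>n y. y \<in> cball x d \<Longrightarrow> norm (f n y) \<le> M n" by blast
  have "uniform_limit (cball x d) (\<lambda>N s. \<Sum>n<N. f n s) (\<lambda>s. \<Sum>n. f n s) sequentially"
    using d by (intro Weierstrass_m_test) auto
  with d show "\<exists>d>0. cball x d \<subseteq> S \<and>
      uniform_limit (cball x d) (\<lambda>N s. \<Sum>n<N. f n s) (\<lambda>s. \<Sum>n. f n s) sequentially"
    by blast
qed

lemma has_field_derivative_gbinomial_powr:
  fixes a z :: complex
  assumes "z \<notin> \<real>\<^sub>\<le>\<^sub>0"
  shows "((\<lambda>z. fact j * (a gchoose j) * z powr (a - of_nat j)) has_field_derivative
           fact (Suc j) * (a gchoose Suc j) * z powr (a - of_nat (Suc j))) (at z within S)"
proof -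
  have "((\<lambda>z. fact j * (a gchoose j) * z powr (a - of_nat j)) has_field_derivative
      fact j * (a gchoose j) * ((a - of_nat j) * z powr (a - of_nat j - 1))) (at z within S)"
    by (intro DERIV_cmult has_field_derivative_at_within[OF has_field_derivative_powr[OF assms]])
  moreover have "fact (Suc j) * (a gchoose Suc j) = fact j * (a gchoose j) * (a - of_nat j)"
    by (simp add: gbinomial_prod_rev del: fact_Suc)
  ultimately show ?thesis by (simp add: mult.assoc diff_diff_eq add.commute del: fact_Suc)
qed

lemma powr_plus_1_Taylor:
  fixes a :: complex and x :: real
  assumes x: "x > 0" and "Re a \<le> real m + 1"
  shows "cmod (of_real (x + 1) powr a - (\<Sum>j\<le>m. (a gchoose j) * of_real x powr (a - of_nat j)))
         \<le> (real m + 1) * cmod (a gchoose Suc m) * x powr (Re a - real m - 1)"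
proof -
  define S where "S = complex_of_real ` {x..x + 1}"
  define f where "f = (\<lambda>j z. fact j * (a gchoose j) * z powr (a - of_nat j))"
  define B where "B = fact (Suc m) * cmod (a gchoose Suc m) * x powr (Re a - real m - 1)"
  have "convex S" unfolding S_def by (intro convex_linear_image) (auto simp: linear_of_real)
  have deriv: "(f j has_field_derivative f (Suc j) z) (at z within S)" if "z \<in> S" for j z
    unfolding f_def by (rule has_field_derivative_gbinomial_powr) (use that x in \<open>auto simp: S_def\<close>)
  have bound: "cmod (f (Suc m) z) \<le> B" if "z \<in> S" for z
  proof -
    from that obtain t where t: "z = of_real t" "t \<ge> x" by (auto simp: S_def)
    hence "cmod (z powr (a - of_nat (Suc m))) = t powr (Re a - real m - 1)"
      using x by (subst norm_powr_real_powr) (auto simp: algebra_simps)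
    also have "\<dots> \<le> x powr (Re a - real m - 1)" using t x assms by (intro powr_mono2') auto
    finally show ?thesis
      unfolding f_def B_def norm_mult norm_fact by (intro mult_left_mono) auto
  qed
  have "cmod (f 0 (of_real (x + 1)) -
      (\<Sum>j\<le>m. f j (of_real x) * (of_real (x + 1) - of_real x) ^ j / fact j))
       \<le> B * cmod (of_real (x + 1) - of_real x) ^ Suc m / fact m"
  proof (rule complex_Taylor[OF \<open>convex S\<close>])
    show "of_real x \<in> S" "of_real (x + 1) \<in> S" unfolding S_def by (intro imageI; simp)+
  qed (use deriv bound in auto)
  also have "\<dots> = (real m + 1) * cmod (a gchoose Suc m) * x powr (Re a - real m - 1)"
    by (simp add: B_def)
  finally show ?thesis by (simp add: f_def)
qed

text \<open>Since \<open>\<Sum>\<^sub>n ((n+1)\<^bsup>1-s\<^esup> - n\<^bsup>1-s\<^esup>)\<close> telescopes, summing the Taylor expansions of \<open>x\<^bsup>1-s\<^esup>\<close>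
  between consecutive integers expresses \<open>(s - 1) \<zeta>(s)\<close> through \<open>\<zeta>(s+1), \<dots>, \<zeta>(s+m-1)\<close> and a series
  of remainders that converges for \<open>Re s > 1 - m\<close>.\<close>

definition zeta_rem :: "nat \<Rightarrow> complex \<Rightarrow> nat \<Rightarrow> complex" where
  "zeta_rem m s n = of_nat (Suc (Suc n)) powr (1 - s) -
     (\<Sum>j\<le>m. ((1 - s) gchoose j) * of_nat (Suc n) powr (1 - s - of_nat j))"

lemma norm_zeta_rem_le:
  assumes "Re s \<ge> - real m"
  shows "cmod (zeta_rem m s n) \<le>
           (real m + 1) * cmod ((1 - s) gchoose Suc m) * real (Suc n) powr (- Re s - real m)"
  using powr_plus_1_Taylor[of "real (Suc n)" "1 - s" m] assms by (simp add: zeta_rem_def add_ac)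

lemma holomorphic_on_gbinomial [holomorphic_intros]:
  "f holomorphic_on A \<Longrightarrow> (\<lambda>s. f s gchoose k) holomorphic_on A"
  unfolding gbinomial_prod_rev by (intro holomorphic_intros) auto

lemma holomorphic_suminf_zeta_rem:
  "(\<lambda>s. \<Sum>n. zeta_rem m s n) holomorphic_on {s. Re s > 1 - real m}"
proof (rule holomorphic_on_suminf)
  show "open {s. Re s > 1 - real m}" by (rule open_halfspace_Re_gt)
  show "(\<lambda>s. zeta_rem m s n) holomorphic_on {s. Re s > 1 - real m}" for n
    unfolding zeta_rem_def by (intro holomorphic_intros)
  fix x assume "x \<in> {s. Re s > 1 - real m}"
  then obtain d where d: "d > 0" and ball: "cball x d \<subseteq> {w. 1 - real m + d \<le> Re w}"
    by (auto elim: halfplane_Re_gt_neighbourhood)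
  have "bounded ((\<lambda>s. (1 - s) gchoose Suc m) ` cball x d)"
    by (intro compact_imp_bounded compact_continuous_image holomorphic_on_imp_continuous_on
          holomorphic_intros compact_cball)
  then obtain C where C: "C > 0" "\<And>y. y \<in> cball x d \<Longrightarrow> cmod ((1 - y) gchoose Suc m) \<le> C"
    by (auto simp: bounded_pos)
  define M where "M = (\<lambda>n. (real m + 1) * C * real (Suc n) powr (-1 - d))"
  have "cmod (zeta_rem m y n) \<le> M n" if y: "y \<in> cball x d" for y n
  proof -
    have Re_y: "1 - real m + d \<le> Re y" using ball y by auto
    hence "cmod (zeta_rem m y n) \<le>
        (real m + 1) * cmod ((1 - y) gchoose Suc m) * real (Suc n) powr (- Re y - real m)"
      using d by (intro norm_zeta_rem_le) simp
    also have "\<dots> \<le> M n"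
      unfolding M_def using Re_y C(1) by (intro mult_mono C y powr_mono) auto
    finally show ?thesis .
  qed
  moreover have "summable M"
    unfolding M_def using d by (intro summable_mult) (simp only: summable_Suc_powr_iff)
  moreover have "cball x d \<subseteq> {s. Re s > 1 - real m}" using ball d by force
  ultimately show "\<exists>d M. 0 < d \<and> cball x d \<subseteq> {s. 1 - real m < Re s} \<and> summable M \<and>
      (\<forall>n. \<forall>y\<in>cball x d. cmod (zeta_rem m y n) \<le> M n)"
    using d by blast
qed

definition zeta_series :: "complex \<Rightarrow> complex" where
  "zeta_series s = (\<Sum>n. 1 / of_nat (Suc n) powr s)"

lemma zeta_series_sums:
  assumes "Re s > 1"
  shows "(\<lambda>n. 1 / of_nat (Suc n) powr s) sums zeta_series s"
proof -
  have "summable (\<lambda>n. cmod (1 / of_nat (Suc n) powr s))"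
    using summable_Suc_powr_iff[of "- Re s"] assms
    by (simp only: norm_divide norm_Suc_powr norm_one powr_minus_divide)
  thus ?thesis unfolding zeta_series_def by (rule summable_sums[OF summable_norm_cancel])
qed

lemma zeta_rem_sums:
  assumes s: "Re s > 1"
  shows "zeta_rem m s sums
      (- 1 - (\<Sum>j\<in>{1..m}. ((1 - s) gchoose j) * zeta_series (s + of_nat j - 1)))"
proof -
  have "(\<lambda>n. real (Suc n) powr (1 - Re s)) \<longlonglongrightarrow> 0" using s by real_asymp
  hence "(\<lambda>n. of_nat (Suc n) powr (1 - s)) \<longlonglongrightarrow> (0::complex)"
    by (intro tendsto_norm_zero_cancel[where f="\<lambda>n. of_nat (Suc n) powr (1 - s)"])
       (simp only: norm_Suc_powr minus_complex.simps one_complex.simps)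
  from telescope_sums[OF this]
  have telescope: "(\<lambda>n. of_nat (Suc (Suc n)) powr (1 - s) - of_nat (Suc n) powr (1 - s)) sums
      (-1::complex)"
    by simp
  have shifted: "(\<lambda>n. of_nat (Suc n) powr (1 - s - of_nat j)) sums zeta_series (s + of_nat j - 1)"
    if "j \<in> {1..m}" for j
  proof -
    have "(\<lambda>n. 1 / of_nat (Suc n) powr (s + of_nat j - 1)) sums zeta_series (s + of_nat j - 1)"
      using s that by (intro zeta_series_sums) auto
    moreover have "1 / of_nat (Suc n) powr (s + of_nat j - 1) =
        (of_nat (Suc n) powr (1 - s - of_nat j) :: complex)" for n
      by (subst powr_minus_divide[symmetric]) (simp add: algebra_simps)
    ultimately show ?thesis by simp
  qed
  have "zeta_rem m s = (\<lambda>n. of_nat (Suc (Suc n)) powr (1 - s) - of_nat (Suc n) powr (1 - s) -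
      (\<Sum>j\<in>{1..m}. ((1 - s) gchoose j) * of_nat (Suc n) powr (1 - s - of_nat j)))"
    by (simp add: fun_eq_iff zeta_rem_def atMost_atLeast0 sum.atLeast_Suc_atMost)
  thus ?thesis
    by (simp only:) (intro sums_diff telescope sums_sum sums_mult shifted)
qed

lemma zeta_series_recursion:
  assumes "Re s > 1"
  shows "(\<Sum>j\<le>m. ((1 - s) gchoose j) / of_nat (Suc j) *
      ((s + of_nat j - 1) * zeta_series (s + of_nat j))) =
           1 + (\<Sum>n. zeta_rem (Suc m) s n)"
proof -
  have "((1 - s) gchoose Suc j) * zeta_series (s + of_nat (Suc j) - 1) =
      - (((1 - s) gchoose j) / of_nat (Suc j) * ((s + of_nat j - 1) * zeta_series (s + of_nat j)))"
        for j
  proof -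
    have "1 - s - of_nat j = - (s + of_nat j - 1)" by simp
    thus ?thesis
      by (simp only: gbinomial_Suc_rec minus_divide_left[symmetric] mult_minus_right
         mult_minus_left)
         (simp add: add_ac)
  qed
  hence "(\<Sum>j\<in>{1..Suc m}. ((1 - s) gchoose j) * zeta_series (s + of_nat j - 1)) =
      - (\<Sum>j\<le>m. ((1 - s) gchoose j) / of_nat (Suc j) *
        ((s + of_nat j - 1) * zeta_series (s + of_nat j)))"
    unfolding sum_negf[symmetric] atMost_atLeast0 One_nat_def sum.shift_bounds_cl_Suc_ivl
    by (intro sum.cong) auto
  thus ?thesis using zeta_rem_sums[OF assms, of "Suc m"] by (simp add: sums_iff)
qed

lemma continuation_zeta_series_halfplane:
  "\<exists>F. F holomorphic_on {s. Re s > 1 - real k} \<and> (\<forall>s. Re s > 1 \<longrightarrow> F s = (s - 1) * zeta_series s)"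
proof (induction k)
  case 0
  have "(\<lambda>s. 1 + (\<Sum>n. zeta_rem 1 s n)) holomorphic_on {s. Re s > 1 - real 0}"
    by (intro holomorphic_intros holomorphic_on_subset[OF holomorphic_suminf_zeta_rem]) auto
  moreover have "1 + (\<Sum>n. zeta_rem 1 s n) = (s - 1) * zeta_series s" if "Re s > 1" for s
    using zeta_series_recursion[OF that, of 0] by simp
  ultimately show ?case by blast
next
  case (Suc k)
  then obtain F where hol: "F holomorphic_on {s. Re s > 1 - real k}"
    and F: "\<And>s. Re s > 1 \<Longrightarrow> F s = (s - 1) * zeta_series s" by blast
  define G where "G = (\<lambda>s. 1 + (\<Sum>n. zeta_rem (Suc k) s n) -
      (\<Sum>j\<in>{1..k}. ((1 - s) gchoose j) / of_nat (Suc j) * F (s + of_nat j)))"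
  have "(\<lambda>s. F (s + of_nat j)) holomorphic_on {s. Re s > 1 - real (Suc k)}" if "j \<in> {1..k}" for j
    by (rule holomorphic_on_compose_gen[OF _ hol, unfolded o_def])
       (use that in \<open>auto intro!: holomorphic_intros\<close>)
  hence "G holomorphic_on {s. Re s > 1 - real (Suc k)}"
    unfolding G_def by (intro holomorphic_intros holomorphic_suminf_zeta_rem of_nat_neq_0) auto
  moreover have "G s = (s - 1) * zeta_series s" if s: "Re s > 1" for s
  proof -
    have "F (s + of_nat j) = (s + of_nat j - 1) * zeta_series (s + of_nat j)" for j
      using s by (intro F) auto
    thus ?thesis
      unfolding G_def diff_eq_eq zeta_series_recursion[OF s, of k, symmetric]
      by (simp add: atMost_atLeast0 sum.atLeast_Suc_atMost)
  qed
  ultimately show ?case by blast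
qed

lemma continuation_zeta_series:
  obtains F where "F holomorphic_on UNIV" and "\<And>s. Re s > 1 \<Longrightarrow> F s = (s - 1) * zeta_series s"
proof -
  let ?H = "\<lambda>k. {s. Re s > 1 - real k}"
  obtain F where F: "\<And>k. F k holomorphic_on ?H k"
    "\<And>k s. Re s > 1 \<Longrightarrow> F k s = (s - 1) * zeta_series s"
    using continuation_zeta_series_halfplane by metis
  have agree: "F k s = F l s" if "k \<le> l" "s \<in> ?H k" for k l s
  proof (rule analytic_continuation_open[where
      s="{s. Re s > 1}" and s'="?H k" and f="F k" and g="F l"])
    show "F l holomorphic_on ?H k" by (rule holomorphic_on_subset[OF F(1)]) (use that in auto)
    show "connected (?H k)" by (intro convex_connected convex_halfspace_Re_gt)
    show "{s. 1 < Re s} \<noteq> {}" by (auto intro!: exI[of _ 2])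
  qed (use that F in \<open>auto simp: open_halfspace_Re_gt\<close>)
  define idx where "idx = (\<lambda>s. nat \<lceil>2 - Re s\<rceil>)"
  have idx: "s \<in> ?H (idx s)" for s unfolding idx_def mem_Collect_eq by linarith
  define G where "G = (\<lambda>s. F (idx s) s)"
  have G: "G s = F k s" if "s \<in> ?H k" for k s
    unfolding G_def by (metis agree idx that linear)
  show ?thesis
  proof
    have "G holomorphic_on ?H k" for k by (rule holomorphic_transform[OF F(1)]) (use G in auto)
    hence "G field_differentiable (at s)" for s
      using holomorphic_on_imp_differentiable_at[OF _ open_halfspace_Re_gt] idx by blast
    thus "G holomorphic_on UNIV" by (simp add: holomorphic_on_def field_differentiable_at_within)
    show "G s = (s - 1) * zeta_series s" if "Re s > 1" for s
      using G[of s 0] F(2)[of s 0] that by simp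
  qed
qed

lemma holomorphic_zeta: "zeta holomorphic_on (- {1})"
  and zeta_eq_zeta_series: "Re s > 1 \<Longrightarrow> zeta s = zeta_series s"
proof -
  obtain F where F: "F holomorphic_on UNIV" "\<And>s. Re s > 1 \<Longrightarrow> F s = (s - 1) * zeta_series s"
    using continuation_zeta_series by blast
  have "(\<lambda>s. F s / (s - 1)) holomorphic_on (- {1})"
    by (intro holomorphic_intros holomorphic_on_subset[OF F(1)]) auto
  moreover have "(\<lambda>n. 1 / (of_nat (Suc n) powr s)) sums (F s / (s - 1))" if "Re s > 1" for s
    using zeta_series_sums[OF that] F(2)[OF that] that by auto
  ultimately have "\<exists>f. f holomorphic_on (- {1}) \<and>
             (\<forall>s. Re s > 1 \<longrightarrow> (\<lambda>n. 1 / (of_nat (Suc n) powr s)) sums f s)" by blast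
  from someI_ex[OF this] have zeta: "zeta holomorphic_on (- {1})"
    "\<And>s. Re s > 1 \<Longrightarrow> (\<lambda>n. 1 / (of_nat (Suc n) powr s)) sums zeta s"
    unfolding zeta_def[symmetric] by blast+
  show "zeta holomorphic_on (- {1})" by fact
  show "zeta s = zeta_series s" if "Re s > 1"
    using zeta(2)[OF that] zeta_series_sums[OF that] by (rule sums_unique2)
qed

text \<open>The value of \<open>(s - 1) \<zeta>(s)\<close>, including at \<open>s = 1\<close>, where \<open>zeta\<close> itself is unspecified.\<close>

definition zeta_reg :: "complex \<Rightarrow> complex" where
  "zeta_reg s = 1 + (\<Sum>n. zeta_rem 1 s n)"

lemma holomorphic_zeta_reg: "zeta_reg holomorphic_on {s. Re s > 0}"
  unfolding zeta_reg_def using holomorphic_suminf_zeta_rem[of 1] by (intro holomorphic_intros) auto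

lemma zeta_reg_eq:
  assumes "Re s > 0" "s \<noteq> 1"
  shows "zeta_reg s = (s - 1) * zeta s"
proof (rule analytic_continuation_open[where s="{s. Re s > 1}" and s'="{s. Re s > 0} - {1}"
      and g="\<lambda>s. (s - 1) * zeta s"])
  show "{s. 1 < Re s} \<noteq> {}" by (auto intro!: exI[of _ 2])
  show "connected ({s. 0 < Re s} - {1})"
    by (intro connected_open_delete convex_connected convex_halfspace_Re_gt)
       (auto simp: open_halfspace_Re_gt)
  show "zeta_reg holomorphic_on {s. 0 < Re s} - {1}"
    by (rule holomorphic_on_subset[OF holomorphic_zeta_reg]) auto
  show "(\<lambda>s. (s - 1) * zeta s) holomorphic_on {s. 0 < Re s} - {1}"
    by (intro holomorphic_intros holomorphic_on_subset[OF holomorphic_zeta]) auto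
  show "zeta_reg z = (z - 1) * zeta z" if "z \<in> {s. 1 < Re s}" for z
    using zeta_series_recursion[of z 0] that zeta_eq_zeta_series[of z] by (simp add: zeta_reg_def)
qed (use assms in \<open>auto simp: open_halfspace_Re_gt\<close>)

lemma zeta_reg_1 [simp]: "zeta_reg 1 = 1"
proof -
  have "of_nat (Suc m) \<noteq> (0::complex)" for m by (rule of_nat_neq_0)
  thus ?thesis by (simp add: zeta_reg_def zeta_rem_def del: of_nat_Suc) simp
qed

lemma norm_zeta_reg_le:
  assumes "\<sigma> > 0"
  obtains C where "C > 0" and "\<And>s. Re s \<ge> \<sigma> \<Longrightarrow> cmod (zeta_reg s) \<le> C * (1 + cmod s)\<^sup>2"
proof
  define K where "K = (\<Sum>n. real (Suc n) powr (- \<sigma> - 1))"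
  have summable: "summable (\<lambda>n. real (Suc n) powr (- \<sigma> - 1))"
    using assms by (simp only: summable_Suc_powr_iff)
  have "K \<ge> 0" unfolding K_def by (rule suminf_nonneg[OF summable]) auto
  thus "1 + K > 0" by simp
  fix s assume s: "Re s \<ge> \<sigma>"
  have term_le: "cmod (zeta_rem 1 s n) \<le> (1 + cmod s)\<^sup>2 * real (Suc n) powr (- \<sigma> - 1)" for n
  proof -
    have "2 * ((1 - s) gchoose Suc 1) = (1 - s) * (- s)"
      by (simp add: gbinomial_Suc_rec field_simps)
    hence "2 * cmod ((1 - s) gchoose Suc 1) = cmod (1 - s) * cmod s"
      by (metis norm_minus_cancel norm_mult norm_numeral)
    also have "\<dots> \<le> (1 + cmod s) * (1 + cmod s)"
      using norm_triangle_ineq4[of 1 s] by (intro mult_mono) auto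
    finally have "2 * cmod ((1 - s) gchoose Suc 1) \<le> (1 + cmod s)\<^sup>2" by (simp add: power2_eq_square)
    moreover have "cmod (zeta_rem 1 s n) \<le>
        2 * cmod ((1 - s) gchoose Suc 1) * real (Suc n) powr (- Re s - 1)"
      using norm_zeta_rem_le[of 1 s n] s assms by simp
    moreover have "real (Suc n) powr (- Re s - 1) \<le> real (Suc n) powr (- \<sigma> - 1)"
      using s by (intro powr_mono) auto
    ultimately show ?thesis by (smt (verit) mult_mono norm_ge_zero powr_ge_zero)
  qed
  have "cmod (\<Sum>n. zeta_rem 1 s n) \<le> (\<Sum>n. (1 + cmod s)\<^sup>2 * real (Suc n) powr (- \<sigma> - 1))"
    by (rule norm_suminf_le[OF term_le]) (intro summable_mult summable)
  also have "\<dots> = (1 + cmod s)\<^sup>2 * K" unfolding K_def by (rule suminf_mult[OF summable])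
  finally have "cmod (zeta_reg s) \<le> 1 + (1 + cmod s)\<^sup>2 * K"
    unfolding zeta_reg_def using norm_triangle_ineq[of 1 "\<Sum>n. zeta_rem 1 s n"] by simp
  moreover have "1 \<le> (1 + cmod s)\<^sup>2" by (simp add: one_le_power)
  ultimately have "cmod (zeta_reg s) \<le> (1 + cmod s)\<^sup>2 + (1 + cmod s)\<^sup>2 * K" by linarith
  thus "cmod (zeta_reg s) \<le> (1 + K) * (1 + cmod s)\<^sup>2"
    by (simp only: distrib_right mult_1 mult.commute)
qed

lemma tendsto_zeta_reg_1: "((\<lambda>x. cmod (zeta_reg (of_real (1 + x)))) \<longlongrightarrow> 1) (at_right 0)"
proof -
  have "isCont zeta_reg 1"
    using holomorphic_on_imp_continuous_on[OF holomorphic_zeta_reg]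
    by (auto simp: continuous_on_eq_continuous_at open_halfspace_Re_gt)
  moreover have "((\<lambda>x. of_real (1 + x)) \<longlongrightarrow> (1::complex)) (at_right 0)"
    by (auto intro!: tendsto_eq_intros)
  ultimately have "((\<lambda>x. cmod (zeta_reg (of_real (1 + x)))) \<longlongrightarrow> cmod (zeta_reg 1)) (at_right 0)"
    by (intro tendsto_norm isCont_tendsto_compose[where g=zeta_reg])
  thus ?thesis by simp
qed


section \<open>Dirichlet series\<close>

text \<open>Indices are shifted by one: \<open>c n\<close> is the coefficient of \<open>(n + 1)\<^bsup>-s\<^esup>\<close>.\<close>

definition dirichlet :: "(nat \<Rightarrow> real) \<Rightarrow> complex \<Rightarrow> complex" where
  "dirichlet c s = (\<Sum>n. of_real (c n) * of_nat (Suc n) powr (-s))"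

lemma zeta_series_eq_dirichlet: "zeta_series s = dirichlet (\<lambda>_. 1) s"
  unfolding zeta_series_def dirichlet_def by (simp add: powr_minus_divide)

lemma Suc_powr_eq_cis:
  "of_nat (Suc n) powr (- s) =
      of_real (real (Suc n) powr (- Re s)) * cis (- (Im s * ln (real (Suc n))))"
proof -
  have "of_nat (Suc n) powr (- s) = exp (- s * of_real (ln (real (Suc n))))"
    unfolding powr_def Ln_of_nat[OF zero_less_Suc] using of_nat_neq_0[of n, where ?'a=complex]
    by (simp only: if_False)
  also have "\<dots> = of_real (exp (- Re s * ln (real (Suc n)))) * cis (- (Im s * ln (real (Suc n))))"
    by (simp add: exp_eq_polar)
  finally show ?thesis by (simp add: powr_def)
qed

lemma norm_dirichlet_term:
  "cmod (of_real c * of_nat (Suc n) powr (-s)) = \<bar>c\<bar> * real (Suc n) powr (- Re s)"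
  unfolding norm_mult norm_Suc_powr by simp

lemma summable_norm_dirichlet:
  assumes "\<And>n. \<bar>c n\<bar> \<le> K * real (Suc n) powr a" and "Re s > a + 1"
  shows "summable (\<lambda>n. cmod (of_real (c n) * of_nat (Suc n) powr (-s)))"
proof (rule summable_comparison_test'[where N=0])
  show "summable (\<lambda>n. K * real (Suc n) powr (a - Re s))"
    using assms(2) by (intro summable_mult) (simp only: summable_Suc_powr_iff)
  fix n
  have "\<bar>c n\<bar> * real (Suc n) powr (- Re s) \<le> K * real (Suc n) powr a * real (Suc n) powr (- Re s)"
    by (intro mult_right_mono assms) auto
  also have "\<dots> = K * real (Suc n) powr (a - Re s)"
    by (simp only: mult.assoc powr_add[symmetric]) simp
  finally show "norm (cmod (of_real (c n) * of_nat (Suc n) powr (-s))) \<le>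
      K * real (Suc n) powr (a - Re s)"
    unfolding norm_dirichlet_term by (simp add: abs_mult del: of_nat_Suc)
qed

lemma dirichlet_sums:
  assumes "summable (\<lambda>n. cmod (of_real (c n) * of_nat (Suc n) powr (-s)))"
  shows "(\<lambda>n. of_real (c n) * of_nat (Suc n) powr (-s)) sums dirichlet c s"
  unfolding dirichlet_def by (rule summable_sums[OF summable_norm_cancel[OF assms]])

lemma dirichlet_bounded_sums:
  assumes "\<And>n. \<bar>c n\<bar> \<le> K" and "Re s > 1"
  shows "summable (\<lambda>n. cmod (of_real (c n) * of_nat (Suc n) powr (-s)))"
    and "(\<lambda>n. of_real (c n) * of_nat (Suc n) powr (-s)) sums dirichlet c s"
proof -
  show "summable (\<lambda>n. cmod (of_real (c n) * of_nat (Suc n) powr (-s)))"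
    using summable_norm_dirichlet[of c K 0 s] assms by simp
  thus "(\<lambda>n. of_real (c n) * of_nat (Suc n) powr (-s)) sums dirichlet c s" by (rule dirichlet_sums)
qed

lemma dirichlet_term_majorant:
  assumes c: "\<And>n. \<bar>c n\<bar> \<le> K" and x: "Re x > 1"
  obtains d M where "d > 0" and "summable M" and
    "\<And>n y. dist x y < d \<Longrightarrow> cmod (of_real (c n) * of_nat (Suc n) powr (-y)) \<le> M n"
proof -
  have "K \<ge> 0" using c[of 0] by linarith
  obtain d where d: "d > 0" and ball: "cball x d \<subseteq> {w. 1 + d \<le> Re w}"
    using halfplane_Re_gt_neighbourhood[OF x] .
  show ?thesis
  proof
    show "d > 0" by fact
    show "summable (\<lambda>n. K * real (Suc n) powr (-1 - d))"
      using d by (intro summable_mult) (simp only: summable_Suc_powr_iff)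
    fix n y assume "dist x y < d"
    hence "y \<in> cball x d" by simp
    with ball have "1 + d \<le> Re y" by blast
    thus "cmod (of_real (c n) * of_nat (Suc n) powr (-y)) \<le> K * real (Suc n) powr (-1 - d)"
      unfolding norm_dirichlet_term using \<open>K \<ge> 0\<close> by (intro mult_mono c powr_mono) auto
  qed
qed

lemma has_field_derivative_dirichlet:
  assumes c: "\<And>n. \<bar>c n\<bar> \<le> K" and s: "Re s > 1"
  shows "(dirichlet c has_field_derivative - dirichlet (\<lambda>n. c n * ln (real (Suc n))) s) (at s)"
proof -
  let ?S = "{s. Re s > 1}"
  let ?f = "\<lambda>n s. of_real (c n) * of_nat (Suc n) powr (-s) :: complex"
  let ?f' = "\<lambda>n s. - (of_real (c n * ln (real (Suc n))) * of_nat (Suc n) powr (-s)) :: complex"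
  have "\<exists>g g'. \<forall>x\<in>?S. (\<lambda>n. ?f n x) sums g x \<and> (\<lambda>n. ?f' n x) sums g' x \<and>
     (g has_field_derivative g' x) (at x)"
  proof (rule series_and_derivative_comparison_complex[OF open_halfspace_Re_gt])
    fix n and x :: complex
    show "(?f n has_field_derivative ?f' n x) (at x)"
      unfolding powr_def Ln_of_nat[OF zero_less_Suc]
      by (auto intro!: derivative_eq_intros simp del: of_nat_Suc)
  next
    fix x assume "x \<in> ?S"
    then obtain d M where d: "d > 0" "summable M" and
      M: "\<And>n y. dist x y < d \<Longrightarrow> cmod (?f n y) \<le> M n"
      using dirichlet_term_majorant[of c K x, OF c] by blast
    have nonneg: "M n \<ge> 0" for n using order_trans[OF norm_ge_zero M[of x n]] d by simp
    show "\<exists>d h. 0 < d \<and> summable h \<and> range h \<subseteq> \<real>\<^sub>\<ge>\<^sub>0 \<and>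
      (\<forall>\<^sub>F n in sequentially. \<forall>y\<in>ball x d \<inter> ?S. cmod (?f n y) \<le> cmod (h n))"
      using d M nonneg
      by (intro exI[of _ d] exI[of _ "\<lambda>n. of_real (M n)"] conjI summable_of_real always_eventually)
         (auto simp del: of_nat_Suc)
  qed
  then obtain g g' where g: "\<And>x. x \<in> ?S \<Longrightarrow> (\<lambda>n. ?f n x) sums g x"
    "\<And>x. x \<in> ?S \<Longrightarrow> (\<lambda>n. ?f' n x) sums g' x"
    "\<And>x. x \<in> ?S \<Longrightarrow> (g has_field_derivative g' x) (at x)" by blast
  have "dirichlet c x = g x" if "x \<in> ?S" for x
    using g(1)[OF that] by (simp only: dirichlet_def sums_iff)
  moreover have "- dirichlet (\<lambda>n. c n * ln (real (Suc n))) s = g' s"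
    using sums_minus[OF g(2)[of s]] s
    by (simp add: dirichlet_def sums_iff minus_equation_iff del: of_nat_Suc)
  ultimately show ?thesis
    using s has_field_derivative_transform_within_open[OF g(3)[of s] open_halfspace_Re_gt, of 1]
    by simp
qed

lemma holomorphic_dirichlet:
  assumes "\<And>n. \<bar>c n\<bar> \<le> K"
  shows "dirichlet c holomorphic_on {s. Re s > 1}"
  using has_field_derivative_dirichlet[of c K, OF assms]
  by (auto simp: holomorphic_on_open open_halfspace_Re_gt)

lemma norm_dirichlet_minus_first_le:
  assumes c: "\<And>n. \<bar>c n\<bar> \<le> K" and s: "Re s \<ge> 2"
  shows "cmod (dirichlet c s - of_real (c 0)) \<le>
      K * 2 powr (2 - Re s) * (\<Sum>n. real (Suc n) powr (-2))"
proof -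
  have "K \<ge> 0" using c[of 0] by linarith
  have summable: "summable (\<lambda>n. real (Suc n) powr (-2))" by (simp only: summable_Suc_powr_iff)
  have "(\<lambda>n. of_real (c n) * of_nat (Suc n) powr (-s)) sums dirichlet c s"
    using s by (intro dirichlet_bounded_sums[OF c]) auto
  from sums_split_initial_segment[OF this, of 1]
  have sums: "(\<lambda>n. of_real (c (Suc n)) * of_nat (Suc (Suc n)) powr (-s)) sums
      (dirichlet c s - of_real (c 0))"
    by (simp del: of_nat_Suc) simp
  have term_le: "cmod (of_real (c (Suc n)) * of_nat (Suc (Suc n)) powr (-s)) \<le>
      K * 2 powr (2 - Re s) * real (Suc n) powr (-2)" for n
  proof -
    have "cmod (of_real (c (Suc n)) * of_nat (Suc (Suc n)) powr (-s)) \<le>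
        K * real (Suc (Suc n)) powr (- Re s)"
      unfolding norm_dirichlet_term by (intro mult_right_mono c) auto
    also have "\<dots> = K * (real (Suc (Suc n)) powr (2 - Re s) * real (Suc (Suc n)) powr (-2))"
      by (simp only: powr_add[symmetric]) simp
    also have "\<dots> \<le> K * (2 powr (2 - Re s) * real (Suc n) powr (-2))"
      using s \<open>K \<ge> 0\<close> by (intro mult_left_mono mult_mono powr_mono2') auto
    finally show ?thesis by simp
  qed
  have "cmod (\<Sum>n. of_real (c (Suc n)) * of_nat (Suc (Suc n)) powr (-s)) \<le>
      (\<Sum>n. K * 2 powr (2 - Re s) * real (Suc n) powr (-2))"
    by (rule norm_suminf_le[OF term_le]) (intro summable_mult summable)
  thus ?thesis
    using sums_unique[OF sums] suminf_mult[OF summable, of "K * 2 powr (2 - Re s)"] by simp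
qed

lemma tendsto_dirichlet_at_top:
  assumes c: "\<And>n. \<bar>c n\<bar> \<le> K"
  shows "((\<lambda>x. dirichlet c (of_real x)) \<longlongrightarrow> of_real (c 0)) at_top"
proof (rule LIM_zero_cancel, rule Lim_null_comparison)
  show "\<forall>\<^sub>F x in at_top. cmod (dirichlet c (of_real x) - of_real (c 0)) \<le>
         K * 2 powr (2 - x) * (\<Sum>n. real (Suc n) powr (-2))"
    using eventually_ge_at_top[of "2::real"]
    by eventually_elim (use norm_dirichlet_minus_first_le[of c K, OF c, of "of_real _"] in auto)
  have "((\<lambda>x. K * 2 powr (2 - x)) \<longlongrightarrow> K * 0) at_top" by (intro tendsto_intros) real_asymp
  thus "((\<lambda>x. K * 2 powr (2 - x) * (\<Sum>n. real (Suc n) powr (-2))) \<longlongrightarrow> 0) at_top"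
    by (intro tendsto_mult_left_zero) simp
qed

lemma has_sum_divisor_convolution:
  fixes f g :: "nat \<Rightarrow> complex"
  assumes f: "(f has_sum x) {0<..}" and g: "(g has_sum y) {0<..}"
  shows "((\<lambda>n. \<Sum>d | d dvd n. f d * g (n div d)) has_sum x * y) {0<..}"
proof -
  let ?A = "{0<..} :: nat set" and ?D = "SIGMA n:{0<..}. {d. d dvd n} :: (nat \<times> nat) set"
  have "(\<lambda>d. norm (f d)) summable_on ?A" "(\<lambda>m. norm (g m)) summable_on ?A"
    using f g by (auto simp: summable_on_iff_abs_summable_on_complex[symmetric] summable_on_def)
  hence "(\<lambda>p. norm (case p of (d, m) \<Rightarrow> f d * g m)) summable_on ?A \<times> ?A"
    unfolding Infinite_Sum.abs_summable_on_Sigma_iff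
    by (auto simp: norm_mult infsum_cmult_right abs_mult
       intro!: summable_on_cmult_right summable_on_cmult_left)
  then obtain S where S: "((\<lambda>(d, m). f d * g m) has_sum S) (?A \<times> ?A)"
    using Infinite_Sum.abs_summable_summable by (force simp: summable_on_def)
  have "((\<lambda>d. f d * y) has_sum S) ?A"
    by (rule has_sum_SigmaD[OF S]) (auto intro!: has_sum_cmult_right g)
  hence "S = x * y" using has_sum_cmult_left[OF f, of y] by (rule has_sum_unique)
  have bij: "bij_betw (\<lambda>(n, d). (d, n div d)) ?D (?A \<times> ?A)"
    by (rule bij_betwI[of _ _ _ "\<lambda>(d, m). (d * m, d)"]) (auto elim!: dvdE intro: Nat.gr0I)
  have "((\<lambda>(n, d). f d * g (n div d)) has_sum S) ?D"
    using has_sum_reindex_bij_betw[OF bij, of "\<lambda>(d, m). f d * g m" S] S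
    by (simp add: case_prod_unfold)
  hence "((\<lambda>n. \<Sum>d | d dvd n. f d * g (n div d)) has_sum S) ?A"
    by (rule has_sum_SigmaD) (auto intro!: has_sum_finite)
  thus ?thesis using \<open>S = x * y\<close> by simp
qed

lemma has_sum_dirichlet:
  assumes "summable (\<lambda>n. cmod (of_real (c (Suc n)) * of_nat (Suc n) powr (-s)))"
  shows "((\<lambda>n. of_real (c n) * of_nat n powr (-s)) has_sum dirichlet (\<lambda>n. c (Suc n)) s) {0<..}"
proof -
  have "bij_betw Suc UNIV {0<..}" by (rule bij_betwI[of _ _ _ "\<lambda>n. n - 1"]) auto
  thus ?thesis
    using norm_summable_imp_has_sum[OF assms dirichlet_sums[OF assms]]
    by (subst has_sum_reindex_bij_betw[symmetric]) (auto simp del: of_nat_Suc)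
qed


section \<open>The Dirichlet series of the logarithm\<close>

text \<open>The coefficient of \<open>(n + 1)\<^bsup>-s\<^esup>\<close> in \<open>log \<zeta>(s)\<close>. At \<open>n = 0\<close> the quotient is \<open>0 / 0 = 0\<close>.\<close>

definition log_coeff :: "nat \<Rightarrow> real" where
  "log_coeff n = mangoldt (Suc n) / ln (real (Suc n))"

lemma log_coeff_nonneg: "log_coeff n \<ge> 0"
  by (simp add: log_coeff_def mangoldt_nonneg del: of_nat_Suc)

lemma abs_log_coeff_le: "\<bar>log_coeff n\<bar> \<le> 1"
proof (cases "n = 0")
  case False
  hence "ln (real (Suc n)) > 0" by simp
  thus ?thesis
    using mangoldt_le[of "Suc n"] mangoldt_nonneg[of "Suc n"]
    by (simp add: log_coeff_def field_simps)
qed (simp add: log_coeff_def)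

lemma log_coeff_mult_ln: "log_coeff n * ln (real (Suc n)) = mangoldt (Suc n)"
  by (cases "n = 0") (simp_all add: log_coeff_def)

lemma log_coeff_0 [simp]: "log_coeff 0 = 0"
  by (simp add: log_coeff_def)

lemma summable_norm_dirichlet_ln:
  assumes c: "\<And>n. \<bar>c n\<bar> \<le> ln (real (Suc n))" and s: "Re s > 1"
  shows "summable (\<lambda>n. cmod (of_real (c n) * of_nat (Suc n) powr (-s)))"
proof -
  define \<delta> where "\<delta> = (Re s - 1) / 2"
  have \<delta>: "\<delta> > 0" "Re s > \<delta> + 1" using s by (auto simp: \<delta>_def field_simps)
  show ?thesis
  proof (rule summable_norm_dirichlet)
    show "\<bar>c n\<bar> \<le> 1 / \<delta> * real (Suc n) powr \<delta>" for n
      using c[of n] ln_powr_bound[of "real (Suc n)" \<delta>] \<delta>(1) by simp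
  qed (rule \<delta>(2))
qed

lemma of_nat_powr_divisor_mult:
  fixes z :: complex
  assumes "d dvd n" "n > 0"
  shows "of_nat d powr z * of_nat (n div d) powr z = of_nat n powr z"
proof -
  obtain m where m: "n = d * m" using \<open>d dvd n\<close> by auto
  hence "of_nat n powr z = complex_of_real (real d * real m) powr z" by simp
  also have "\<dots> = of_nat d powr z * of_nat m powr z"
    by (subst of_real_mult, subst powr_times_real) auto
  finally show ?thesis using m \<open>n > 0\<close> by simp
qed

lemma dirichlet_mangoldt_mult_zeta_series:
  assumes s: "Re s > 1"
  shows "dirichlet (\<lambda>n. mangoldt (Suc n)) s * zeta_series s = dirichlet (\<lambda>n. ln (real (Suc n))) s"
proof -
  have mangoldt: "((\<lambda>n. of_real (mangoldt n) * of_nat n powr (-s)) has_sum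
      dirichlet (\<lambda>n. mangoldt (Suc n)) s) {0<..}"
    using s by (intro has_sum_dirichlet summable_norm_dirichlet_ln)
      (auto simp: mangoldt_le mangoldt_nonneg simp del: of_nat_Suc)
  have one: "((\<lambda>n. of_real 1 * of_nat n powr (-s)) has_sum zeta_series s) {0<..}"
    unfolding zeta_series_eq_dirichlet
    using s by (intro has_sum_dirichlet dirichlet_bounded_sums) auto
  have convolution: "(\<Sum>d | d dvd n. of_real (mangoldt d) * of_nat d powr (-s) *
      (of_real 1 * of_nat (n div d) powr (-s))) =
      of_real (ln (real n)) * of_nat n powr (-s)" if n: "n \<in> {0<..}" for n
  proof -
    have "(\<Sum>d | d dvd n. of_real (mangoldt d) * of_nat d powr (-s) *
        (of_real 1 * of_nat (n div d) powr (-s))) =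
        (\<Sum>d | d dvd n. of_real (mangoldt d) * of_nat n powr (-s))"
      using n by (intro sum.cong) (auto simp: mult.assoc of_nat_powr_divisor_mult)
    also have "\<dots> = of_real (\<Sum>d | d dvd n. mangoldt d) * of_nat n powr (-s)"
      by (simp only: sum_distrib_right of_real_sum)
    also have "(\<Sum>d | d dvd n. mangoldt d) = ln (real n)" using n by (subst mangoldt_sum) auto
    finally show ?thesis .
  qed
  have "((\<lambda>n. of_real (ln (real n)) * of_nat n powr (-s)) has_sum
      dirichlet (\<lambda>n. mangoldt (Suc n)) s * zeta_series s) {0<..}"
    using has_sum_divisor_convolution[OF mangoldt one] by (subst (asm) has_sum_cong[OF convolution])
  moreover have "((\<lambda>n. of_real (ln (real n)) * of_nat n powr (-s)) has_sum
      dirichlet (\<lambda>n. ln (real (Suc n))) s) {0<..}"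
    using s by (intro has_sum_dirichlet summable_norm_dirichlet_ln) (auto simp del: of_nat_Suc)
  ultimately show ?thesis by (rule has_sum_unique)
qed

lemma zeta_series_eq_exp:
  assumes "Re s > 1"
  shows "zeta_series s = exp (dirichlet log_coeff s)"
proof -
  define h where "h = (\<lambda>s. zeta_series s * exp (- dirichlet log_coeff s))"
  have "(h has_field_derivative 0) (at s)" if s: "Re s > 1" for s
  proof -
    have "(dirichlet log_coeff has_field_derivative - dirichlet (\<lambda>n. mangoldt (Suc n)) s) (at s)"
      using has_field_derivative_dirichlet[of log_coeff 1, OF abs_log_coeff_le s]
      by (simp only: log_coeff_mult_ln)
    moreover have "(zeta_series has_field_derivative -
        (dirichlet (\<lambda>n. mangoldt (Suc n)) s * zeta_series s)) (at s)"
      unfolding dirichlet_mangoldt_mult_zeta_series[OF s]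
      unfolding zeta_series_eq_dirichlet[abs_def]
      using has_field_derivative_dirichlet[of "\<lambda>_. 1" 1 s] s by (simp del: of_nat_Suc)
    ultimately show ?thesis
      unfolding h_def by (auto intro!: derivative_eq_intros)
  qed
  then obtain c where c: "\<And>s. Re s > 1 \<Longrightarrow> h s = c"
    using has_field_derivative_zero_constant[OF convex_halfspace_Re_gt, of 1 h]
    by (auto simp: at_within_open[OF _ open_halfspace_Re_gt])
  have "((\<lambda>x. h (of_real x)) \<longlongrightarrow> of_real 1 * exp (- of_real (log_coeff 0))) at_top"
    unfolding h_def zeta_series_eq_dirichlet
    by (intro tendsto_intros tendsto_dirichlet_at_top[where K=1] abs_log_coeff_le) auto
  moreover have "((\<lambda>x. h (of_real x)) \<longlongrightarrow> c) at_top"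
    by (rule tendsto_eventually)
       (use eventually_gt_at_top[of "1::real"] in eventually_elim, auto intro!: c)
  ultimately have "c = 1" using tendsto_unique[OF trivial_limit_at_top_linorder] by force
  with c[OF assms] show ?thesis by (simp add: h_def exp_minus field_simps)
qed

corollary zeta_eq_exp: "Re s > 1 \<Longrightarrow> zeta s = exp (dirichlet log_coeff s)"
  by (simp add: zeta_eq_zeta_series zeta_series_eq_exp)

lemma Re_dirichlet_sums:
  assumes "\<And>n. \<bar>c n\<bar> \<le> K" and "a > 1"
  shows "(\<lambda>n. c n * real (Suc n) powr (-a) * cos (t * ln (real (Suc n)))) sums
      Re (dirichlet c (Complex a t))"
proof -
  have "Re (of_real (c n) * of_nat (Suc n) powr (- Complex a t)) =
      c n * real (Suc n) powr (-a) * cos (t * ln (real (Suc n)))" for n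
    unfolding Suc_powr_eq_cis by simp
  thus ?thesis
    using sums_Re[OF dirichlet_bounded_sums(2)[of c K "Complex a t", OF assms(1)]] assms(2)
    by (simp only: complex.sel)
qed

lemma dirichlet_three_four_one:
  assumes bounded: "\<And>n. \<bar>c n\<bar> \<le> K" and nonneg: "\<And>n. c n \<ge> 0" and a: "a > 1"
  shows "3 * Re (dirichlet c (Complex a 0)) + 4 * Re (dirichlet c (Complex a t)) +
     Re (dirichlet c (Complex a (2 * t))) \<ge> 0"
proof -
  let ?term = "\<lambda>t n. c n * real (Suc n) powr (-a) * cos (t * ln (real (Suc n)))"
  have cos_le: "3 + 4 * cos x + cos (2 * x) \<ge> 0" for x :: real
  proof -
    have "3 + 4 * cos x + cos (2 * x) = 2 * (1 + cos x)\<^sup>2"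
      unfolding cos_double_cos by (simp add: power2_eq_square algebra_simps)
    thus ?thesis by simp
  qed
  have term_nonneg: "3 * ?term 0 n + 4 * ?term t n + ?term (2 * t) n \<ge> 0" for n
  proof -
    have "c n * real (Suc n) powr (-a) *
        (3 + 4 * cos (t * ln (real (Suc n))) + cos (2 * (t * ln (real (Suc n))))) \<ge> 0"
      by (intro mult_nonneg_nonneg cos_le nonneg) auto
    thus ?thesis by (simp add: algebra_simps)
  qed
  have "(\<lambda>n. 3 * ?term 0 n + 4 * ?term t n + ?term (2 * t) n) sums
      (3 * Re (dirichlet c (Complex a 0)) + 4 * Re (dirichlet c (Complex a t)) +
        Re (dirichlet c (Complex a (2 * t))))"
    by (intro sums_add sums_mult Re_dirichlet_sums[OF bounded] a)
  thus ?thesis by (rule sums_le[OF term_nonneg sums_zero])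
qed

lemma zeta_three_four_one:
  assumes "a > 1"
  shows "cmod (zeta (Complex a 0)) ^ 3 * cmod (zeta (Complex a t)) ^ 4 *
      cmod (zeta (Complex a (2 * t))) \<ge> 1"
proof -
  let ?L = "\<lambda>t. Re (dirichlet log_coeff (Complex a t))"
  have "cmod (zeta (Complex a t)) = exp (?L t)" for t using assms by (simp add: zeta_eq_exp)
  hence "cmod (zeta (Complex a 0)) ^ 3 * cmod (zeta (Complex a t)) ^ 4 *
      cmod (zeta (Complex a (2 * t))) =
      exp (3 * ?L 0 + 4 * ?L t + ?L (2 * t))"
    by (simp only: exp_add exp_of_nat_mult[symmetric] of_nat_numeral)
  also have "\<dots> \<ge> 1"
    using dirichlet_three_four_one[of log_coeff 1, OF abs_log_coeff_le log_coeff_nonneg assms, of t]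
    by simp
  finally show ?thesis .
qed

lemma zeta_reg_one_plus:
  assumes "x > 0"
  shows "zeta_reg (of_real (1 + x)) = of_real x * zeta (Complex (1 + x) 0)"
proof -
  have "Complex (1 + x) 0 = of_real (1 + x)" by (rule complex_of_real_def[symmetric])
  thus ?thesis using zeta_reg_eq[of "of_real (1 + x)"] assms by simp
qed

lemma zeta_nonzero_Re_eq_1:
  assumes "t \<noteq> 0"
  shows "zeta (Complex 1 t) \<noteq> 0"
proof
  assume zero: "zeta (Complex 1 t) = 0"
  have deriv: "\<exists>D. (zeta has_field_derivative D) (at (Complex 1 u))" if "u \<noteq> 0" for u
    using holomorphic_on_imp_differentiable_at[OF holomorphic_zeta, of "Complex 1 u"] that
    by (auto simp: field_differentiable_def complex_eq_iff)
  obtain D where D: "(zeta has_field_derivative D) (at (Complex 1 t))"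
    using deriv[OF assms] by blast
  have "filterlim complex_of_real (at 0) (at_right 0)"
    by (rule filterlim_atI) (auto intro!: tendsto_eq_intros simp: eventually_at_filter)
  from filterlim_compose[OF D[unfolded DERIV_def] this]
  have quotient: "((\<lambda>x::real. zeta (Complex 1 t + of_real x) / of_real x) \<longlongrightarrow> D) (at_right 0)"
    using zero by simp
  have "isCont zeta (Complex 1 (2 * t))" using deriv[of "2 * t"] assms by (auto intro: DERIV_isCont)
  hence double: "((\<lambda>x::real. zeta (Complex 1 (2 * t) + of_real x)) \<longlongrightarrow>
      zeta (Complex 1 (2 * t))) (at_right 0)"
    by (rule isCont_tendsto_compose) (auto intro!: tendsto_eq_intros)
  define f where "f = (\<lambda>x::real. cmod (zeta_reg (of_real (1 + x))) ^ 3 *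
      cmod (zeta (Complex 1 t + of_real x) / of_real x) ^ 4 *
        cmod (zeta (Complex 1 (2 * t) + of_real x)) * x)"
  have "(f \<longlongrightarrow> 1 ^ 3 * cmod D ^ 4 * cmod (zeta (Complex 1 (2 * t))) * 0) (at_right 0)"
    unfolding f_def by (intro tendsto_intros quotient double tendsto_zeta_reg_1)
  moreover have "\<forall>\<^sub>F x in at_right (0::real). 1 \<le> f x"
    using eventually_at_right_less[of 0]
  proof eventually_elim
    case (elim x)
    have "Complex 1 u + of_real x = Complex (1 + x) u" for u by (simp add: complex_eq_iff)
    hence "f x = cmod (zeta (Complex (1 + x) 0)) ^ 3 * cmod (zeta (Complex (1 + x) t)) ^ 4 *
        cmod (zeta (Complex (1 + x) (2 * t)))"
      using elim unfolding f_def zeta_reg_one_plus[OF elim]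
      by (simp add: norm_mult norm_divide power_mult_distrib power_divide)
         (simp add: field_simps eval_nat_numeral)
    thus ?case using zeta_three_four_one[of "1 + x" t] elim by simp
  qed
  ultimately have "1 \<le> 1 ^ 3 * cmod D ^ 4 * cmod (zeta (Complex 1 (2 * t))) * 0"
    by (intro tendsto_lowerbound[where F="at_right 0"]) auto
  thus False by simp
qed

lemma sum_log_coeff_unbounded:
  assumes "a \<le> 1"
  shows "\<exists>M. (\<Sum>n<M. log_coeff n * real (Suc n) powr (-a)) > R"
proof -
  let ?L = "\<lambda>x. Re (dirichlet log_coeff (Complex (1 + x) 0))"
  have "\<forall>\<^sub>F x in at_right (0::real). cmod (zeta_reg (of_real (1 + x))) > 1/2"
    by (rule order_tendstoD[OF tendsto_zeta_reg_1]) simp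
  moreover have "\<forall>\<^sub>F x in at_right (0::real). 0 < x \<and> x < exp (- R) / 2"
    by (auto simp: eventually_at_right_field intro!: exI[of _ "exp (- R) / 2"])
  ultimately have "\<forall>\<^sub>F x in at_right (0::real). ?L x > R \<and> 0 < x"
  proof eventually_elim
    case (elim x)
    have "1/2 < x * exp (?L x)"
      using elim by (simp add: zeta_reg_one_plus norm_mult zeta_eq_exp del: of_real_add)
    also have "\<dots> \<le> exp (- R) / 2 * exp (?L x)" using elim by (intro mult_right_mono) auto
    also have "\<dots> = exp (?L x - R) / 2" by (simp add: exp_diff exp_minus field_simps)
    finally show ?case using elim by simp
  qed
  from eventually_happens[OF this] obtain x where x: "?L x > R" "x > 0" by auto
  have "(\<lambda>n. log_coeff n * real (Suc n) powr (-(1+x)) * cos (0 * ln (real (Suc n)))) sums ?L x"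
    using x by (intro Re_dirichlet_sums[of log_coeff 1] abs_log_coeff_le) auto
  hence "(\<lambda>N. \<Sum>n<N. log_coeff n * real (Suc n) powr (-(1+x))) \<longlonglongrightarrow> ?L x"
    by (simp add: sums_def del: of_nat_Suc)
  from order_tendstoD(1)[OF this x(1)] obtain M where
    "R < (\<Sum>n<M. log_coeff n * real (Suc n) powr (-(1+x)))"
    by (auto simp: eventually_at_top_linorder)
  also have "\<dots> \<le> (\<Sum>n<M. log_coeff n * real (Suc n) powr (-a))"
    using x assms by (intro sum_mono mult_left_mono powr_mono log_coeff_nonneg) auto
  finally show ?thesis by blast
qed


section \<open>The logarithm under the Riemann hypothesis\<close>

text \<open>Multiplying \<open>\<zeta>\<close> by \<open>(s - 1) / (s + 1)\<close> removes the pole at a cost of only \<open>O(1 / |s|)\<close> in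
  the logarithm.\<close>

definition pole_factor :: "complex \<Rightarrow> complex" where
  "pole_factor s = (s - 1) / (s + 1)"

lemma Re_pole_factor_pos:
  assumes "Re s > 1"
  shows "Re (pole_factor s) > 0"
proof -
  have "(Re s)\<^sup>2 > 1" using assms by (simp add: one_less_power)
  hence "(Re s - 1) * (Re s + 1) + Im s * Im s > 0"
    by (intro add_pos_nonneg) (auto simp: algebra_simps power2_eq_square)
  thus ?thesis
    unfolding pole_factor_def Re_divide
    using assms by (intro divide_pos_pos) (auto intro: add_pos_nonneg)
qed

lemma norm_pole_factor_le_1:
  assumes "Re s \<ge> 0"
  shows "cmod (pole_factor s) \<le> 1"
proof -
  have "cmod (s - 1) \<le> cmod (s + 1)"
    unfolding cmod_def
    using assms by (auto intro!: real_sqrt_le_mono simp: power2_eq_square algebra_simps)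
  thus ?thesis unfolding pole_factor_def norm_divide by (intro divide_le_eq_1[THEN iffD2]) auto
qed

lemma norm_Ln_pole_factor_le_Im:
  assumes "\<bar>Im s\<bar> > 4"
  shows "cmod (Ln (pole_factor s)) \<le> 4 / \<bar>Im s\<bar>"
proof -
  have Im_le: "\<bar>Im s\<bar> \<le> cmod (s + 1)" using abs_Im_le_cmod[of "s + 1"] by simp
  hence "s + 1 \<noteq> 0" using assms by auto
  hence eq: "pole_factor s = 1 + - (2 / (s + 1))" by (simp add: pole_factor_def field_simps)
  have small: "cmod (- (2 / (s + 1))) \<le> 2 / \<bar>Im s\<bar>"
    using assms Im_le by (simp add: norm_divide frac_le)
  also have "\<dots> < 1/2" using assms by (simp add: field_simps)
  finally have "cmod (Ln (pole_factor s)) \<le> 2 * cmod (- (2 / (s + 1)))"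
    unfolding eq by (rule norm_Ln_le)
  thus ?thesis using small by simp
qed

lemma norm_Ln_pole_factor_le:
  assumes s: "Re s > 1"
  shows "cmod (Ln (pole_factor s)) \<le> cmod (s + 1) / (Re s - 1) + pi"
proof -
  let ?z = "pole_factor s"
  have ne: "?z \<noteq> 0" using Re_pole_factor_pos[OF s] by auto
  have "\<bar>ln (cmod ?z)\<bar> = ln (1 / cmod ?z)"
    using norm_pole_factor_le_1[of s] s ne by (simp add: ln_div)
  also have "\<dots> \<le> 1 / cmod ?z" using ne by (intro less_imp_le[OF ln_less_self]) auto
  also have "\<dots> = cmod (s + 1) / cmod (s - 1)" by (simp add: pole_factor_def norm_divide)
  also have "\<dots> \<le> cmod (s + 1) / (Re s - 1)"
    using s complex_Re_le_cmod[of "s - 1"] by (intro divide_left_mono mult_pos_pos) auto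
  finally have "\<bar>Re (Ln ?z)\<bar> \<le> cmod (s + 1) / (Re s - 1)" using ne by simp
  moreover have "\<bar>Im (Ln ?z)\<bar> \<le> pi"
    using mpi_less_Im_Ln[OF ne] Im_Ln_le_pi[OF ne] by linarith
  ultimately show ?thesis using cmod_le[of "Ln ?z"] by linarith
qed

definition depoled_zeta :: "complex \<Rightarrow> complex" where
  "depoled_zeta s = zeta_reg s / (s + 1)"

lemma depoled_zeta_eq: "Re s > 0 \<Longrightarrow> s \<noteq> 1 \<Longrightarrow> depoled_zeta s = pole_factor s * zeta s"
  by (simp add: depoled_zeta_def pole_factor_def zeta_reg_eq)

lemma holomorphic_depoled_zeta: "depoled_zeta holomorphic_on {s. Re s > 0}"
  unfolding depoled_zeta_def[abs_def]
  by (intro holomorphic_intros holomorphic_zeta_reg) (auto simp: complex_eq_iff)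

lemma norm_depoled_zeta_le:
  assumes "\<sigma> > 0"
  obtains C where "C \<ge> 1" and "\<And>s. Re s \<ge> \<sigma> \<Longrightarrow> cmod (depoled_zeta s) \<le> C * (1 + cmod s)\<^sup>2"
proof -
  obtain C where C: "C > 0" "\<And>s. Re s \<ge> \<sigma> \<Longrightarrow> cmod (zeta_reg s) \<le> C * (1 + cmod s)\<^sup>2"
    using norm_zeta_reg_le[OF assms] by blast
  show ?thesis
  proof
    fix s assume s: "Re s \<ge> \<sigma>"
    have "cmod (s + 1) \<ge> 1" using complex_Re_le_cmod[of "s + 1"] s assms by simp
    hence "cmod (depoled_zeta s) \<le> cmod (zeta_reg s) / 1"
      unfolding depoled_zeta_def norm_divide by (intro divide_left_mono) auto
    thus "cmod (depoled_zeta s) \<le> (C + 1) * (1 + cmod s)\<^sup>2"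
      using C(2)[OF s] by (simp add: distrib_right add_increasing2)
  qed (use C in simp)
qed

lemma depoled_zeta_nonzero:
  assumes RH: "riemann_hypothesis" and s: "Re s > 1/2"
  shows "depoled_zeta s \<noteq> 0"
proof (cases "s = 1")
  case False
  consider "Re s < 1" | "Re s = 1" | "Re s > 1" by linarith
  hence "zeta s \<noteq> 0"
  proof cases
    assume "Re s < 1"
    thus ?thesis using RH s unfolding riemann_hypothesis_def by force
  next
    assume "Re s = 1"
    hence "s = Complex 1 (Im s)" "Im s \<noteq> 0" using False by (auto simp: complex_eq_iff)
    thus ?thesis using zeta_nonzero_Re_eq_1 by metis
  next
    assume "Re s > 1"
    thus ?thesis by (simp add: zeta_eq_exp)
  qed
  moreover have "s + 1 \<noteq> 0" using s by (auto simp: complex_eq_iff)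
  ultimately show ?thesis using depoled_zeta_eq[of s] s False by (simp add: pole_factor_def)
qed (simp add: depoled_zeta_def)

locale log_depoled_zeta =
  fixes F :: "complex \<Rightarrow> complex"
  assumes holomorphic: "F holomorphic_on {s. Re s > 1/2}"
    and exp_eq: "Re s > 1/2 \<Longrightarrow> exp (F s) = depoled_zeta s"
    and eq_dirichlet: "Re s > 1 \<Longrightarrow> F s = dirichlet log_coeff s + Ln (pole_factor s)"

lemma holomorphic_exp_eq_imp_diff_const:
  assumes S: "convex S" "open S" and hol: "f holomorphic_on S" "g holomorphic_on S"
    and exp_eq: "\<And>z. z \<in> S \<Longrightarrow> exp (f z) = exp (g z)"
  shows "\<exists>c. \<forall>z\<in>S. f z - g z = c"
proof (rule has_field_derivative_zero_constant[OF S(1)])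
  fix z assume z: "z \<in> S"
  have f: "(f has_field_derivative deriv f z) (at z)"
    and g: "(g has_field_derivative deriv g z) (at z)"
    using hol holomorphic_derivI[OF _ S(2) z] by blast+
  have "((\<lambda>z. exp (f z)) has_field_derivative exp (g z) * deriv g z) (at z)"
    by (rule has_field_derivative_transform_within_open[OF DERIV_chain2[OF DERIV_exp g] S(2) z])
       (simp add: exp_eq)
  hence "exp (g z) * deriv f z = exp (g z) * deriv g z"
    using DERIV_unique[OF DERIV_chain2[OF DERIV_exp f]] exp_eq[OF z] by simp
  thus "((\<lambda>z. f z - g z) has_field_derivative 0) (at z within S)"
    using has_field_derivative_at_within[OF DERIV_diff[OF f g]] by simp
qed

lemma ex_log_depoled_zeta:
  assumes RH: "riemann_hypothesis"
  obtains F where "log_depoled_zeta F"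
proof -
  let ?H = "{s. Re s > 1/2}" and ?S = "{s. Re s > 1}"
  define G where "G = (\<lambda>s. dirichlet log_coeff s + Ln (pole_factor s))"
  have "depoled_zeta holomorphic_on ?H"
    by (rule holomorphic_on_subset[OF holomorphic_depoled_zeta]) auto
  then obtain g where g: "g holomorphic_on ?H" "\<And>s. s \<in> ?H \<Longrightarrow> exp (g s) = depoled_zeta s"
    using holomorphic_logarithm_exists[OF convex_halfspace_Re_gt open_halfspace_Re_gt,
      of depoled_zeta "1/2" 1] depoled_zeta_nonzero[OF RH] by auto
  have "pole_factor holomorphic_on ?S"
    unfolding pole_factor_def[abs_def] by (intro holomorphic_intros) (auto simp: complex_eq_iff)
  hence "G holomorphic_on ?S"
    unfolding G_def using Re_pole_factor_pos
    by (intro holomorphic_intros holomorphic_dirichlet[OF abs_log_coeff_le])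
       (force elim!: nonpos_Reals_cases)+
  moreover have exp_g: "exp (g s) = exp (G s)" if s: "s \<in> ?S" for s
  proof -
    have "s \<noteq> 1" "pole_factor s \<noteq> 0" using s Re_pole_factor_pos[of s] by auto
    thus ?thesis using s g(2)[of s] depoled_zeta_eq[of s] by (simp add: G_def exp_add zeta_eq_exp)
  qed
  moreover have "g holomorphic_on ?S" by (rule holomorphic_on_subset[OF g(1)]) auto
  ultimately have "\<exists>c. \<forall>s\<in>?S. g s - G s = c"
    by (intro holomorphic_exp_eq_imp_diff_const convex_halfspace_Re_gt open_halfspace_Re_gt)
  then obtain c where c: "\<And>s. s \<in> ?S \<Longrightarrow> g s - G s = c" by blast
  have "exp c = 1" using c[of 2] exp_g[of 2] by (auto simp: exp_diff)
  have "log_depoled_zeta (\<lambda>s. g s - c)"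
  proof
    show "(\<lambda>s. g s - c) holomorphic_on ?H" by (intro holomorphic_intros g)
    show "exp (g s - c) = depoled_zeta s" if "Re s > 1/2" for s
      using that g(2)[of s] \<open>exp c = 1\<close> by (simp add: exp_diff)
    show "g s - c = dirichlet log_coeff s + Ln (pole_factor s)" if "Re s > 1" for s
      using c[of s] that by (simp add: G_def algebra_simps)
  qed
  thus ?thesis by (rule that)
qed

lemma Borel_Caratheodory_unit_ball:
  assumes hol: "h holomorphic_on ball 0 1" and h0: "h 0 = 0"
    and Re_less: "\<And>x. cmod x < 1 \<Longrightarrow> Re (h x) < M" and x: "cmod x < 1"
  shows "cmod (h x) \<le> 2 * M * cmod x / (1 - cmod x)"
proof -
  have M: "M > 0" using Re_less[of 0] h0 by simp
  have less: "cmod (h y) < cmod (2 * of_real M - h y)" if "cmod y < 1" for y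
  proof -
    have "(cmod (2 * of_real M - h y))\<^sup>2 - (cmod (h y))\<^sup>2 = 4 * M * (M - Re (h y))"
      unfolding cmod_power2 by (simp add: power2_eq_square algebra_simps)
    moreover have "4 * M * (M - Re (h y)) > 0" using M Re_less[OF that] by simp
    ultimately have "(cmod (h y))\<^sup>2 < (cmod (2 * of_real M - h y))\<^sup>2" by linarith
    thus ?thesis by (rule power_less_imp_less_base) simp
  qed
  hence ne: "2 * of_real M - h y \<noteq> 0" if "cmod y < 1" for y using that by force
  have "cmod (h x / (2 * of_real M - h x)) \<le> cmod x"
  proof (rule Schwarz_Lemma(1)[where f="\<lambda>y. h y / (2 * of_real M - h y)"])
    show "(\<lambda>y. h y / (2 * of_real M - h y)) holomorphic_on ball 0 1"
      using ne by (intro holomorphic_intros hol) auto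
    show "cmod (h y / (2 * of_real M - h y)) < 1" if "cmod y < 1" for y
      using less[OF that] ne[OF that] by (simp add: norm_divide)
  qed (use h0 x in auto)
  hence "cmod (h x) \<le> cmod x * cmod (2 * of_real M - h x)"
    using ne[OF x] by (simp add: norm_divide divide_le_eq)
  also have "\<dots> \<le> cmod x * (2 * M + cmod (h x))"
    using norm_triangle_ineq4[of "2 * of_real M" "h x"] M
    by (intro mult_left_mono) (auto simp: norm_mult)
  finally show ?thesis using x by (simp add: field_simps)
qed

lemma Borel_Caratheodory:
  assumes hol: "f holomorphic_on ball z R" and Re_less: "\<And>w. w \<in> ball z R \<Longrightarrow> Re (f w) < M"
    and r: "dist z w \<le> r" "r < R"
  shows "cmod (f w - f z) \<le> 2 * (M - Re (f z)) * (r / (R - r))"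
proof -
  have R: "R > 0" "0 \<le> r" using r zero_le_dist[of z w] by linarith+
  define x where "x = (w - z) / of_real R"
  have in_ball: "z + of_real R * y \<in> ball z R" if "cmod y < 1" for y
    using that R by (simp add: dist_norm norm_mult)
  have x_le: "cmod x \<le> r / R"
    using r R by (simp add: x_def norm_divide dist_norm norm_minus_commute divide_right_mono)
  moreover have "r / R < 1" using r R by simp
  ultimately have x: "cmod x < 1" by linarith
  have M: "Re (f z) < M" using Re_less[of z] R by simp
  define h where "h = (\<lambda>y. f (z + of_real R * y) - f z)"
  have "h holomorphic_on ball 0 1"
    unfolding h_def
    by (intro holomorphic_intros holomorphic_on_compose_gen[OF _ hol, unfolded o_def])
       (auto intro!: holomorphic_intros in_ball)
  moreover have "Re (h y) < M - Re (f z)" if "cmod y < 1" for y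
    using Re_less[OF in_ball[OF that]] by (simp add: h_def)
  ultimately have "cmod (h x) \<le> 2 * (M - Re (f z)) * cmod x / (1 - cmod x)"
    using x by (intro Borel_Caratheodory_unit_ball) (auto simp: h_def)
  also have "\<dots> \<le> 2 * (M - Re (f z)) * (r / R) / (1 - r / R)"
    using x_le \<open>r / R < 1\<close> M R by (intro frac_le mult_left_mono) auto
  also have "\<dots> = 2 * (M - Re (f z)) * (r / (R - r))" using R r by (simp add: field_simps)
  finally show ?thesis using R by (simp add: h_def x_def)
qed

context log_depoled_zeta
begin

lemma Re_less:
  assumes "Re s > 1/2"
  shows "Re (F s) < cmod (depoled_zeta s)"
  using exp_gt_self[of "Re (F s)"] exp_eq[OF assms] by (metis norm_exp_eq_Re)

lemma norm_Re_eq_2_le: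
  obtains K where "\<And>t. cmod (F (Complex 2 t)) \<le> K * (1 + \<bar>t\<bar>)"
proof
  define S where "S = (\<Sum>n. real (Suc n) powr (-2))"
  fix t
  have S: "cmod (dirichlet log_coeff (Complex 2 t)) \<le> S"
    using norm_dirichlet_minus_first_le[of log_coeff 1 "Complex 2 t", OF abs_log_coeff_le]
    by (simp add: S_def del: of_nat_Suc)
  have "cmod (Ln (pole_factor (Complex 2 t))) \<le> cmod (Complex 2 t + 1) / 1 + pi"
    using norm_Ln_pole_factor_le[of "Complex 2 t"] by simp
  also have "\<dots> \<le> 3 + \<bar>t\<bar> + pi" using cmod_le[of "Complex 2 t + 1"] by simp
  finally have "cmod (F (Complex 2 t)) \<le> S + (3 + \<bar>t\<bar> + pi)"
    using S norm_triangle_le[OF add_mono] by (simp add: eq_dirichlet norm_triangle_le)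
  moreover have "0 \<le> (S + 3 + pi) * \<bar>t\<bar>"
    using order_trans[OF norm_ge_zero S] by simp
  ultimately show "cmod (F (Complex 2 t)) \<le> (S + 4 + pi) * (1 + \<bar>t\<bar>)"
    by (simp add: algebra_simps)
qed

lemma Re_less_quadratic:
  obtains C where "C \<ge> 0"
    and "\<And>t w. dist (Complex 2 t) w < 3/2 \<Longrightarrow> Re (F w) < C * (1 + \<bar>t\<bar>)\<^sup>2"
proof -
  obtain C where C: "C \<ge> 1" "\<And>s. Re s \<ge> 1/2 \<Longrightarrow> cmod (depoled_zeta s) \<le> C * (1 + cmod s)\<^sup>2"
    using norm_depoled_zeta_le[of "1/2"] by auto
  show ?thesis
  proof
    fix t w assume dist: "dist (Complex 2 t) w < 3/2"
    hence Re_w: "Re w > 1/2" using abs_Re_le_cmod[of "Complex 2 t - w"] by (auto simp: dist_norm)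
    have "1 + cmod w \<le> 5 * (1 + \<bar>t\<bar>)"
      using dist norm_triangle_ineq2[of w "Complex 2 t"] cmod_le[of "Complex 2 t"]
      by (simp add: dist_norm norm_minus_commute)
    hence "(1 + cmod w)\<^sup>2 \<le> (5 * (1 + \<bar>t\<bar>))\<^sup>2" by (intro power_mono) auto
    hence "C * (1 + cmod w)\<^sup>2 \<le> C * (25 * (1 + \<bar>t\<bar>)\<^sup>2)"
      unfolding power_mult_distrib using C(1) by (intro mult_left_mono) auto
    thus "Re (F w) < 25 * C * (1 + \<bar>t\<bar>)\<^sup>2" using Re_less[OF Re_w] C(2)[of w] Re_w by simp
  qed (use C(1) in simp)
qed

lemma norm_le_quadratic:
  assumes \<epsilon>: "\<epsilon> > 0"
  obtains C where "C \<ge> 0"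
    and "\<And>s. 1/2 + \<epsilon> \<le> Re s \<Longrightarrow> Re s \<le> 2 \<Longrightarrow> cmod (F s) \<le> C * (1 + \<bar>Im s\<bar>)\<^sup>2"
proof -
  obtain C where C: "C \<ge> 0" "\<And>t w. dist (Complex 2 t) w < 3/2 \<Longrightarrow> Re (F w) < C * (1 + \<bar>t\<bar>)\<^sup>2"
    using Re_less_quadratic by blast
  obtain K where K: "\<And>t. cmod (F (Complex 2 t)) \<le> K * (1 + \<bar>t\<bar>)"
    using norm_Re_eq_2_le by blast
  have K_nonneg: "K \<ge> 0" using order_trans[OF norm_ge_zero K[of 0]] by simp
  define r where "r = max 0 (3/2 - \<epsilon>)"
  have r: "0 \<le> r" "r < 3/2" using \<epsilon> by (auto simp: r_def max_def)
  define \<rho> where "\<rho> = r / (3/2 - r)"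
  have \<rho>: "\<rho> \<ge> 0" using r by (simp add: \<rho>_def)
  define D where "D = K + 2 * (C + K) * \<rho>"
  have "cmod (F s) \<le> D * (1 + \<bar>Im s\<bar>)\<^sup>2" if s: "1/2 + \<epsilon> \<le> Re s" "Re s \<le> 2" for s
  proof -
    define z where "z = Complex 2 (Im s)"
    define q where "q = (1 + \<bar>Im s\<bar>)\<^sup>2"
    have "1 + \<bar>Im s\<bar> \<le> q" unfolding q_def by (rule self_le_power) auto
    hence Fz: "cmod (F z) \<le> K * q"
      using K[of "Im s"] mult_left_mono[OF _ K_nonneg, of "1 + \<bar>Im s\<bar>" q] by (simp add: z_def)
    have "Re w > 1/2" if "dist z w < 3/2" for w
      using that abs_Re_le_cmod[of "z - w"] by (auto simp: dist_norm z_def)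
    hence "F holomorphic_on ball z (3/2)" by (intro holomorphic_on_subset[OF holomorphic]) auto
    moreover have "dist z s \<le> r"
    proof -
      have "dist z s = \<bar>2 - Re s\<bar>" by (simp add: dist_norm z_def cmod_def)
      thus ?thesis using s by (simp add: r_def)
    qed
    ultimately have "cmod (F s - F z) \<le> 2 * (C * q - Re (F z)) * \<rho>"
      unfolding \<rho>_def using r C(2)[of "Im s"] by (intro Borel_Caratheodory) (auto simp: z_def q_def)
    also have "\<dots> \<le> 2 * (C * q + K * q) * \<rho>"
      using Fz abs_Re_le_cmod[of "F z"] \<rho> by (intro mult_right_mono mult_left_mono) auto
    finally have "cmod (F s) \<le> K * q + 2 * (C * q + K * q) * \<rho>"
      using Fz norm_triangle_sub[of "F s" "F z"] by linarith
    thus ?thesis by (simp add: D_def q_def algebra_simps)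
  qed
  moreover have "D \<ge> 0" using K_nonneg \<rho> C(1) by (simp add: D_def)
  ultimately show ?thesis by (rule that[rotated])
qed

end


section \<open>Integrals along horizontal lines\<close>

lemma integrable_majorant:
  fixes f :: "'a \<Rightarrow> 'b::{banach, second_countable_topology}"
  assumes "integrable M g" and "f \<in> borel_measurable M" and "\<And>x. norm (f x) \<le> g x"
  shows "integrable M f"
  by (rule Bochner_Integration.integrable_bound[OF assms(1,2)])
     (use assms(3) order_trans[OF _ abs_ge_self] in \<open>auto simp: real_norm_def\<close>)

lemma norm_integral_le_majorant:
  fixes f :: "'a \<Rightarrow> 'b::{banach, second_countable_topology}"
  assumes "integrable M g" and "\<And>x. norm (f x) \<le> g x"
  shows "norm (integral\<^sup>L M f) \<le> integral\<^sup>L M g"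
  by (rule order_trans[OF integral_norm_bound integral_mono'])
     (use assms order_trans[OF norm_ge_zero] in blast)+

lemma integral_derivative_eq_0:
  fixes W w :: "real \<Rightarrow> 'a::euclidean_space"
  assumes deriv: "\<And>x. (W has_vector_derivative w x) (at x)"
    and cont: "continuous_on UNIV w" and int: "integrable lborel w"
    and lim: "(W \<longlongrightarrow> 0) at_top" "(W \<longlongrightarrow> 0) at_bot"
  shows "(LINT x|lborel. w x) = 0"
proof -
  have "(LBINT x=-\<infinity>..\<infinity>. w x) = 0 - 0"
    using cont int lim deriv
    by (intro interval_integral_FTC_integrable[where F=W])
       (auto simp: ereal_tendsto_simps continuous_on_eq_continuous_at
         einterval_eq_UNIV set_integrable_def)
  thus ?thesis
    by (simp add: interval_lebesgue_integral_def einterval_eq_UNIV set_lebesgue_integral_def)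
qed

lemma has_vector_derivative_along_horizontal_line:
  assumes "(f has_field_derivative D) (at (Complex x y))"
  shows "((\<lambda>x. f (Complex x y)) has_vector_derivative D) (at x)"
proof -
  have "((\<lambda>x. Complex x y) has_vector_derivative 1) (at x)"
    unfolding Complex_eq by (auto intro!: derivative_eq_intros)
  from field_vector_diff_chain_at[OF this assms] show ?thesis by (simp add: o_def)
qed

lemma continuous_on_horizontal_line:
  assumes "continuous_on S f" and "\<And>x. Complex x y \<in> S"
  shows "continuous_on UNIV (\<lambda>x. f (Complex x y))"
  by (rule continuous_on_compose2[OF assms(1)]) (use assms(2) in \<open>auto intro!: continuous_intros\<close>)

lemma integrable_along_horizontal_line:
  assumes "continuous_on S f" and "\<And>x. Complex x y \<in> S"
    and "integrable lborel g" and "\<And>x. cmod (f (Complex x y)) \<le> g x"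
  shows "integrable lborel (\<lambda>x. f (Complex x y))"
proof (rule integrable_majorant[OF assms(3) _ assms(4)])
  show "(\<lambda>x. f (Complex x y)) \<in> borel_measurable lborel"
    using continuous_on_horizontal_line[OF assms(1,2)]
    by (simp add: borel_measurable_continuous_onI)
qed

lemma norm_primitive_vertical_diff_le:
  assumes "a \<le> b"
    and P: "\<And>y. a \<le> y \<Longrightarrow> y \<le> b \<Longrightarrow> (P has_field_derivative f (Complex x y)) (at (Complex x y))"
    and bound: "\<And>y. a \<le> y \<Longrightarrow> y \<le> b \<Longrightarrow> cmod (f (Complex x y)) \<le> M"
  shows "cmod (P (Complex x a) - P (Complex x b)) \<le> M * (b - a)"
proof -
  let ?seg = "closed_segment (Complex x b) (Complex x a)"
  have seg: "\<exists>y. u = Complex x y \<and> a \<le> y \<and> y \<le> b" if "u \<in> ?seg" for u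
    using that \<open>a \<le> b\<close>
    by (subst (asm) closed_segment_same_Re)
       (auto simp: closed_segment_eq_real_ivl complex_eq_iff split: if_splits)
  have "cmod (P (Complex x a) - P (Complex x b)) \<le> M * cmod (Complex x a - Complex x b)"
  proof (rule field_differentiable_bound[where S="?seg" and f'=f])
    show "(P has_field_derivative f u) (at u within ?seg)" if "u \<in> ?seg" for u
      using seg[OF that] P has_field_derivative_at_within by blast
    show "cmod (f u) \<le> M" if "u \<in> ?seg" for u using seg[OF that] bound by auto
  qed auto
  also have "cmod (Complex x a - Complex x b) = b - a" using \<open>a \<le> b\<close> by (simp add: cmod_def)
  finally show ?thesis .
qed

lemma integral_horizontal_lines_eq:
  assumes S: "open S" "convex S" and hol: "f holomorphic_on S"
    and strip: "\<And>u. a \<le> Im u \<Longrightarrow> Im u \<le> b \<Longrightarrow> u \<in> S"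
    and bound: "\<And>u. a \<le> Im u \<Longrightarrow> Im u \<le> b \<Longrightarrow> cmod (f u) \<le> g (Re u)"
    and g: "integrable lborel g" "(g \<longlongrightarrow> 0) at_top" "(g \<longlongrightarrow> 0) at_bot" and "a \<le> b"
  shows "(LINT x|lborel. f (Complex x a)) = (LINT x|lborel. f (Complex x b))"
proof -
  obtain P where P: "\<And>u. u \<in> S \<Longrightarrow> (P has_field_derivative f u) (at u)"
    using holomorphic_convex_primitive'[OF S(2,1) hol] S(1) by (metis at_within_open)
  have cont: "continuous_on S f" by (rule holomorphic_on_imp_continuous_on[OF hol])
  have int: "integrable lborel (\<lambda>x. f (Complex x y))" if "a \<le> y" "y \<le> b" for y
    using that bound[of "Complex _ y"]
    by (intro integrable_along_horizontal_line[OF cont strip g(1)]) auto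
  define W where "W = (\<lambda>x. P (Complex x a) - P (Complex x b))"
  have W_le: "cmod (W x) \<le> g x * (b - a)" for x
    unfolding W_def using bound[of "Complex x _"] \<open>a \<le> b\<close>
    by (intro norm_primitive_vertical_diff_le[where f=f] P strip) auto
  have "(LINT x|lborel. f (Complex x a) - f (Complex x b)) = 0"
  proof (rule integral_derivative_eq_0)
    show "(W has_vector_derivative f (Complex x a) - f (Complex x b)) (at x)" for x
      unfolding W_def using \<open>a \<le> b\<close>
      by (intro has_vector_derivative_diff has_vector_derivative_along_horizontal_line P strip) auto
    show "continuous_on UNIV (\<lambda>x. f (Complex x a) - f (Complex x b))"
      using \<open>a \<le> b\<close> by (intro continuous_on_diff continuous_on_horizontal_line[OF cont] strip) auto
    show "integrable lborel (\<lambda>x. f (Complex x a) - f (Complex x b))"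
      using \<open>a \<le> b\<close> by (intro Bochner_Integration.integrable_diff int) auto
    show "(W \<longlongrightarrow> 0) at_top" "(W \<longlongrightarrow> 0) at_bot"
      by (rule Lim_null_comparison[OF always_eventually[OF allI[OF W_le]]],
          rule tendsto_mult_left_zero, rule g)+
  qed
  thus ?thesis using int \<open>a \<le> b\<close> by simp
qed

lemma integral_derivative_mult_cis:
  fixes f f' :: "real \<Rightarrow> complex"
  assumes deriv: "\<And>x. (f has_vector_derivative f' x) (at x)"
    and cont: "continuous_on UNIV f'" and int: "integrable lborel f" "integrable lborel f'"
    and lim: "(f \<longlongrightarrow> 0) at_top" "(f \<longlongrightarrow> 0) at_bot"
  shows "(LINT x|lborel. f' x * cis (- (x * \<xi>))) =
      \<i> * of_real \<xi> * (LINT x|lborel. f x * cis (- (x * \<xi>)))"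
proof -
  let ?w = "\<lambda>x. f' x * cis (- (x * \<xi>)) - \<i> * of_real \<xi> * (f x * cis (- (x * \<xi>)))"
  have int_cis: "integrable lborel (\<lambda>x. h x * cis (- (x * \<xi>)))" if "integrable lborel h" for h
  proof (rule Bochner_Integration.integrable_bound[OF that])
    have "(\<lambda>x. cis (- (x * \<xi>))) \<in> borel_measurable borel"
      by (intro borel_measurable_continuous_onI continuous_intros)
    thus "(\<lambda>x. h x * cis (- (x * \<xi>))) \<in> borel_measurable lborel"
      using borel_measurable_integrable[OF that] by measurable
  qed (simp add: norm_mult)
  have "continuous_on UNIV f"
    using deriv by (auto intro!: continuous_at_imp_continuous_on has_vector_derivative_continuous)
  hence cont_w: "continuous_on UNIV ?w" by (intro continuous_intros cont)
  have deriv_w: "((\<lambda>x. f x * cis (- (x * \<xi>))) has_vector_derivative ?w x) (at x)" for x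
  proof -
    have "((\<lambda>x. cis (- (x * \<xi>))) has_vector_derivative (- \<i> * of_real \<xi>) * cis (- (x * \<xi>))) (at x)"
      unfolding has_vector_derivative_def
      by (auto intro!: derivative_eq_intros simp: scaleR_conv_of_real algebra_simps)
    from has_vector_derivative_mult[OF deriv[of x] this] show ?thesis by (simp add: algebra_simps)
  qed
  have lim_w: "((\<lambda>x. f x * cis (- (x * \<xi>))) \<longlongrightarrow> 0) F" if "(f \<longlongrightarrow> 0) F" for F
    using tendsto_norm_zero[OF that]
    by (intro tendsto_norm_zero_cancel[where f="\<lambda>x. f x * _ x"]) (simp add: norm_mult)
  have "(LINT x|lborel. ?w x) = 0"
    using int int_cis
    by (intro integral_derivative_eq_0[OF deriv_w cont_w] lim_w lim
          Bochner_Integration.integrable_diff integrable_mult_right) auto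
  thus ?thesis using int_cis[OF int(1)] int_cis[OF int(2)] by simp
qed


section \<open>Gaussian majorants\<close>

definition gauss_exp :: "real \<Rightarrow> real \<Rightarrow> real \<Rightarrow> real" where
  "gauss_exp b c x = exp (b * \<bar>x\<bar> - c * x\<^sup>2)"

lemma gauss_exp_nonneg [simp]: "gauss_exp b c x \<ge> 0"
  by (simp add: gauss_exp_def)

lemma exp_abs_mult_gauss_exp: "exp (a * \<bar>x\<bar>) * gauss_exp b c x = gauss_exp (a + b) c x"
  by (simp add: gauss_exp_def exp_add[symmetric] algebra_simps)

lemma borel_measurable_gauss_exp [measurable]: "gauss_exp b c \<in> borel_measurable borel"
  unfolding gauss_exp_def[abs_def] by measurable

lemma has_bochner_integral_gauss_exp_0:
  assumes "c > 0"
  shows "has_bochner_integral lborel (gauss_exp 0 c) (sqrt (pi / c))"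
proof -
  define \<sigma> where "\<sigma> = sqrt (1 / (2 * c))"
  have \<sigma>: "\<sigma> > 0" "\<sigma>\<^sup>2 = 1 / (2 * c)" using assms by (auto simp: \<sigma>_def)
  have "gauss_exp 0 c = (\<lambda>x. sqrt (pi / c) * normal_density 0 \<sigma> x)"
    using assms by (auto simp: fun_eq_iff gauss_exp_def normal_density_def \<sigma>(2) mult.commute)
  moreover have "has_bochner_integral lborel
      (\<lambda>x. sqrt (pi / c) * normal_density 0 \<sigma> x) (sqrt (pi / c) * 1)"
    using integrable_normal_density[OF \<sigma>(1), of 0] integral_normal_density[OF \<sigma>(1), of 0]
    by (intro has_bochner_integral_mult_right) (simp add: has_bochner_integral_iff)
  ultimately show ?thesis by simp
qed

lemma integrable_gauss_exp:
  assumes "c > 0"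
  shows "integrable lborel (gauss_exp b c)"
proof (rule integrable_majorant)
  show "integrable lborel (\<lambda>x. exp (b\<^sup>2 / (2 * c)) * gauss_exp 0 (c / 2) x)"
    using has_bochner_integral_gauss_exp_0[of "c / 2"] assms by (simp add: has_bochner_integral_iff)
  show "norm (gauss_exp b c x) \<le> exp (b\<^sup>2 / (2 * c)) * gauss_exp 0 (c / 2) x" for x
  proof -
    have "0 \<le> (c * \<bar>x\<bar> - b)\<^sup>2 / (2 * c)" using assms by simp
    also have "\<dots> = b\<^sup>2 / (2 * c) - c / 2 * x\<^sup>2 - (b * \<bar>x\<bar> - c * x\<^sup>2)"
      using assms by (simp add: power2_diff power_mult_distrib field_simps power2_eq_square)
    finally have "b * \<bar>x\<bar> - c * x\<^sup>2 \<le> b\<^sup>2 / (2 * c) + (0 * \<bar>x\<bar> - c / 2 * x\<^sup>2)" by simp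
    thus ?thesis unfolding gauss_exp_def exp_add[symmetric] by simp
  qed
qed measurable

lemma gauss_exp_tendsto_0:
  assumes "c > 0"
  shows "(gauss_exp b c \<longlongrightarrow> 0) at_top" "(gauss_exp b c \<longlongrightarrow> 0) at_bot"
proof -
  show lim: "(gauss_exp b c \<longlongrightarrow> 0) at_top"
    unfolding gauss_exp_def[abs_def] using assms by real_asymp
  have "(\<lambda>x. gauss_exp b c (- x)) = gauss_exp b c" by (simp add: gauss_exp_def fun_eq_iff)
  thus "(gauss_exp b c \<longlongrightarrow> 0) at_bot" using lim by (simp add: filterlim_at_bot_mirror)
qed

lemma tendsto_0_gauss_exp_bound:
  assumes "c > 0" and "\<And>x. norm (f x) \<le> C * gauss_exp b c x"
  shows "(f \<longlongrightarrow> 0) at_top" "(f \<longlongrightarrow> 0) at_bot"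
proof -
  note comparison = Lim_null_comparison[OF always_eventually[OF allI[OF assms(2)]]]
  show "(f \<longlongrightarrow> 0) at_top" "(f \<longlongrightarrow> 0) at_bot"
    by (rule comparison, rule tendsto_mult_right_zero, rule gauss_exp_tendsto_0[OF assms(1)])+
qed

lemma gaussian_fourier:
  assumes "c > 0"
  shows "(LINT x|lborel. of_real (gauss_exp 0 c x) * cis (- (x * \<xi>))) =
           complex_of_real (sqrt (pi / c) * exp (- \<xi>\<^sup>2 / (4 * c)))"
proof -
  define a where "a = sqrt (2 * c)"
  have a: "a > 0" "a\<^sup>2 = 2 * c" using assms by (auto simp: a_def)
  define f where "f = (\<lambda>x. std_normal_density x *\<^sub>R cis (- (\<xi> / a) * x))"
  have f_scaled: "f (a * x) =
      of_real (1 / sqrt (2 * pi)) * (of_real (gauss_exp 0 c x) * cis (- (x * \<xi>)))" for x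
  proof -
    have "std_normal_density (a * x) = 1 / sqrt (2 * pi) * gauss_exp 0 c x"
      using a by (simp add: std_normal_density_def gauss_exp_def power_mult_distrib)
    moreover have "- (\<xi> / a) * (a * x) = - (x * \<xi>)" using a by simp
    ultimately show ?thesis
      unfolding f_def by (simp only: scaleR_conv_of_real of_real_mult mult.assoc)
  qed
  have "complex_of_real (exp (- \<xi>\<^sup>2 / (4 * c))) = char std_normal_distribution (- (\<xi> / a))"
    using a by (simp add: char_std_normal_distribution power_divide)
  also have "\<dots> = (LINT x|lborel. f x)"
    unfolding char_def f_def cis_conv_exp by (subst integral_density) auto
  also have "\<dots> = of_real a * (LINT x|lborel. f (a * x))"
    using lborel_integral_real_affine[of a f 0] a(1) by (simp add: scaleR_conv_of_real)
  also have "\<dots> =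
      of_real (a / sqrt (2 * pi)) * (LINT x|lborel. of_real (gauss_exp 0 c x) * cis (- (x * \<xi>)))"
    unfolding f_scaled integral_mult_right_zero by simp
  finally have "of_real (sqrt (2 * pi) / a) * complex_of_real (exp (- \<xi>\<^sup>2 / (4 * c))) =
      (LINT x|lborel. of_real (gauss_exp 0 c x) * cis (- (x * \<xi>)))"
    using a(1) by simp
  moreover have "sqrt (2 * pi) / a = sqrt (pi / c)"
    using assms by (simp add: a_def real_sqrt_divide[symmetric])
  ultimately show ?thesis by simp
qed


section \<open>The kernel and its Fourier transform\<close>

definition dexp_kernel :: "real \<Rightarrow> real \<Rightarrow> complex \<Rightarrow> complex" where
  "dexp_kernel B \<eta> u = exp (- (of_real \<eta> * cosh (of_real pi * u)) - of_real B * u\<^sup>2)"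

lemma Re_cosh: "Re (cosh z) = cosh (Re z) * cos (Im z)"
  by (simp add: cosh_def Re_exp field_simps)

lemma cosh_le_exp_abs: "cosh x \<le> exp \<bar>x\<bar>" for x :: real
proof -
  have "exp x \<le> exp \<bar>x\<bar>" "exp (- x) \<le> exp \<bar>x\<bar>" by auto
  thus ?thesis by (simp add: cosh_def del: exp_le_cancel_iff)
qed

lemma norm_cosh_le: "cmod (cosh z) \<le> exp \<bar>Re z\<bar>"
  and norm_sinh_le: "cmod (sinh z) \<le> exp \<bar>Re z\<bar>"
proof -
  have "cmod (exp z) \<le> exp \<bar>Re z\<bar>" "cmod (exp (- z)) \<le> exp \<bar>Re z\<bar>" by (auto simp: norm_exp_eq_Re)
  thus "cmod (cosh z) \<le> exp \<bar>Re z\<bar>" "cmod (sinh z) \<le> exp \<bar>Re z\<bar>"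
    using norm_triangle_ineq[of "exp z" "exp (- z)"] norm_triangle_ineq4[of "exp z" "exp (- z)"]
    by (simp_all add: cosh_def sinh_def del: norm_exp_eq_Re)
qed

lemma holomorphic_on_cosh [holomorphic_intros]:
  "f holomorphic_on A \<Longrightarrow> (\<lambda>u. cosh (f u)) holomorphic_on A"
  and holomorphic_on_sinh [holomorphic_intros]:
  "f holomorphic_on A \<Longrightarrow> (\<lambda>u. sinh (f u)) holomorphic_on A"
  unfolding cosh_def sinh_def scaleR_conv_of_real by (intro holomorphic_intros; simp)+

lemma holomorphic_dexp_kernel: "dexp_kernel B \<eta> holomorphic_on A"
  unfolding dexp_kernel_def[abs_def] by (intro holomorphic_intros)

lemma norm_dexp_kernel_le:
  assumes "\<bar>Im u\<bar> \<le> 1/2" "\<eta> \<ge> 0" "B \<ge> 0"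
  shows "cmod (dexp_kernel B \<eta> u) \<le> exp (B / 4) * gauss_exp 0 B (Re u)"
proof -
  have "cos (pi * Im u) \<ge> 0"
    using assms(1) mult_left_mono[of "Im u" "1/2" pi] mult_left_mono[of "-1/2" "Im u" pi]
    by (intro cos_ge_zero) (auto simp: abs_le_iff)
  hence "\<eta> * cosh (pi * Re u) * cos (pi * Im u) \<ge> 0" using assms by simp
  moreover have "B * (Im u)\<^sup>2 \<le> B * (1/2)\<^sup>2"
    using assms power_mono[OF assms(1), of 2] by (intro mult_left_mono) auto
  ultimately have "- \<eta> * cosh (pi * Re u) * cos (pi * Im u) - B * ((Re u)\<^sup>2 - (Im u)\<^sup>2) \<le>
      B / 4 + (0 * \<bar>Re u\<bar> - B * (Re u)\<^sup>2)"
    by (simp add: algebra_simps power2_eq_square)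
  moreover have "Re (u\<^sup>2) = (Re u)\<^sup>2 - (Im u)\<^sup>2" by (simp add: power2_eq_square)
  ultimately show ?thesis
    unfolding gauss_exp_def exp_add[symmetric] dexp_kernel_def norm_exp_eq_Re by (simp add: Re_cosh)
qed

lemma dexp_kernel_Complex_0:
  "dexp_kernel B \<eta> (Complex x 0) = of_real (exp (- \<eta> * cosh (pi * x)) * gauss_exp 0 B x)"
proof -
  have "cosh (complex_of_real (pi * x)) = of_real (cosh (pi * x))"
    unfolding cosh_def
    by (simp add: scaleR_conv_of_real exp_of_real flip: of_real_minus of_real_mult)
  hence "- (of_real \<eta> * cosh (of_real pi * of_real x)) - of_real B * (of_real x)\<^sup>2 =
      complex_of_real (- \<eta> * cosh (pi * x) + (0 * \<bar>x\<bar> - B * x\<^sup>2))"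
    by simp
  thus ?thesis
    unfolding dexp_kernel_def gauss_exp_def exp_add[symmetric] complex_of_real_def[symmetric]
    by (simp only: exp_of_real)
qed

lemma norm_mult_dexp_kernel_le:
  assumes "\<bar>Im u\<bar> \<le> 1/2" "\<eta> \<ge> 0" "B \<ge> 0" and z: "cmod z \<le> C * exp (b * \<bar>Re u\<bar>)"
  shows "cmod (z * dexp_kernel B \<eta> u) \<le> C * exp (B / 4) * gauss_exp b B (Re u)"
proof -
  have "cmod z * cmod (dexp_kernel B \<eta> u) \<le>
      C * exp (b * \<bar>Re u\<bar>) * (exp (B / 4) * gauss_exp 0 B (Re u))"
    using order_trans[OF norm_ge_zero z] by (intro mult_mono z norm_dexp_kernel_le assms) auto
  also have "\<dots> = C * exp (B / 4) * (exp (b * \<bar>Re u\<bar>) * gauss_exp 0 B (Re u))"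
    by (simp only: mult_ac)
  finally show ?thesis by (simp only: norm_mult exp_abs_mult_gauss_exp add_0_right)
qed

lemma integrable_mult_dexp_kernel:
  assumes "B > 0" "\<eta> \<ge> 0" "\<bar>y\<bar> \<le> 1/2" and meas: "f \<in> borel_measurable borel"
    and f: "\<And>x. cmod (f x) \<le> C * exp (b * \<bar>x\<bar>)"
  shows "integrable lborel (\<lambda>x. f x * dexp_kernel B \<eta> (Complex x y))"
proof (rule integrable_majorant)
  show "integrable lborel (\<lambda>x. C * exp (B / 4) * gauss_exp b B x)"
    by (intro integrable_mult_right integrable_gauss_exp \<open>B > 0\<close>)
  have "(\<lambda>x. dexp_kernel B \<eta> (Complex x y)) \<in> borel_measurable borel"
    by (intro borel_measurable_continuous_onI continuous_on_horizontal_line[where S=UNIV]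
          holomorphic_on_imp_continuous_on holomorphic_dexp_kernel) auto
  thus "(\<lambda>x. f x * dexp_kernel B \<eta> (Complex x y)) \<in> borel_measurable lborel"
    using meas by measurable
  show "cmod (f x * dexp_kernel B \<eta> (Complex x y)) \<le> C * exp (B / 4) * gauss_exp b B x" for x
    using norm_mult_dexp_kernel_le[of "Complex x y"] assms by simp
qed

definition kernel_ft :: "real \<Rightarrow> real \<Rightarrow> real \<Rightarrow> complex" where
  "kernel_ft B \<eta> \<xi> = (LINT x|lborel. dexp_kernel B \<eta> (Complex x 0) * cis (- (x * \<xi>)))"

lemma kernel_ft_shift:
  assumes "\<eta> \<ge> 0" "B > 0"
  shows "kernel_ft B \<eta> \<xi> =
    of_real (exp (- \<xi> / 2)) * (LINT x|lborel. dexp_kernel B \<eta> (Complex x (-1/2)) * cis (- (x * \<xi>)))"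
proof -
  define f where "f = (\<lambda>u. dexp_kernel B \<eta> u * exp (- \<i> * u * of_real \<xi>))"
  have exp_line: "exp (- \<i> * Complex x y * of_real \<xi>) = of_real (exp (y * \<xi>)) * cis (- (x * \<xi>))"
    for x y
    by (simp add: exp_eq_polar)
  have "kernel_ft B \<eta> \<xi> = (LINT x|lborel. f (Complex x 0))"
    unfolding kernel_ft_def f_def exp_line by simp
  also have "\<dots> = (LINT x|lborel. f (Complex x (-1/2)))"
  proof (rule integral_horizontal_lines_eq[symmetric, where S=UNIV and
        g="\<lambda>x. exp (B / 4) * exp (\<bar>\<xi>\<bar> / 2) * gauss_exp 0 B x"])
    show "f holomorphic_on UNIV"
      unfolding f_def by (intro holomorphic_intros holomorphic_dexp_kernel)
    fix u assume u: "-1/2 \<le> Im u" "Im u \<le> 0"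
    have "\<bar>Im u * \<xi>\<bar> \<le> 1/2 * \<bar>\<xi>\<bar>" unfolding abs_mult using u by (intro mult_right_mono) auto
    hence "cmod (exp (- \<i> * u * of_real \<xi>)) \<le> exp (\<bar>\<xi>\<bar> / 2)" by (simp add: norm_exp_eq_Re)
    hence "cmod (f u) \<le> exp (B / 4) * gauss_exp 0 B (Re u) * exp (\<bar>\<xi>\<bar> / 2)"
      unfolding f_def norm_mult using u assms by (intro mult_mono norm_dexp_kernel_le) auto
    thus "cmod (f u) \<le> exp (B / 4) * exp (\<bar>\<xi>\<bar> / 2) * gauss_exp 0 B (Re u)" by (simp only: mult_ac)
  qed (use assms integrable_gauss_exp gauss_exp_tendsto_0 in \<open>auto intro!: tendsto_mult_right_zero\<close>)
  also have "\<dots> = (LINT x|lborel. of_real (exp (- \<xi> / 2)) *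
      (dexp_kernel B \<eta> (Complex x (-1/2)) * cis (- (x * \<xi>))))"
    unfolding f_def exp_line by (simp add: mult_ac)
  also have "\<dots> = of_real (exp (- \<xi> / 2)) *
      (LINT x|lborel. dexp_kernel B \<eta> (Complex x (-1/2)) * cis (- (x * \<xi>)))"
    by (rule integral_mult_right_zero)
  finally show ?thesis .
qed

lemma norm_kernel_ft_minus_gaussian_le:
  assumes B: "B > 0" and \<eta>: "\<eta> \<ge> 0"
  shows "cmod (kernel_ft B \<eta> \<xi> - of_real (sqrt (pi / B) * exp (- \<xi>\<^sup>2 / (4 * B)))) \<le>
           \<eta> * (LINT x|lborel. gauss_exp pi B x)"
proof -
  let ?c = "\<lambda>x. cis (- (x * \<xi>))"
  have meas: "?c \<in> borel_measurable borel"
    by (intro borel_measurable_continuous_onI continuous_intros)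
  have "integrable lborel (\<lambda>x. ?c x * dexp_kernel B \<eta>' (Complex x 0))" if "\<eta>' \<ge> 0" for \<eta>'
    using that B meas by (intro integrable_mult_dexp_kernel[where C=1 and b=0]) auto
  from this[OF \<eta>] this[of 0]
  have int: "integrable lborel (\<lambda>x. dexp_kernel B \<eta> (Complex x 0) * ?c x)"
      "integrable lborel (\<lambda>x. of_real (gauss_exp 0 B x) * ?c x)"
    by (simp_all add: dexp_kernel_Complex_0 mult.commute)
  have diff_le: "cmod (dexp_kernel B \<eta> (Complex x 0) * ?c x - of_real (gauss_exp 0 B x) * ?c x) \<le>
      \<eta> * gauss_exp pi B x" for x
  proof -
    let ?k = "exp (- \<eta> * cosh (pi * x))"
    have "dexp_kernel B \<eta> (Complex x 0) * ?c x - of_real (gauss_exp 0 B x) * ?c x =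
        of_real ((?k - 1) * gauss_exp 0 B x) * ?c x"
      by (simp add: dexp_kernel_Complex_0 algebra_simps)
    hence "cmod (dexp_kernel B \<eta> (Complex x 0) * ?c x - of_real (gauss_exp 0 B x) * ?c x) =
        \<bar>?k - 1\<bar> * gauss_exp 0 B x"
      by (simp only: norm_mult norm_of_real norm_cis mult_1_right abs_mult
         abs_of_nonneg[OF gauss_exp_nonneg])
    also have "\<bar>?k - 1\<bar> \<le> \<eta> * cosh (pi * x)"
      using exp_ge_add_one_self[of "- \<eta> * cosh (pi * x)"] \<eta> by simp
    finally have "cmod (dexp_kernel B \<eta> (Complex x 0) * ?c x - of_real (gauss_exp 0 B x) * ?c x) \<le>
        \<eta> * cosh (pi * x) * gauss_exp 0 B x"
      by (simp add: mult_right_mono)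
    also have "\<dots> \<le> \<eta> * exp (pi * \<bar>x\<bar>) * gauss_exp 0 B x"
      using cosh_le_exp_abs[of "pi * x"] \<eta>
      by (intro mult_right_mono mult_left_mono) (auto simp: abs_mult)
    finally show ?thesis by (simp only: mult.assoc exp_abs_mult_gauss_exp add_0_right)
  qed
  have "kernel_ft B \<eta> \<xi> - of_real (sqrt (pi / B) * exp (- \<xi>\<^sup>2 / (4 * B))) =
     (LINT x|lborel. dexp_kernel B \<eta> (Complex x 0) * ?c x - of_real (gauss_exp 0 B x) * ?c x)"
    unfolding kernel_ft_def gaussian_fourier[OF B, symmetric] using int by simp
  also have "cmod \<dots> \<le> (LINT x|lborel. \<eta> * gauss_exp pi B x)"
    using integrable_gauss_exp[OF B] by (intro norm_integral_le_majorant diff_le) auto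
  finally show ?thesis by simp
qed

text \<open>The quotients \<open>k'/k\<close> and \<open>k''/k\<close> for the kernel \<open>k\<close>.\<close>

definition kernel_quot' :: "real \<Rightarrow> real \<Rightarrow> complex \<Rightarrow> complex" where
  "kernel_quot' B \<eta> u = - (of_real (\<eta> * pi) * sinh (of_real pi * u)) - 2 * of_real B * u"

definition kernel_quot'' :: "real \<Rightarrow> real \<Rightarrow> complex \<Rightarrow> complex" where
  "kernel_quot'' B \<eta> u =
      (kernel_quot' B \<eta> u)\<^sup>2 - of_real (\<eta> * pi\<^sup>2) * cosh (of_real pi * u) - 2 * of_real B"

lemma holomorphic_kernel_quot': "kernel_quot' B \<eta> holomorphic_on A"
  and holomorphic_kernel_quot'': "kernel_quot'' B \<eta> holomorphic_on A"
  unfolding kernel_quot'_def[abs_def] kernel_quot''_def[abs_def] by (intro holomorphic_intros)+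

lemma has_field_derivative_dexp_kernel:
  "(dexp_kernel B \<eta> has_field_derivative kernel_quot' B \<eta> u * dexp_kernel B \<eta> u) (at u)"
  unfolding dexp_kernel_def[abs_def]
  by (rule derivative_eq_intros refl)+ (simp add: kernel_quot'_def algebra_simps)

lemma has_field_derivative_dexp_kernel':
  "((\<lambda>u. kernel_quot' B \<eta> u * dexp_kernel B \<eta> u) has_field_derivative
      kernel_quot'' B \<eta> u * dexp_kernel B \<eta> u) (at u)"
proof -
  have "(kernel_quot' B \<eta> has_field_derivative
      - (of_real (\<eta> * pi\<^sup>2) * cosh (of_real pi * u)) - 2 * of_real B) (at u)"
    unfolding kernel_quot'_def[abs_def]
    by (rule derivative_eq_intros refl)+ (simp add: algebra_simps power2_eq_square)
  from DERIV_mult[OF this has_field_derivative_dexp_kernel] show ?thesis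
    by (simp add: kernel_quot''_def power2_eq_square algebra_simps)
qed

lemma norm_kernel_quot'_le:
  assumes "\<bar>Im u\<bar> \<le> 1" "0 \<le> \<eta>" "\<eta> \<le> 1" "B \<ge> 0"
  shows "cmod (kernel_quot' B \<eta> u) \<le> (pi + 2 * B) * exp (pi * \<bar>Re u\<bar>)"
proof -
  have "cmod (sinh (of_real pi * u)) \<le> exp (pi * \<bar>Re u\<bar>)"
    using norm_sinh_le[of "of_real pi * u"] by (simp add: abs_mult)
  moreover have "cmod (of_real (\<eta> * pi)) \<le> pi"
    using assms unfolding norm_of_real by (simp add: abs_mult mult_left_le_one_le)
  ultimately have "cmod (of_real (\<eta> * pi) * sinh (of_real pi * u)) \<le> pi * exp (pi * \<bar>Re u\<bar>)"
    unfolding norm_mult[of "of_real _" "sinh _"] by (intro mult_mono) auto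
  moreover have "cmod (2 * of_real B * u) \<le> 2 * B * exp (pi * \<bar>Re u\<bar>)"
  proof -
    have "cmod u \<le> 1 + \<bar>Re u\<bar>" using cmod_le[of u] assms by simp
    also have "\<dots> \<le> 1 + pi * \<bar>Re u\<bar>" using pi_gt3 mult_right_mono[of 1 pi "\<bar>Re u\<bar>"] by simp
    also have "\<dots> \<le> exp (pi * \<bar>Re u\<bar>)" by (rule exp_ge_add_one_self)
    finally show ?thesis using assms by (simp add: norm_mult mult_left_mono)
  qed
  ultimately show ?thesis
    unfolding kernel_quot'_def
    using norm_triangle_ineq4[of "- (of_real (\<eta> * pi) * sinh (of_real pi * u))" "2 * of_real B * u"]
    by (simp only: norm_minus_cancel distrib_right; linarith)
qed

lemma norm_kernel_quot''_le:
  assumes "\<bar>Im u\<bar> \<le> 1" "0 \<le> \<eta>" "\<eta> \<le> 1" "B \<ge> 0"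
  shows "cmod (kernel_quot'' B \<eta> u) \<le> ((pi + 2 * B)\<^sup>2 + pi\<^sup>2 + 2 * B) * exp (2 * pi * \<bar>Re u\<bar>)"
proof -
  have "cmod ((kernel_quot' B \<eta> u)\<^sup>2) \<le> ((pi + 2 * B) * exp (pi * \<bar>Re u\<bar>))\<^sup>2"
    unfolding norm_power by (intro power_mono norm_kernel_quot'_le assms) auto
  also have "\<dots> = (pi + 2 * B)\<^sup>2 * exp (2 * pi * \<bar>Re u\<bar>)"
    by (simp add: power_mult_distrib exp_double[symmetric] mult.assoc)
  finally have square: "cmod ((kernel_quot' B \<eta> u)\<^sup>2) \<le> (pi + 2 * B)\<^sup>2 * exp (2 * pi * \<bar>Re u\<bar>)" .
  have "cmod (cosh (of_real pi * u)) \<le> exp (2 * pi * \<bar>Re u\<bar>)"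
    by (rule order_trans[OF norm_cosh_le]) (simp add: abs_mult)
  moreover have "cmod (of_real (\<eta> * pi\<^sup>2)) \<le> pi\<^sup>2"
    using assms unfolding norm_of_real by (simp add: abs_mult mult_left_le_one_le)
  ultimately have "cmod (of_real (\<eta> * pi\<^sup>2) * cosh (of_real pi * u)) \<le> pi\<^sup>2 * exp (2 * pi * \<bar>Re u\<bar>)"
    unfolding norm_mult[of "of_real _" "cosh _"] by (intro mult_mono) auto
  moreover have "cmod (2 * of_real B) \<le> 2 * B * exp (2 * pi * \<bar>Re u\<bar>)"
    using assms mult_left_mono[of 1 "exp (2 * pi * \<bar>Re u\<bar>)" "2 * B"] by (simp add: norm_mult)
  ultimately show ?thesis
    unfolding kernel_quot''_def
    using square norm_triangle_ineq4[of
        "(kernel_quot' B \<eta> u)\<^sup>2 - of_real (\<eta> * pi\<^sup>2) * cosh (of_real pi * u)" "2 * of_real B"]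
      norm_triangle_ineq4[of "(kernel_quot' B \<eta> u)\<^sup>2" "of_real (\<eta> * pi\<^sup>2) * cosh (of_real pi * u)"]
    by (simp only: distrib_right; linarith)
qed

lemma integral_dexp_kernel_by_parts:
  assumes B: "B > 0" and \<eta>: "0 \<le> \<eta>" "\<eta> \<le> 1" and y: "\<bar>y\<bar> \<le> 1/2"
  shows "(LINT x|lborel. kernel_quot'' B \<eta> (Complex x y) * dexp_kernel B \<eta> (Complex x y) *
      cis (- (x * \<xi>))) =
    - of_real (\<xi>\<^sup>2) * (LINT x|lborel. dexp_kernel B \<eta> (Complex x y) * cis (- (x * \<xi>)))"
proof -
  let ?k = "\<lambda>u. dexp_kernel B \<eta> u"
  have meas: "(\<lambda>x. h (Complex x y)) \<in> borel_measurable borel"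
    and cont: "continuous_on UNIV (\<lambda>x. h (Complex x y) * ?k (Complex x y))"
      if "h holomorphic_on UNIV" for h
    using that holomorphic_dexp_kernel[of B \<eta> UNIV]
    by (auto intro!: continuous_on_mult continuous_on_horizontal_line[where S=UNIV]
          holomorphic_on_imp_continuous_on holomorphic_on_mult borel_measurable_continuous_onI)
  have y1: "\<bar>Im (Complex x y)\<bar> \<le> 1" for x using y by simp
  note quot'_le = norm_kernel_quot'_le[OF y1 \<eta> less_imp_le[OF B], unfolded complex.sel]
  note quot''_le = norm_kernel_quot''_le[OF y1 \<eta> less_imp_le[OF B], unfolded complex.sel]
  have int: "integrable lborel (\<lambda>x. ?k (Complex x y))"
    "integrable lborel (\<lambda>x. kernel_quot' B \<eta> (Complex x y) * ?k (Complex x y))"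
    "integrable lborel (\<lambda>x. kernel_quot'' B \<eta> (Complex x y) * ?k (Complex x y))"
    using integrable_mult_dexp_kernel[where f="\<lambda>_. 1" and C=1 and b=0, OF B \<eta>(1) y]
      integrable_mult_dexp_kernel[OF B \<eta>(1) y meas[OF holomorphic_kernel_quot'] quot'_le]
      integrable_mult_dexp_kernel[OF B \<eta>(1) y meas[OF holomorphic_kernel_quot''] quot''_le]
    by simp_all
  have k_le: "cmod (?k (Complex x y)) \<le> exp (B / 4) * gauss_exp 0 B x" for x
    using norm_dexp_kernel_le[of "Complex x y" \<eta> B] y \<eta> B by simp
  have k'_le: "cmod (kernel_quot' B \<eta> (Complex x y) * ?k (Complex x y)) \<le>
      (pi + 2 * B) * exp (B / 4) * gauss_exp pi B x" for x
    using norm_mult_dexp_kernel_le[of "Complex x y"] quot'_le y \<eta> B by simp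
  have "(LINT x|lborel. kernel_quot' B \<eta> (Complex x y) * ?k (Complex x y) * cis (- (x * \<xi>))) =
      \<i> * of_real \<xi> * (LINT x|lborel. ?k (Complex x y) * cis (- (x * \<xi>)))"
    by (rule integral_derivative_mult_cis[OF _ cont[OF holomorphic_kernel_quot'] int(1,2)
          tendsto_0_gauss_exp_bound[OF B k_le]])
       (rule has_vector_derivative_along_horizontal_line[OF has_field_derivative_dexp_kernel])
  moreover have "(LINT x|lborel. kernel_quot'' B \<eta> (Complex x y) * ?k (Complex x y) *
      cis (- (x * \<xi>))) =
      \<i> * of_real \<xi> *
        (LINT x|lborel. kernel_quot' B \<eta> (Complex x y) * ?k (Complex x y) * cis (- (x * \<xi>)))"
    by (rule integral_derivative_mult_cis[OF _ cont[OF holomorphic_kernel_quot''] int(2,3)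
          tendsto_0_gauss_exp_bound[OF B k'_le]])
       (rule has_vector_derivative_along_horizontal_line[OF has_field_derivative_dexp_kernel'])
  ultimately show ?thesis by (simp add: power2_eq_square algebra_simps)
qed

lemma norm_kernel_ft_le:
  assumes B: "B > 0"
  obtains C where "C \<ge> 0" and "\<And>\<eta> \<xi>. 0 \<le> \<eta> \<Longrightarrow> \<eta> \<le> 1 \<Longrightarrow> \<xi> > 0 \<Longrightarrow>
    cmod (kernel_ft B \<eta> \<xi>) \<le> C * exp (- \<xi> / 2) / \<xi>\<^sup>2"
proof
  define Q where "Q = ((pi + 2 * B)\<^sup>2 + pi\<^sup>2 + 2 * B) * exp (B / 4)"
  define C where "C = Q * (LINT x|lborel. gauss_exp (2 * pi) B x)"
  show "C \<ge> 0" using B by (simp add: C_def Q_def)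
  fix \<eta> \<xi> :: real
  assume \<eta>: "0 \<le> \<eta>" "\<eta> \<le> 1" and \<xi>: "\<xi> > 0"
  let ?I = "LINT x|lborel. dexp_kernel B \<eta> (Complex x (-1/2)) * cis (- (x * \<xi>))"
  let ?h = "\<lambda>x. kernel_quot'' B \<eta> (Complex x (-1/2)) * dexp_kernel B \<eta> (Complex x (-1/2)) *
      cis (- (x * \<xi>))"
  have h_le: "cmod (?h x) \<le> Q * gauss_exp (2 * pi) B x" for x
    using norm_mult_dexp_kernel_le[OF _ _ _ norm_kernel_quot''_le, of "Complex x (-1/2)" \<eta> B \<eta> B]
      \<eta> B
    by (simp add: Q_def norm_mult)
  have "\<xi>\<^sup>2 * cmod ?I = cmod (LINT x|lborel. ?h x)"
    using B \<eta> by (subst integral_dexp_kernel_by_parts) (auto simp: norm_mult norm_power)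
  also have "\<dots> \<le> (LINT x|lborel. Q * gauss_exp (2 * pi) B x)"
    using integrable_gauss_exp[OF B] h_le by (intro norm_integral_le_majorant) auto
  also have "\<dots> = C" by (simp add: C_def)
  finally have "cmod ?I \<le> C / \<xi>\<^sup>2" using \<xi> by (simp add: field_simps)
  hence "exp (- \<xi> / 2) * cmod ?I \<le> exp (- \<xi> / 2) * (C / \<xi>\<^sup>2)" by (intro mult_left_mono) auto
  thus "cmod (kernel_ft B \<eta> \<xi>) \<le> C * exp (- \<xi> / 2) / \<xi>\<^sup>2"
    using kernel_ft_shift[OF \<eta>(1) B, of \<xi>] by (simp add: norm_mult mult.commute)
qed


section \<open>Averages against the kernel\<close>

definition kernel_integrand :: "real \<Rightarrow> real \<Rightarrow> (complex \<Rightarrow> complex) \<Rightarrow> complex \<Rightarrow> complex \<Rightarrow> complex"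
  where
  "kernel_integrand B \<eta> f s u = f (s + \<i> * u) * dexp_kernel B \<eta> u"

definition kernel_avg :: "real \<Rightarrow> real \<Rightarrow> real \<Rightarrow> (complex \<Rightarrow> complex) \<Rightarrow> complex \<Rightarrow> complex" where
  "kernel_avg B \<eta> y f s = (LINT x|lborel. kernel_integrand B \<eta> f s (Complex x y))"

lemma one_plus_abs_power_le_exp: "(1 + \<bar>x\<bar>) ^ k \<le> exp (real k * \<bar>x\<bar>)" for x :: real
proof -
  have "(1 + \<bar>x\<bar>) ^ k \<le> exp \<bar>x\<bar> ^ k" by (intro power_mono exp_ge_add_one_self) auto
  thus ?thesis by (simp add: exp_of_nat_mult)
qed

lemma norm_kernel_integrand_le:
  assumes growth: "cmod (f (s + \<i> * u)) \<le> C * (1 + \<bar>Im (s + \<i> * u)\<bar>)\<^sup>2"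
    and "C \<ge> 0" "B \<ge> 0" "\<eta> \<ge> 0" "\<bar>Im u\<bar> \<le> 1/2"
  shows "cmod (kernel_integrand B \<eta> f s u) \<le>
      C * (1 + \<bar>Im s\<bar>)\<^sup>2 * exp (B / 4) * gauss_exp 2 B (Re u)"
proof -
  have "1 + \<bar>Im s + Re u\<bar> \<le> (1 + \<bar>Im s\<bar>) * (1 + \<bar>Re u\<bar>)"
    using abs_triangle_ineq[of "Im s" "Re u"]
      mult_nonneg_nonneg[OF abs_ge_zero abs_ge_zero, of "Im s" "Re u"]
    by (simp only: distrib_left distrib_right mult_1 mult_1_right; linarith)
  hence "(1 + \<bar>Im s + Re u\<bar>)\<^sup>2 \<le> (1 + \<bar>Im s\<bar>)\<^sup>2 * (1 + \<bar>Re u\<bar>)\<^sup>2"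
    unfolding power_mult_distrib[symmetric] by (intro power_mono) auto
  also have "\<dots> \<le> (1 + \<bar>Im s\<bar>)\<^sup>2 * exp (2 * \<bar>Re u\<bar>)"
    using one_plus_abs_power_le_exp[of "Re u" 2] by (intro mult_left_mono) auto
  finally have "C * (1 + \<bar>Im s + Re u\<bar>)\<^sup>2 \<le> C * (1 + \<bar>Im s\<bar>)\<^sup>2 * exp (2 * \<bar>Re u\<bar>)"
    using \<open>C \<ge> 0\<close> by (simp add: mult_left_mono mult.assoc)
  with growth have "cmod (f (s + \<i> * u)) \<le> C * (1 + \<bar>Im s\<bar>)\<^sup>2 * exp (2 * \<bar>Re u\<bar>)" by simp
  thus ?thesis unfolding kernel_integrand_def using assms by (intro norm_mult_dexp_kernel_le) auto
qed

lemma kernel_avg_shift: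
  assumes hol: "f holomorphic_on {w. Re w > a}" and s: "Re s > a"
    and growth: "\<And>w. Re s \<le> Re w \<Longrightarrow> Re w \<le> Re s + 1/2 \<Longrightarrow> cmod (f w) \<le> C * (1 + \<bar>Im w\<bar>)\<^sup>2"
    and C: "C \<ge> 0" and B: "B > 0" and \<eta>: "\<eta> \<ge> 0"
  shows "kernel_avg B \<eta> (-1/2) f s = kernel_avg B \<eta> 0 f s"
    and "\<And>y. -1/2 \<le> y \<Longrightarrow> y \<le> 0 \<Longrightarrow> integrable lborel (\<lambda>x. kernel_integrand B \<eta> f s (Complex x y))"
proof -
  define S where "S = {u. Im u < Re s - a}"
  define D where "D = C * (1 + \<bar>Im s\<bar>)\<^sup>2 * exp (B / 4)"
  have S: "open S" "convex S" by (auto simp: S_def open_halfspace_Im_lt convex_halfspace_Im_lt)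
  have mem_S: "u \<in> S" if "Im u \<le> 0" for u using that s by (simp add: S_def)
  have hol_int: "kernel_integrand B \<eta> f s holomorphic_on S"
    unfolding kernel_integrand_def[abs_def]
    by (intro holomorphic_intros holomorphic_dexp_kernel
       holomorphic_on_compose_gen[OF _ hol, unfolded o_def])
       (auto intro!: holomorphic_intros simp: S_def)
  have bound: "cmod (kernel_integrand B \<eta> f s u) \<le> D * gauss_exp 2 B (Re u)"
    if "-1/2 \<le> Im u" "Im u \<le> 0" for u
    unfolding D_def using that C B \<eta> by (intro norm_kernel_integrand_le growth) auto
  have majorant: "integrable lborel (\<lambda>x. D * gauss_exp 2 B x)"
    by (intro integrable_mult_right integrable_gauss_exp B)
  show "integrable lborel (\<lambda>x. kernel_integrand B \<eta> f s (Complex x y))" if "-1/2 \<le> y" "y \<le> 0" for y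
    using that bound[of "Complex _ y"]
    by (intro integrable_along_horizontal_line[OF holomorphic_on_imp_continuous_on[OF hol_int]
       mem_S majorant]) auto
  show "kernel_avg B \<eta> (-1/2) f s = kernel_avg B \<eta> 0 f s"
    unfolding kernel_avg_def
    by (rule integral_horizontal_lines_eq[OF S hol_int mem_S bound majorant])
       (auto intro!: tendsto_mult_right_zero gauss_exp_tendsto_0 B)
qed

lemma kernel_avg_dirichlet_term:
  assumes "B > 0" "\<eta> \<ge> 0"
  shows "kernel_avg B \<eta> (-1/2) (\<lambda>w. of_nat (Suc n) powr (- w)) s =
    of_nat (Suc n) powr (- s) * kernel_ft B \<eta> (ln (real (Suc n)))"
    and "integrable lborel (\<lambda>x.
      kernel_integrand B \<eta> (\<lambda>w. of_nat (Suc n) powr (- w)) s (Complex x (-1/2)))"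
proof -
  define \<xi> where "\<xi> = ln (real (Suc n))"
  have integrand: "kernel_integrand B \<eta> (\<lambda>w. of_nat (Suc n) powr (- w)) s (Complex x (-1/2)) =
      of_nat (Suc n) powr (- s) * of_real (exp (- \<xi> / 2)) *
        (dexp_kernel B \<eta> (Complex x (-1/2)) * cis (- (x * \<xi>)))" for x
  proof -
    have "real (Suc n) powr (- (Re s + 1/2)) = real (Suc n) powr (- Re s) * exp (- \<xi> / 2)"
      by (simp add: powr_def \<xi>_def exp_add[symmetric] algebra_simps del: of_nat_Suc)
    moreover have "cis (- ((Im s + x) * \<xi>)) = cis (- (Im s * \<xi>)) * cis (- (x * \<xi>))"
      by (simp add: cis_mult algebra_simps)
    ultimately show ?thesis
      unfolding kernel_integrand_def Suc_powr_eq_cis by (simp add: \<xi>_def[symmetric] del: of_nat_Suc)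
  qed
  show "kernel_avg B \<eta> (-1/2) (\<lambda>w. of_nat (Suc n) powr (- w)) s =
      of_nat (Suc n) powr (- s) * kernel_ft B \<eta> (ln (real (Suc n)))"
    unfolding kernel_avg_def integrand integral_mult_right_zero \<xi>_def[symmetric]
    using kernel_ft_shift[OF assms(2,1), of \<xi>] by simp
  have "(\<lambda>x. cis (- (x * \<xi>))) \<in> borel_measurable borel"
    by (intro borel_measurable_continuous_onI continuous_intros)
  hence "integrable lborel (\<lambda>x. cis (- (x * \<xi>)) * dexp_kernel B \<eta> (Complex x (-1/2)))"
    using assms by (intro integrable_mult_dexp_kernel[where C=1 and b=0]) auto
  thus "integrable lborel (\<lambda>x.
      kernel_integrand B \<eta> (\<lambda>w. of_nat (Suc n) powr (- w)) s (Complex x (-1/2)))"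
    unfolding integrand by (intro integrable_mult_right) (simp add: mult.commute)
qed

lemma kernel_avg_dirichlet:
  assumes c: "\<And>n. \<bar>c n\<bar> \<le> K" and s: "Re s > 1/2" and B: "B > 0" and \<eta>: "\<eta> \<ge> 0"
  shows "(\<lambda>n. of_real (c n) * of_nat (Suc n) powr (- s) * kernel_ft B \<eta> (ln (real (Suc n)))) sums
      kernel_avg B \<eta> (-1/2) (dirichlet c) s"
    and "integrable lborel (\<lambda>x. kernel_integrand B \<eta> (dirichlet c) s (Complex x (-1/2)))"
proof -
  define f where "f = (\<lambda>n x. of_real (c n) *
      kernel_integrand B \<eta> (\<lambda>w. of_nat (Suc n) powr (- w)) s (Complex x (-1/2)))"
  define k where "k = (\<lambda>x. cmod (dexp_kernel B \<eta> (Complex x (-1/2))))"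
  have int_f: "integrable lborel (f n)" for n
    unfolding f_def by (intro integrable_mult_right kernel_avg_dirichlet_term B \<eta>)
  have integral_f: "(LINT x|lborel. f n x) =
      of_real (c n) * of_nat (Suc n) powr (- s) * kernel_ft B \<eta> (ln (real (Suc n)))" for n
    using kernel_avg_dirichlet_term(1)[OF B \<eta>, of n s]
    unfolding f_def integral_mult_right_zero kernel_avg_def[symmetric] by simp
  have "(\<lambda>n. f n x) sums kernel_integrand B \<eta> (dirichlet c) s (Complex x (-1/2))" for x
    unfolding f_def kernel_integrand_def mult.assoc[symmetric]
    using s by (intro sums_mult2 dirichlet_bounded_sums[OF c]) auto
  hence suminf_f: "(\<Sum>n. f n x) = kernel_integrand B \<eta> (dirichlet c) s (Complex x (-1/2))" for x
    by (simp add: sums_iff)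
  have norm_f: "norm (f n x) = \<bar>c n\<bar> * real (Suc n) powr (- (Re s + 1/2)) * k x" for n x
    unfolding f_def k_def kernel_integrand_def mult.assoc[symmetric]
      norm_mult[of _ "dexp_kernel _ _ _"] norm_dirichlet_term by simp
  have summable: "summable (\<lambda>n. \<bar>c n\<bar> * real (Suc n) powr (- (Re s + 1/2)))"
    using dirichlet_bounded_sums(1)[of c K "Complex (Re s + 1/2) 0", OF c] s
    unfolding norm_dirichlet_term by simp
  have "AE x in lborel. summable (\<lambda>n. norm (f n x))"
    unfolding norm_f by (intro AE_I2 summable_mult2 summable)
  moreover have "summable (\<lambda>n. LINT x|lborel. norm (f n x))"
    unfolding norm_f integral_mult_right_zero by (intro summable_mult2 summable)
  ultimately show "(\<lambda>n. of_real (c n) * of_nat (Suc n) powr (- s) *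
      kernel_ft B \<eta> (ln (real (Suc n)))) sums
      kernel_avg B \<eta> (-1/2) (dirichlet c) s"
    and "integrable lborel (\<lambda>x. kernel_integrand B \<eta> (dirichlet c) s (Complex x (-1/2)))"
    using sums_integral[of lborel f] integrable_suminf[of lborel f] int_f
    unfolding suminf_f integral_f kernel_avg_def by blast+
qed

text \<open>To the right of the pole the logarithm of the pole factor is large only near \<open>s = 1\<close>, that is
  at \<open>x \<approx> -\<tau>\<close>, where the Gaussian majorant of the kernel absorbs any power of \<open>\<tau>\<close>.\<close>

lemma norm_Ln_pole_factor_le_far:
  assumes \<tau>: "\<tau> > 8" and x: "\<bar>x\<bar> > \<tau> / 2"
  shows "cmod (Ln (pole_factor (Complex (1 + 1 / \<tau> ^ 3) (\<tau> + x)))) \<le> 112 / \<tau> * (1 + \<bar>x\<bar>) ^ 5"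
proof -
  define \<epsilon> where "\<epsilon> = 1 / \<tau> ^ 3"
  define s where "s = Complex (1 + \<epsilon>) (\<tau> + x)"
  define q where "q = 1 + \<bar>x\<bar>"
  have \<tau>3: "\<tau> ^ 3 \<ge> 1" using \<tau> by (intro one_le_power) auto
  have "q \<ge> 1" by (simp add: q_def)
  have \<epsilon>: "\<epsilon> > 0" "\<epsilon> \<le> 1" using \<tau>3 \<tau> by (simp_all add: \<epsilon>_def divide_le_eq)
  have "cmod (s + 1) \<le> 2 + \<epsilon> + \<bar>\<tau> + x\<bar>" using cmod_le[of "s + 1"] \<epsilon> by (simp add: s_def)
  also have "\<bar>\<tau> + x\<bar> \<le> 3 * \<bar>x\<bar>" using x \<tau> by linarith
  also have "2 + \<epsilon> + 3 * \<bar>x\<bar> \<le> 3 * q" using \<epsilon> by (simp add: q_def)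
  finally have "cmod (s + 1) / (Re s - 1) \<le> 3 * q * \<tau> ^ 3"
    using \<tau> by (simp add: s_def \<epsilon>_def mult_right_mono)
  moreover have "pi \<le> 4 * (q * \<tau> ^ 3)"
    using mult_mono[OF \<open>q \<ge> 1\<close> \<tau>3] pi_less_4 by (simp add: q_def)
  ultimately have "cmod (Ln (pole_factor s)) \<le> 7 * (q * \<tau> ^ 3)"
    using norm_Ln_pole_factor_le[of s] \<epsilon> by (simp add: s_def)
  also have "\<tau> ^ 3 \<le> 16 * q ^ 4 / \<tau>"
  proof -
    have "\<tau> ^ 4 \<le> (2 * q) ^ 4" using x \<tau> unfolding q_def by (intro power_mono) auto
    moreover have "\<tau> ^ 4 = \<tau> ^ 3 * \<tau>" by (simp add: eval_nat_numeral)
    ultimately show ?thesis using \<tau> unfolding power_mult_distrib by (simp add: pos_le_divide_eq)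
  qed
  hence "7 * (q * \<tau> ^ 3) \<le> 7 * (q * (16 * q ^ 4 / \<tau>))" using \<open>q \<ge> 1\<close> by (intro mult_left_mono) auto
  also have "\<dots> = 112 / \<tau> * q ^ 5" by (simp add: eval_nat_numeral)
  finally show ?thesis by (simp add: s_def \<epsilon>_def q_def)
qed

lemma norm_Ln_pole_factor_le_exp:
  assumes \<tau>: "\<tau> > 8"
  shows "cmod (Ln (pole_factor (Complex (1 + 1 / \<tau> ^ 3) (\<tau> + x)))) \<le> 112 / \<tau> * exp (5 * \<bar>x\<bar>)"
proof (cases "\<bar>x\<bar> \<le> \<tau> / 2")
  case True
  hence Im: "\<bar>\<tau> + x\<bar> > 4" "\<bar>\<tau> + x\<bar> \<ge> \<tau> / 2" using \<tau> by linarith+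
  have "cmod (Ln (pole_factor (Complex (1 + 1 / \<tau> ^ 3) (\<tau> + x)))) \<le> 4 / \<bar>\<tau> + x\<bar>"
    using norm_Ln_pole_factor_le_Im[of "Complex (1 + 1 / \<tau> ^ 3) (\<tau> + x)"] Im by simp
  also have "\<dots> \<le> 4 / (\<tau> / 2)" using Im \<tau> by (intro frac_le) auto
  also have "\<dots> \<le> 112 / \<tau> * 1" using \<tau> by (simp add: divide_right_mono)
  also have "\<dots> \<le> 112 / \<tau> * exp (5 * \<bar>x\<bar>)" using \<tau> by (intro mult_left_mono) auto
  finally show ?thesis .
next
  case False
  hence "cmod (Ln (pole_factor (Complex (1 + 1 / \<tau> ^ 3) (\<tau> + x)))) \<le> 112 / \<tau> * (1 + \<bar>x\<bar>) ^ 5"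
    using \<tau> by (intro norm_Ln_pole_factor_le_far) auto
  also have "\<dots> \<le> 112 / \<tau> * exp (5 * \<bar>x\<bar>)"
    using one_plus_abs_power_le_exp[of x 5] \<tau> by (intro mult_left_mono) auto
  finally show ?thesis .
qed

lemma norm_kernel_avg_Ln_pole_factor_le:
  assumes B: "B > 0" and \<eta>: "\<eta> \<ge> 0" and \<tau>: "\<tau> > 8"
  shows "cmod (kernel_avg B \<eta> (-1/2) (\<lambda>w. Ln (pole_factor w)) (Complex (1/2 + 1 / \<tau> ^ 3) \<tau>)) \<le>
           112 * exp (B / 4) * (LINT x|lborel. gauss_exp 5 B x) / \<tau>"
proof -
  let ?s = "Complex (1/2 + 1 / \<tau> ^ 3) \<tau>"
  have "?s + \<i> * Complex x (-1/2) = Complex (1 + 1 / \<tau> ^ 3) (\<tau> + x)" for x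
    by (simp add: complex_eq_iff)
  hence "cmod (kernel_integrand B \<eta> (\<lambda>w. Ln (pole_factor w)) ?s (Complex x (-1/2))) \<le>
      112 / \<tau> * exp (B / 4) * gauss_exp 5 B x" for x
    unfolding kernel_integrand_def
    using norm_mult_dexp_kernel_le[of "Complex x (-1/2)" \<eta> B _ "112 / \<tau>" 5]
      norm_Ln_pole_factor_le_exp[OF \<tau>, of x] B \<eta>
    by simp
  hence "cmod (kernel_avg B \<eta> (-1/2) (\<lambda>w. Ln (pole_factor w)) ?s) \<le>
      (LINT x|lborel. 112 / \<tau> * exp (B / 4) * gauss_exp 5 B x)"
    unfolding kernel_avg_def
    by (intro norm_integral_le_majorant integrable_mult_right integrable_gauss_exp B)
  thus ?thesis by simp
qed

lemma Re_kernel_integrand_real: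
  "Re (kernel_integrand B \<eta> f s (Complex x 0)) =
     Re (f (s + \<i> * of_real x)) * exp (- \<eta> * cosh (pi * x)) * gauss_exp 0 B x"
  unfolding kernel_integrand_def dexp_kernel_Complex_0
  unfolding complex_of_real_def[symmetric]
  by (simp only: Re_complex_of_real times_complex.simps Im_complex_of_real)

lemma Re_kernel_integrand_le_far:
  assumes \<eta>: "\<eta> \<ge> 0" and h: "0 \<le> h" "h \<le> \<bar>x\<bar>" and D: "D \<ge> 0"
    and far: "Re (f (s + \<i> * of_real x)) \<le> D * exp (b * \<bar>x\<bar>)"
  shows "Re (kernel_integrand B \<eta> f s (Complex x 0)) \<le>
      D * exp (- \<eta> * cosh (pi * h)) * gauss_exp b B x"
proof -
  define E where "E = exp (- \<eta> * cosh (pi * h))"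
  define k where "k = exp (- \<eta> * cosh (pi * x))"
  have "cosh (pi * h) \<le> cosh (pi * \<bar>x\<bar>)" using h by (subst cosh_real_nonneg_le_iff) auto
  also have "cosh (pi * \<bar>x\<bar>) = cosh (pi * x)" by (cases "x \<ge> 0") auto
  finally have "k \<le> E" unfolding k_def E_def using \<eta> by (simp add: mult_left_mono)
  have "Re (f (s + \<i> * of_real x)) * k \<le> D * exp (b * \<bar>x\<bar>) * k"
    by (intro mult_right_mono far) (simp add: k_def)
  also have "\<dots> \<le> D * exp (b * \<bar>x\<bar>) * E" using D \<open>k \<le> E\<close> by (intro mult_left_mono) auto
  finally have "Re (f (s + \<i> * of_real x)) * k * gauss_exp 0 B x \<le>
      D * exp (b * \<bar>x\<bar>) * E * gauss_exp 0 B x"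
    by (rule mult_right_mono) simp
  also have "\<dots> = D * E * (exp (b * \<bar>x\<bar>) * gauss_exp 0 B x)" by (simp only: mult_ac)
  finally show ?thesis
    by (simp only: Re_kernel_integrand_real k_def E_def exp_abs_mult_gauss_exp add_0_right)
qed

lemma Re_kernel_avg_le:
  assumes B: "B > 0" and \<eta>: "\<eta> \<ge> 0" and h: "h \<ge> 0" and a: "a \<ge> 0" and D: "D \<ge> 0"
    and near: "\<And>x. \<bar>x\<bar> \<le> h \<Longrightarrow> Re (f (s + \<i> * of_real x)) \<le> a"
    and far: "\<And>x. Re (f (s + \<i> * of_real x)) \<le> D * exp (b * \<bar>x\<bar>)"
    and int: "integrable lborel (\<lambda>x. kernel_integrand B \<eta> f s (Complex x 0))"
  shows "Re (kernel_avg B \<eta> 0 f s) \<le>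
    a * sqrt (pi / B) + D * exp (- \<eta> * cosh (pi * h)) * (LINT x|lborel. gauss_exp b B x)"
proof -
  define E where "E = exp (- \<eta> * cosh (pi * h))"
  have integrand_le: "Re (kernel_integrand B \<eta> f s (Complex x 0)) \<le>
      a * gauss_exp 0 B x + D * E * gauss_exp b B x" for x
  proof (cases "\<bar>x\<bar> \<le> h")
    case True
    have "Re (f (s + \<i> * of_real x)) * exp (- \<eta> * cosh (pi * x)) \<le> a * exp (- \<eta> * cosh (pi * x))"
      by (intro mult_right_mono near True) simp
    also have "\<dots> \<le> a * 1" using a \<eta> by (intro mult_left_mono) auto
    finally have "Re (kernel_integrand B \<eta> f s (Complex x 0)) \<le> a * gauss_exp 0 B x"
      unfolding Re_kernel_integrand_real by (simp add: mult_right_mono)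
    moreover have "D * E * gauss_exp b B x \<ge> 0" using D by (simp add: E_def)
    ultimately show ?thesis by linarith
  next
    case False
    hence "Re (kernel_integrand B \<eta> f s (Complex x 0)) \<le> D * E * gauss_exp b B x"
      unfolding E_def using h by (intro Re_kernel_integrand_le_far \<eta> D far) auto
    moreover have "a * gauss_exp 0 B x \<ge> 0" using a by simp
    ultimately show ?thesis by linarith
  qed
  have gauss: "integrable lborel (gauss_exp 0 B)"
      "integral\<^sup>L lborel (gauss_exp 0 B) = sqrt (pi / B)"
    using has_bochner_integral_gauss_exp_0[OF B] by (simp_all add: has_bochner_integral_iff)
  have "Re (kernel_avg B \<eta> 0 f s) = (LINT x|lborel. Re (kernel_integrand B \<eta> f s (Complex x 0)))"
    unfolding kernel_avg_def by (rule integral_Re[OF int, symmetric])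
  also have "\<dots> \<le> (LINT x|lborel. a * gauss_exp 0 B x + D * E * gauss_exp b B x)"
    using gauss(1) integrable_gauss_exp[OF B, of b]
    by (intro integral_mono integrand_le integrable_Re int) auto
  also have "\<dots> = a * sqrt (pi / B) + D * E * (LINT x|lborel. gauss_exp b B x)"
    using gauss integrable_gauss_exp[OF B, of b] by simp
  finally show ?thesis by (simp only: E_def)
qed

definition smoothed_log_term :: "real \<Rightarrow> real \<Rightarrow> complex \<Rightarrow> nat \<Rightarrow> complex" where
  "smoothed_log_term B \<eta> s n =
     of_real (log_coeff n) * of_nat (Suc n) powr (- s) * kernel_ft B \<eta> (ln (real (Suc n)))"

definition smoothed_log_zeta :: "real \<Rightarrow> real \<Rightarrow> complex \<Rightarrow> complex" where
  "smoothed_log_zeta B \<eta> s = (\<Sum>n. smoothed_log_term B \<eta> s n)"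

lemma smoothed_log_zeta_sums:
  assumes "Re s > 1/2" "B > 0" "\<eta> \<ge> 0"
  shows "smoothed_log_term B \<eta> s sums smoothed_log_zeta B \<eta> s"
    and "smoothed_log_zeta B \<eta> s = kernel_avg B \<eta> (-1/2) (dirichlet log_coeff) s"
  using kernel_avg_dirichlet(1)[of log_coeff 1, OF abs_log_coeff_le assms]
  unfolding smoothed_log_zeta_def smoothed_log_term_def[abs_def] by (simp_all only: sums_iff)

context log_depoled_zeta
begin

lemma kernel_avg_eq:
  assumes s: "1/2 < Re s" "Re s \<le> 3/2" and B: "B > 0" and \<eta>: "\<eta> \<ge> 0"
  shows "kernel_avg B \<eta> 0 F s =
      smoothed_log_zeta B \<eta> s + kernel_avg B \<eta> (-1/2) (\<lambda>w. Ln (pole_factor w)) s"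
    and "integrable lborel (\<lambda>x. kernel_integrand B \<eta> F s (Complex x 0))"
proof -
  obtain C where "C \<ge> 0" and C: "\<And>w. Re s \<le> Re w \<Longrightarrow> Re w \<le> 2 \<Longrightarrow> cmod (F w) \<le> C * (1 + \<bar>Im w\<bar>)\<^sup>2"
    using norm_le_quadratic[of "Re s - 1/2"] s by auto
  have growth: "cmod (F w) \<le> C * (1 + \<bar>Im w\<bar>)\<^sup>2" if "Re s \<le> Re w" "Re w \<le> Re s + 1/2" for w
    using C[of w] that s by simp
  note shift = kernel_avg_shift[OF holomorphic s(1) growth \<open>C \<ge> 0\<close> B \<eta>]
  note dirichlet = kernel_avg_dirichlet[of log_coeff 1, OF abs_log_coeff_le s(1) B \<eta>]
  have integrand: "kernel_integrand B \<eta> F s (Complex x (-1/2)) -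
      kernel_integrand B \<eta> (dirichlet log_coeff) s (Complex x (-1/2)) =
      kernel_integrand B \<eta> (\<lambda>w. Ln (pole_factor w)) s (Complex x (-1/2))" for x
    using s by (simp add: kernel_integrand_def eq_dirichlet algebra_simps)
  have "kernel_avg B \<eta> (-1/2) F s - kernel_avg B \<eta> (-1/2) (dirichlet log_coeff) s =
      kernel_avg B \<eta> (-1/2) (\<lambda>w. Ln (pole_factor w)) s"
    unfolding kernel_avg_def integrand[symmetric]
    by (rule Bochner_Integration.integral_diff[OF shift(2) dirichlet(2), symmetric]) auto
  thus "kernel_avg B \<eta> 0 F s =
      smoothed_log_zeta B \<eta> s + kernel_avg B \<eta> (-1/2) (\<lambda>w. Ln (pole_factor w)) s"
    using shift(1) smoothed_log_zeta_sums(2)[OF s(1) B \<eta>] by (simp add: algebra_simps)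
  show "integrable lborel (\<lambda>x. kernel_integrand B \<eta> F s (Complex x 0))" by (rule shift(2)) auto
qed

lemma Re_le_ln:
  assumes "Re s > 1/2" "cmod (depoled_zeta s) \<le> D" "D > 0"
  shows "Re (F s) \<le> ln D"
proof -
  have "exp (Re (F s)) = cmod (depoled_zeta s)" using exp_eq[OF assms(1)] norm_exp_eq_Re by metis
  thus ?thesis using assms by (simp add: ln_ge_iff)
qed

lemma Re_le_ln_exp:
  obtains L where "L \<ge> 0" and "\<And>\<tau> \<epsilon> x. \<tau> \<ge> 1 \<Longrightarrow> 0 < \<epsilon> \<Longrightarrow> \<epsilon> \<le> 1/2 \<Longrightarrow>
    Re (F (Complex (1/2 + \<epsilon>) \<tau> + \<i> * of_real x)) \<le> L * (1 + ln \<tau>) * exp (2 * \<bar>x\<bar>)"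
proof -
  obtain C where C: "C \<ge> 1" "\<And>s. Re s \<ge> 1/2 \<Longrightarrow> cmod (depoled_zeta s) \<le> C * (1 + cmod s)\<^sup>2"
    using norm_depoled_zeta_le[of "1/2"] by auto
  define L where "L = ln C + 2 * ln 3 + 2"
  have "Re (F s) \<le> L * (1 + ln \<tau>) * exp (2 * \<bar>x\<bar>)"
    if \<tau>: "\<tau> \<ge> 1" and \<epsilon>: "0 < \<epsilon>" "\<epsilon> \<le> 1/2"
      and s: "s = Complex (1/2 + \<epsilon>) \<tau> + \<i> * of_real x" for \<tau> \<epsilon> x s
  proof -
    have "1 + cmod s \<le> 2 + \<tau> + \<bar>x\<bar>" using cmod_le[of s] \<epsilon> \<tau> by (simp add: s)
    also have "\<dots> \<le> 3 * \<tau> + 3 * (\<tau> * \<bar>x\<bar>)" using \<tau> mult_right_mono[of 1 \<tau> "\<bar>x\<bar>"] by simp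
    finally have s_le: "1 + cmod s \<le> 3 * \<tau> * (1 + \<bar>x\<bar>)" by (simp add: algebra_simps)
    have "cmod (depoled_zeta s) \<le> C * (1 + cmod s)\<^sup>2" using \<epsilon> by (intro C) (simp add: s)
    also have "\<dots> \<le> C * (3 * \<tau> * (1 + \<bar>x\<bar>))\<^sup>2"
      using C(1) s_le by (intro mult_left_mono power_mono) auto
    finally have "Re (F s) \<le> ln (C * (3 * \<tau> * (1 + \<bar>x\<bar>))\<^sup>2)"
      using C(1) \<tau> \<epsilon> by (intro Re_le_ln) (auto simp: s)
    also have "\<dots> = ln C + 2 * (ln 3 + ln \<tau> + ln (1 + \<bar>x\<bar>))"
      using C(1) \<tau> by (simp add: ln_mult ln_realpow)
    also have "\<dots> \<le> ln C + 2 * ln 3 + 2 * ln \<tau> + 2 * \<bar>x\<bar>"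
      using ln_add_one_self_le_self[of "\<bar>x\<bar>"] by simp
    also have "\<dots> \<le> L * (1 + ln \<tau>) * (1 + 2 * \<bar>x\<bar>)"
    proof -
      have "2 * ln \<tau> \<le> L * ln \<tau>" using \<tau> C(1) by (intro mult_right_mono) (auto simp: L_def)
      hence "ln C + 2 * ln 3 + 2 * ln \<tau> + 2 \<le> L * (1 + ln \<tau>)"
        by (simp add: L_def algebra_simps)
      moreover from this have "1 * (2 * \<bar>x\<bar>) \<le> L * (1 + ln \<tau>) * (2 * \<bar>x\<bar>)"
        using \<tau> C(1) by (intro mult_right_mono) (auto intro: order_trans[rotated])
      ultimately show ?thesis by (simp only: distrib_left mult_1_right; linarith)
    qed
    also have "\<dots> \<le> L * (1 + ln \<tau>) * exp (2 * \<bar>x\<bar>)"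
      using C(1) \<tau> by (intro mult_left_mono exp_ge_add_one_self) (auto simp: L_def)
    finally show ?thesis .
  qed
  moreover have "L \<ge> 0" using C(1) by (simp add: L_def)
  ultimately show ?thesis by (intro that[of L]) blast+
qed

end

lemma norm_deriv_depoled_zeta_le:
  obtains C where "C \<ge> 0" and "\<And>u. 1/2 \<le> Re u \<Longrightarrow> Re u \<le> 3/2 \<Longrightarrow>
    cmod (deriv depoled_zeta u) \<le> C * (1 + \<bar>Im u\<bar>)\<^sup>2"
proof -
  obtain C where C: "C \<ge> 1" "\<And>s. Re s \<ge> 1/4 \<Longrightarrow> cmod (depoled_zeta s) \<le> C * (1 + cmod s)\<^sup>2"
    using norm_depoled_zeta_le[of "1/4"] by auto
  show ?thesis
  proof
    fix u assume u: "1/2 \<le> Re u" "Re u \<le> 3/2"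
    have near: "Re w \<ge> 1/4 \<and> \<bar>Re w\<bar> \<le> 7/4 \<and> \<bar>Im w\<bar> \<le> \<bar>Im u\<bar> + 1/4" if "cmod (u - w) \<le> 1/4" for w
      using abs_Re_le_cmod[of "u - w"] abs_Im_le_cmod[of "u - w"] that u by auto
    have hol: "depoled_zeta holomorphic_on cball u (1/4)"
      by (rule holomorphic_on_subset[OF holomorphic_depoled_zeta])
         (use near in \<open>force simp: dist_norm\<close>)
    have "cmod ((deriv ^^ 1) depoled_zeta u) \<le> fact 1 * (C * (3 * (1 + \<bar>Im u\<bar>))\<^sup>2) / (1/4) ^ 1"
    proof (rule Cauchy_inequality)
      show "depoled_zeta holomorphic_on ball u (1/4)" by (rule holomorphic_on_subset[OF hol]) auto
      show "continuous_on (cball u (1/4)) depoled_zeta"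
        by (rule holomorphic_on_imp_continuous_on[OF hol])
      fix w assume "cmod (u - w) = 1/4"
      hence w: "Re w \<ge> 1/4" "1 + cmod w \<le> 3 * (1 + \<bar>Im u\<bar>)" using near[of w] cmod_le[of w] by auto
      hence "C * (1 + cmod w)\<^sup>2 \<le> C * (3 * (1 + \<bar>Im u\<bar>))\<^sup>2"
        using C(1) by (intro mult_left_mono power_mono) auto
      thus "cmod (depoled_zeta w) \<le> C * (3 * (1 + \<bar>Im u\<bar>))\<^sup>2" using C(2)[OF w(1)] by simp
    qed auto
    thus "cmod (deriv depoled_zeta u) \<le> 36 * C * (1 + \<bar>Im u\<bar>)\<^sup>2"
      by (simp add: power_mult_distrib del: distrib_left_numeral)
  qed (use C(1) in simp)
qed

lemma depoled_zeta_near_critical_line: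
  obtains C where "C \<ge> 0" and "\<And>t \<epsilon>. 0 \<le> \<epsilon> \<Longrightarrow> \<epsilon> \<le> 1 \<Longrightarrow>
    cmod (depoled_zeta (Complex (1/2 + \<epsilon>) t) - depoled_zeta (Complex (1/2) t)) \<le>
      C * (1 + \<bar>t\<bar>)\<^sup>2 * \<epsilon>"
proof -
  obtain C where C: "C \<ge> 0" "\<And>u. 1/2 \<le> Re u \<Longrightarrow> Re u \<le> 3/2 \<Longrightarrow>
      cmod (deriv depoled_zeta u) \<le> C * (1 + \<bar>Im u\<bar>)\<^sup>2"
    using norm_deriv_depoled_zeta_le by blast
  show ?thesis
  proof
    fix t \<epsilon> :: real assume \<epsilon>: "0 \<le> \<epsilon>" "\<epsilon> \<le> 1"
    let ?S = "closed_segment (Complex (1/2) t) (Complex (1/2 + \<epsilon>) t)"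
    have seg: "Im u = t \<and> 1/2 \<le> Re u \<and> Re u \<le> 3/2" if "u \<in> ?S" for u
      using that \<epsilon> by (subst (asm) closed_segment_same_Im) (auto simp: closed_segment_eq_real_ivl)
    have "cmod (depoled_zeta (Complex (1/2 + \<epsilon>) t) - depoled_zeta (Complex (1/2) t)) \<le>
        C * (1 + \<bar>t\<bar>)\<^sup>2 * cmod (Complex (1/2 + \<epsilon>) t - Complex (1/2) t)"
    proof (rule field_differentiable_bound[where S="?S" and f'="deriv depoled_zeta"])
      fix u assume u: "u \<in> ?S"
      have "(depoled_zeta has_field_derivative deriv depoled_zeta u) (at u)"
        using holomorphic_derivI[OF holomorphic_depoled_zeta open_halfspace_Re_gt, of u] seg[OF u]
        by auto
      thus "(depoled_zeta has_field_derivative deriv depoled_zeta u) (at u within ?S)"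
        by (rule has_field_derivative_at_within)
      show "cmod (deriv depoled_zeta u) \<le> C * (1 + \<bar>t\<bar>)\<^sup>2" using C(2)[of u] seg[OF u] by simp
    qed auto
    also have "cmod (Complex (1/2 + \<epsilon>) t - Complex (1/2) t) = \<epsilon>" using \<epsilon> by (simp add: cmod_def)
    finally show "cmod (depoled_zeta (Complex (1/2 + \<epsilon>) t) - depoled_zeta (Complex (1/2) t)) \<le>
        C * (1 + \<bar>t\<bar>)\<^sup>2 * \<epsilon>" .
  qed (rule C(1))
qed

definition window :: "real \<Rightarrow> real \<Rightarrow> real" where
  "window \<eta> \<tau> = (ln (ln (ln \<tau>)) + ln (4 / \<eta>)) / pi"

lemma exp_cosh_window_le:
  assumes "\<eta> > 0" "ln \<tau> > 1"
  shows "exp (- \<eta> * cosh (pi * window \<eta> \<tau>)) \<le> 1 / (ln \<tau>)\<^sup>2"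
proof -
  have pos: "ln (ln \<tau>) > 0" "ln \<tau> > 0" using assms by auto
  have "exp (pi * window \<eta> \<tau>) = ln (ln \<tau>) * (4 / \<eta>)"
    using assms pos by (simp add: window_def exp_add)
  moreover have "exp (pi * window \<eta> \<tau>) / 2 \<le> cosh (pi * window \<eta> \<tau>)" by (simp add: cosh_def)
  ultimately have "\<eta> * (ln (ln \<tau>) * (4 / \<eta>) / 2) \<le> \<eta> * cosh (pi * window \<eta> \<tau>)"
    using assms by (intro mult_left_mono) auto
  hence "exp (- \<eta> * cosh (pi * window \<eta> \<tau>)) \<le> exp (- (2 * ln (ln \<tau>)))" using assms by simp
  also have "\<dots> = 1 / (ln \<tau>)\<^sup>2" using pos by (simp add: exp_minus exp_double inverse_eq_divide)
  finally show ?thesis .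
qed

lemma eventually_window_le:
  "\<forall>\<^sub>F T in at_top. \<forall>\<tau>. \<bar>\<tau> - T\<bar> \<le> R \<longrightarrow> window \<eta> \<tau> < 1 / pi * ln (ln (ln T)) + ln (4 / \<eta>) / pi + 1"
proof -
  have "((\<lambda>T. ln (ln (ln (T + R))) - ln (ln (ln T))) \<longlongrightarrow> 0) at_top" by real_asymp
  hence "\<forall>\<^sub>F T in at_top. ln (ln (ln (T + R))) - ln (ln (ln T)) < pi"
    by (rule order_tendstoD) simp
  moreover have "\<forall>\<^sub>F T in at_top. ln (ln (T - R)) > 0 \<and> ln (T - R) > 0 \<and> T - R > 0"
    by (intro eventually_conj; real_asymp)
  ultimately show ?thesis
  proof eventually_elim
    case (elim T)
    show ?case
    proof safe
      fix \<tau> assume "\<bar>\<tau> - T\<bar> \<le> R"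
      hence \<tau>: "T - R \<le> \<tau>" "\<tau> \<le> T + R" "\<tau> > 0" using elim by linarith+
      hence "ln (T - R) \<le> ln \<tau>" using elim by simp
      hence ln_pos: "ln \<tau> > 0" and "ln (ln (T - R)) \<le> ln (ln \<tau>)" using elim by auto
      hence ln_ln_pos: "ln (ln \<tau>) > 0" using elim by linarith
      have "ln \<tau> \<le> ln (T + R)" using \<tau> by simp
      hence "ln (ln \<tau>) \<le> ln (ln (T + R))" using ln_pos by simp
      hence "ln (ln (ln \<tau>)) \<le> ln (ln (ln (T + R)))" using ln_ln_pos by simp
      hence "ln (ln (ln \<tau>)) < ln (ln (ln T)) + pi" using elim by linarith
      hence "ln (ln (ln \<tau>)) / pi < (ln (ln (ln T)) + pi) / pi"
        by (rule divide_strict_right_mono) simp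
      thus "window \<eta> \<tau> < 1 / pi * ln (ln (ln T)) + ln (4 / \<eta>) / pi + 1"
        by (simp add: window_def add_divide_distrib)
    qed
  qed
qed

lemma eventually_norm_depoled_zeta_le:
  assumes A: "A \<ge> 0"
  shows "\<forall>\<^sub>F \<tau> in at_top. \<forall>t. \<bar>t\<bar> \<le> 2 * \<tau> \<longrightarrow> cmod (zeta (Complex (1/2) t)) \<le> A \<longrightarrow>
    cmod (depoled_zeta (Complex (1/2 + 1 / \<tau> ^ 3) t)) \<le> A + 1"
proof -
  obtain C where C: "C \<ge> 0" and near: "\<And>t \<epsilon>. 0 \<le> \<epsilon> \<Longrightarrow> \<epsilon> \<le> 1 \<Longrightarrow>
      cmod (depoled_zeta (Complex (1/2 + \<epsilon>) t) - depoled_zeta (Complex (1/2) t)) \<le>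
        C * (1 + \<bar>t\<bar>)\<^sup>2 * \<epsilon>"
    using depoled_zeta_near_critical_line by blast
  have "((\<lambda>\<tau>. C * ((1 + 2 * \<tau>)\<^sup>2 * (1 / \<tau> ^ 3))) \<longlongrightarrow> C * 0) at_top"
    by (intro tendsto_intros) real_asymp
  hence "\<forall>\<^sub>F \<tau> in at_top. C * ((1 + 2 * \<tau>)\<^sup>2 * (1 / \<tau> ^ 3)) < 1" by (rule order_tendstoD) simp
  moreover have "\<forall>\<^sub>F \<tau> in at_top. 0 \<le> 1 / \<tau> ^ 3 \<and> 1 / \<tau> ^ 3 \<le> (1::real)"
    by (intro eventually_conj; real_asymp)
  ultimately show ?thesis
  proof eventually_elim
    case (elim \<tau>)
    define \<epsilon> where "\<epsilon> = 1 / \<tau> ^ 3"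
    have \<epsilon>: "0 \<le> \<epsilon>" "\<epsilon> \<le> 1" using elim by (auto simp: \<epsilon>_def)
    have "cmod (depoled_zeta (Complex (1/2 + \<epsilon>) t)) \<le> A + 1"
      if t: "\<bar>t\<bar> \<le> 2 * \<tau>" and small: "cmod (zeta (Complex (1/2) t)) \<le> A" for t
    proof -
      have "C * (1 + \<bar>t\<bar>)\<^sup>2 * \<epsilon> \<le> C * (1 + 2 * \<tau>)\<^sup>2 * \<epsilon>"
        using t C \<epsilon> by (intro mult_right_mono mult_left_mono power_mono) auto
      hence "cmod (depoled_zeta (Complex (1/2 + \<epsilon>) t) - depoled_zeta (Complex (1/2) t)) \<le> 1"
        using near[OF \<epsilon>, of t] elim by (simp add: \<epsilon>_def)
      moreover have "cmod (depoled_zeta (Complex (1/2) t)) \<le> 1 * A"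
      proof -
        have "depoled_zeta (Complex (1/2) t) =
            pole_factor (Complex (1/2) t) * zeta (Complex (1/2) t)"
          by (rule depoled_zeta_eq) (auto simp: complex_eq_iff)
        thus ?thesis
          using small norm_pole_factor_le_1[of "Complex (1/2) t"]
          by (simp only: norm_mult) (intro mult_mono; simp)
      qed
      ultimately show ?thesis
        using norm_triangle_sub[of
            "depoled_zeta (Complex (1/2 + \<epsilon>) t)" "depoled_zeta (Complex (1/2) t)"]
        by linarith
    qed
    thus ?case by (simp add: \<epsilon>_def)
  qed
qed

context log_depoled_zeta
begin

lemma eventually_Re_kernel_avg_less:
  assumes A: "A \<ge> 0" and B: "B > 0" and \<eta>: "\<eta> > 0" and \<delta>: "\<delta> > 0"
  shows "\<forall>\<^sub>F \<tau> in at_top. (\<forall>t. \<bar>t - \<tau>\<bar> \<le> window \<eta> \<tau> \<longrightarrow> cmod (zeta (Complex (1/2) t)) \<le> A) \<longrightarrow>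
    Re (kernel_avg B \<eta> 0 F (Complex (1/2 + 1 / \<tau> ^ 3) \<tau>)) < ln (A + 1) * sqrt (pi / B) + \<delta>"
proof -
  obtain L where L: "L \<ge> 0" and far: "\<And>\<tau> \<epsilon> x. \<tau> \<ge> 1 \<Longrightarrow> 0 < \<epsilon> \<Longrightarrow> \<epsilon> \<le> 1/2 \<Longrightarrow>
      Re (F (Complex (1/2 + \<epsilon>) \<tau> + \<i> * of_real x)) \<le> L * (1 + ln \<tau>) * exp (2 * \<bar>x\<bar>)"
    using Re_le_ln_exp by blast
  define I where "I = (LINT x|lborel. gauss_exp 2 B x)"
  have "I \<ge> 0" by (simp add: I_def)
  have "((\<lambda>\<tau>. L * I * ((1 + ln \<tau>) / (ln \<tau>)\<^sup>2)) \<longlongrightarrow> L * I * 0) at_top"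
    by (intro tendsto_intros) real_asymp
  hence "\<forall>\<^sub>F \<tau> in at_top. L * I * ((1 + ln \<tau>) / (ln \<tau>)\<^sup>2) < \<delta>"
    using \<delta> by (intro order_tendstoD(2)) auto
  moreover have "\<forall>\<^sub>F \<tau> in at_top. window \<eta> \<tau> \<ge> 0 \<and> window \<eta> \<tau> \<le> \<tau> \<and> ln \<tau> > 1 \<and> \<tau> > 1 \<and>
      1 / \<tau> ^ 3 \<le> (1/2::real)"
    unfolding window_def by (intro eventually_conj; real_asymp)
  ultimately show ?thesis using eventually_norm_depoled_zeta_le[OF A]
  proof eventually_elim
    case (elim \<tau>)
    let ?s = "Complex (1/2 + 1 / \<tau> ^ 3) \<tau>" and ?h = "window \<eta> \<tau>"
    have s: "?s + \<i> * of_real x = Complex (1/2 + 1 / \<tau> ^ 3) (\<tau> + x)" for x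
      by (simp add: complex_eq_iff)
    show ?case
    proof
      assume small: "\<forall>t. \<bar>t - \<tau>\<bar> \<le> ?h \<longrightarrow> cmod (zeta (Complex (1/2) t)) \<le> A"
      have near: "Re (F (?s + \<i> * of_real x)) \<le> ln (A + 1)" if x: "\<bar>x\<bar> \<le> ?h" for x
      proof -
        have "\<bar>\<tau> + x\<bar> \<le> 2 * \<tau>" using x elim by linarith
        thus ?thesis using elim small x A by (intro Re_le_ln) (auto simp: s)
      qed
      have "Re (kernel_avg B \<eta> 0 F ?s) \<le>
          ln (A + 1) * sqrt (pi / B) + L * (1 + ln \<tau>) * exp (- \<eta> * cosh (pi * ?h)) * I"
        unfolding I_def using A B \<eta> L elim
        by (intro Re_kernel_avg_le near far kernel_avg_eq(2)) auto
      also have "L * (1 + ln \<tau>) * exp (- \<eta> * cosh (pi * ?h)) * I \<le>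
          L * (1 + ln \<tau>) * (1 / (ln \<tau>)\<^sup>2) * I"
        using exp_cosh_window_le[OF \<eta>, of \<tau>] elim L \<open>I \<ge> 0\<close>
        by (intro mult_right_mono mult_left_mono) auto
      also have "L * (1 + ln \<tau>) * (1 / (ln \<tau>)\<^sup>2) * I = L * I * ((1 + ln \<tau>) / (ln \<tau>)\<^sup>2)" by simp
      also have "\<dots> < \<delta>" using elim by simp
      finally show "Re (kernel_avg B \<eta> 0 F ?s) < ln (A + 1) * sqrt (pi / B) + \<delta>" by simp
    qed
  qed
qed

lemma eventually_Re_smoothed_log_zeta_less:
  assumes A: "A \<ge> 0" and B: "B > 0" and \<eta>: "\<eta> > 0"
  shows "\<forall>\<^sub>F \<tau> in at_top. (\<forall>t. \<bar>t - \<tau>\<bar> \<le> window \<eta> \<tau> \<longrightarrow> cmod (zeta (Complex (1/2) t)) \<le> A) \<longrightarrow>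
    Re (smoothed_log_zeta B \<eta> (Complex (1/2 + 1 / \<tau> ^ 3) \<tau>)) < (ln (A + 1) + 1) * sqrt (pi / B)"
proof -
  define g where "g = sqrt (pi / B)"
  have g: "g > 0" using B by (simp add: g_def)
  define P where "P = 112 * exp (B / 4) * (LINT x|lborel. gauss_exp 5 B x)"
  have "((\<lambda>\<tau>. P * (1 / \<tau>)) \<longlongrightarrow> P * 0) at_top" by (intro tendsto_intros) real_asymp
  hence "\<forall>\<^sub>F \<tau> in at_top. P * (1 / \<tau>) < g / 2" using g by (intro order_tendstoD(2)) auto
  moreover have "\<forall>\<^sub>F \<tau> in at_top. \<tau> > 8 \<and> 0 < 1 / \<tau> ^ 3 \<and> 1 / \<tau> ^ 3 \<le> (1::real)"
    by (intro eventually_conj; real_asymp)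
  moreover have "\<forall>\<^sub>F \<tau> in at_top. (\<forall>t. \<bar>t - \<tau>\<bar> \<le> window \<eta> \<tau> \<longrightarrow> cmod (zeta (Complex (1/2) t)) \<le> A) \<longrightarrow>
      Re (kernel_avg B \<eta> 0 F (Complex (1/2 + 1 / \<tau> ^ 3) \<tau>)) < ln (A + 1) * g + g / 2"
    unfolding g_def using B by (intro eventually_Re_kernel_avg_less A \<eta>) auto
  ultimately show ?thesis
  proof eventually_elim
    case (elim \<tau>)
    let ?s = "Complex (1/2 + 1 / \<tau> ^ 3) \<tau>"
    let ?D = "kernel_avg B \<eta> (-1/2) (\<lambda>w. Ln (pole_factor w)) ?s"
    have "Re (kernel_avg B \<eta> 0 F ?s) = Re (smoothed_log_zeta B \<eta> ?s) + Re ?D"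
      using elim B \<eta> by (subst kernel_avg_eq(1)) auto
    moreover have "\<bar>Re ?D\<bar> \<le> P * (1 / \<tau>)"
      using norm_kernel_avg_Ln_pole_factor_le[OF B less_imp_le[OF \<eta>], of \<tau>] abs_Re_le_cmod[of ?D]
        elim
      by (simp add: P_def)
    ultimately have "Re (smoothed_log_zeta B \<eta> ?s) < ln (A + 1) * g + g"
      if "\<forall>t. \<bar>t - \<tau>\<bar> \<le> window \<eta> \<tau> \<longrightarrow> cmod (zeta (Complex (1/2) t)) \<le> A"
      using elim(1) mp[OF elim(3) that] by linarith
    thus ?case by (simp add: g_def distrib_right)
  qed
qed

end


section \<open>Large values\<close>

lemma relatively_dense_cis_near_1:
  fixes \<xi> :: "'i \<Rightarrow> real"
  assumes "finite I" "\<delta> > 0"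
  obtains R where "R \<ge> 0" and "\<And>T. \<exists>\<tau>. \<bar>\<tau> - T\<bar> \<le> R \<and> (\<forall>i\<in>I. cmod (cis (\<tau> * \<xi> i) - 1) \<le> \<delta>)"
proof -
  have "\<forall>e>0. \<exists>K. finite K \<and> K \<subseteq> sphere (0::complex) 1 \<and> sphere 0 1 \<subseteq> (\<Union>z\<in>K. ball z e)"
    by (intro seq_compact_imp_totally_bounded compact_imp_seq_compact compact_sphere)
  from this[rule_format, OF half_gt_zero[OF assms(2)]]
  obtain K where K: "finite K" "sphere (0::complex) 1 \<subseteq> (\<Union>z\<in>K. ball z (\<delta> / 2))" by metis
  have "\<exists>z\<in>K. dist z (cis \<theta>) < \<delta> / 2" for \<theta>
    using K(2) by (force simp: subset_iff)
  then obtain centre where centre: "\<And>\<theta>. centre \<theta> \<in> K" "\<And>\<theta>. dist (centre \<theta>) (cis \<theta>) < \<delta> / 2"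
    by metis
  define c where "c = (\<lambda>T. restrict (\<lambda>i. centre (T * \<xi> i)) I)"
  have "range c \<subseteq> I \<rightarrow>\<^sub>E K" using centre(1) by (auto simp: c_def)
  hence "finite (range c)" using finite_PiE[OF assms(1), of "\<lambda>_. K"] K(1) finite_subset by blast
  hence fin: "finite (inv_into UNIV c ` range c)" by simp
  define R where "R = Max (insert 0 (abs ` inv_into UNIV c ` range c))"
  show ?thesis
  proof
    show "R \<ge> 0" using fin by (simp add: R_def)
    fix T
    define t where "t = inv_into UNIV c (c T)"
    have ct: "c t = c T" unfolding t_def by (rule f_inv_into_f) simp
    have "cmod (cis ((T - t) * \<xi> i) - 1) \<le> \<delta>" if "i \<in> I" for i
    proof -
      have "centre (t * \<xi> i) = centre (T * \<xi> i)"
        using fun_cong[OF ct, of i] that by (simp add: c_def)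
      hence "dist (cis (T * \<xi> i)) (cis (t * \<xi> i)) < \<delta>"
        using centre(2)[of "T * \<xi> i"] centre(2)[of "t * \<xi> i"] by (metis dist_triangle_half_r)
      moreover have "cis (T * \<xi> i) - cis (t * \<xi> i) = cis (t * \<xi> i) * (cis ((T - t) * \<xi> i) - 1)"
        by (simp add: right_diff_distrib cis_mult algebra_simps)
      ultimately show ?thesis by (simp add: dist_norm norm_mult)
    qed
    moreover have "\<bar>t\<bar> \<le> R" unfolding R_def t_def using fin by (intro Max_ge) auto
    hence "\<bar>(T - t) - T\<bar> \<le> R" by simp
    ultimately show "\<exists>\<tau>. \<bar>\<tau> - T\<bar> \<le> R \<and> (\<forall>i\<in>I. cmod (cis (\<tau> * \<xi> i) - 1) \<le> \<delta>)" by blast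
  qed
qed

lemma summable_inverse_mult_ln_squared: "summable (\<lambda>n. 1 / (real (Suc n) * (ln (real (Suc n)))\<^sup>2))"
proof -
  have "(\<lambda>n. 1 / ln (real (n + 2))) \<longlonglongrightarrow> 0" by real_asymp
  from telescope_summable'[OF this]
  have "summable (\<lambda>n. 1 / ln (real (n + 2)) - 1 / ln (real (Suc n + 2)))" by simp
  hence "summable (\<lambda>n. 1 / (real (Suc (n + 2)) * (ln (real (Suc (n + 2))))\<^sup>2))"
  proof (rule summable_comparison_test'[where N=0])
    fix n :: nat
    define a where "a = real (n + 2)"
    have a: "a \<ge> 2" "ln a > 0" "ln (a + 1) \<ge> ln a" by (auto simp: a_def)
    have "ln (a / (a + 1)) \<le> a / (a + 1) - 1" using a by (intro ln_le_minus_one) auto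
    hence "1 / (a + 1) \<le> ln (a + 1) - ln a" using a by (simp add: ln_div field_simps)
    hence "1 / (a + 1) / (ln (a + 1) * ln (a + 1)) \<le> (ln (a + 1) - ln a) / (ln a * ln (a + 1))"
      using a by (intro frac_le mult_right_mono) auto
    also have "\<dots> = 1 / ln a - 1 / ln (a + 1)" using a by (simp add: field_simps)
    finally show "norm (1 / (real (Suc (n + 2)) * (ln (real (Suc (n + 2))))\<^sup>2)) \<le>
        1 / ln (real (n + 2)) - 1 / ln (real (Suc n + 2))"
      by (simp add: a_def power2_eq_square add.commute add.left_commute)
  qed
  thus ?thesis
    by (subst (asm) summable_iff_shift[where f="\<lambda>n. 1 / (real (Suc n) * (ln (real (Suc n)))\<^sup>2)"])
qed

lemma smoothed_log_term_majorant:
  assumes B: "B > 0"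
  obtains Q where "summable Q" and "\<And>\<eta> s n. 0 \<le> \<eta> \<Longrightarrow> \<eta> \<le> 1 \<Longrightarrow> Re s \<ge> 1/2 \<Longrightarrow>
    cmod (smoothed_log_term B \<eta> s n) \<le> Q n"
proof -
  obtain C where C: "C \<ge> 0" "\<And>\<eta> \<xi>. 0 \<le> \<eta> \<Longrightarrow> \<eta> \<le> 1 \<Longrightarrow> \<xi> > 0 \<Longrightarrow>
      cmod (kernel_ft B \<eta> \<xi>) \<le> C * exp (- \<xi> / 2) / \<xi>\<^sup>2"
    using norm_kernel_ft_le[OF B] by blast
  have "cmod (smoothed_log_term B \<eta> s n) \<le> C * (1 / (real (Suc n) * (ln (real (Suc n)))\<^sup>2))"
    if \<eta>: "0 \<le> \<eta>" "\<eta> \<le> 1" and s: "Re s \<ge> 1/2" for \<eta> s n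
  proof (cases "n = 0")
    case False
    define \<xi> where "\<xi> = ln (real (Suc n))"
    have \<xi>: "\<xi> > 0" "exp \<xi> = real (Suc n)" using False by (auto simp: \<xi>_def)
    have "\<bar>log_coeff n\<bar> * real (Suc n) powr (- Re s) \<le> 1 * real (Suc n) powr (-1/2)"
      using s by (intro mult_mono abs_log_coeff_le powr_mono) auto
    also have "\<dots> = exp (- \<xi> / 2)" by (simp add: powr_def \<xi>_def)
    finally have "cmod (smoothed_log_term B \<eta> s n) \<le> exp (- \<xi> / 2) * (C * exp (- \<xi> / 2) / \<xi>\<^sup>2)"
      unfolding smoothed_log_term_def norm_mult[of _ "kernel_ft _ _ _"]
        norm_dirichlet_term \<xi>_def[symmetric]
      using \<eta> \<xi> by (intro mult_mono C) auto
    also have "\<dots> = C * (exp (- \<xi> / 2) * exp (- \<xi> / 2)) / \<xi>\<^sup>2" by simp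
    also have "exp (- \<xi> / 2) * exp (- \<xi> / 2) = 1 / real (Suc n)"
      using \<xi>(2) by (simp add: exp_add[symmetric] exp_minus inverse_eq_divide)
    finally show ?thesis by (simp add: \<xi>_def)
  qed (simp add: smoothed_log_term_def)
  moreover have "summable (\<lambda>n. C * (1 / (real (Suc n) * (ln (real (Suc n)))\<^sup>2)))"
    by (intro summable_mult summable_inverse_mult_ln_squared)
  ultimately show ?thesis by (rule that[rotated])
qed

lemma smoothed_log_zeta_tail_le:
  assumes B: "B > 0" and \<delta>: "\<delta> > 0"
  obtains N where "\<And>M \<eta> s. M \<ge> N \<Longrightarrow> 0 \<le> \<eta> \<Longrightarrow> \<eta> \<le> 1 \<Longrightarrow> Re s > 1/2 \<Longrightarrow>
    cmod (smoothed_log_zeta B \<eta> s - (\<Sum>n<M. smoothed_log_term B \<eta> s n)) \<le> \<delta>"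
proof -
  obtain Q where Q: "summable Q" and term_le: "\<And>\<eta> s n. 0 \<le> \<eta> \<Longrightarrow> \<eta> \<le> 1 \<Longrightarrow> Re s \<ge> 1/2 \<Longrightarrow>
      cmod (smoothed_log_term B \<eta> s n) \<le> Q n"
    using smoothed_log_term_majorant[OF B] by blast
  obtain N where N: "\<And>M. M \<ge> N \<Longrightarrow> norm (\<Sum>n. Q (n + M)) < \<delta>"
    using suminf_exist_split[OF \<delta> Q] by blast
  show ?thesis
  proof
    fix M and \<eta> :: real and s assume range: "M \<ge> N" "0 \<le> \<eta>" "\<eta> \<le> 1" "Re s > 1/2"
    have sums: "smoothed_log_term B \<eta> s sums smoothed_log_zeta B \<eta> s"
      using range B by (intro smoothed_log_zeta_sums) auto
    have "smoothed_log_zeta B \<eta> s - (\<Sum>n<M. smoothed_log_term B \<eta> s n) =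
        (\<Sum>n. smoothed_log_term B \<eta> s (n + M))"
      using suminf_minus_initial_segment[OF sums_summable[OF sums], of M]
      by (simp add: smoothed_log_zeta_def)
    also have "cmod \<dots> \<le> (\<Sum>n. Q (n + M))"
      using Q range by (intro norm_suminf_le term_le) (auto simp: summable_iff_shift)
    also have "\<dots> \<le> \<delta>" using N[OF range(1)] by simp
    finally show "cmod (smoothed_log_zeta B \<eta> s - (\<Sum>n<M. smoothed_log_term B \<eta> s n)) \<le> \<delta>" .
  qed
qed

lemma Re_mult_near_1_ge:
  assumes "cmod e = 1" "cmod (e - 1) \<le> 1/2" "cmod (z - of_real g) \<le> \<delta>" "g \<ge> 0"
  shows "Re (e * z) \<ge> g / 2 - \<delta>"
proof -
  have "e * z = of_real g + ((e - 1) * of_real g + e * (z - of_real g))"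
    by (simp add: algebra_simps)
  moreover have "\<bar>Re ((e - 1) * of_real g)\<bar> \<le> 1/2 * g"
    using abs_Re_le_cmod[of "(e - 1) * of_real g"] mult_right_mono[OF assms(2,4)] assms(4)
    by (simp add: norm_mult)
  moreover have "\<bar>Re (e * (z - of_real g))\<bar> \<le> \<delta>"
    using abs_Re_le_cmod[of "e * (z - of_real g)"] assms(1,3) by (simp add: norm_mult)
  ultimately show ?thesis by simp
qed

definition gaussian_log_sum :: "real \<Rightarrow> real \<Rightarrow> nat \<Rightarrow> real" where
  "gaussian_log_sum B \<sigma> M =
     (\<Sum>n<M. log_coeff n * real (Suc n) powr (- \<sigma>) * exp (- (ln (real (Suc n)))\<^sup>2 / (4 * B)))"

lemma Re_sum_smoothed_log_term_ge:
  assumes B: "B > 0" and \<eta>: "\<eta> \<ge> 0" and s: "Re s \<ge> 0"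
    and phase: "\<And>n. n < M \<Longrightarrow> cmod (cis (- (Im s * ln (real (Suc n)))) - 1) \<le> 1/2"
  shows "Re (\<Sum>n<M. smoothed_log_term B \<eta> s n) \<ge>
    sqrt (pi / B) / 2 * gaussian_log_sum B (Re s) M -
      real M * (\<eta> * (LINT x|lborel. gauss_exp pi B x))"
proof -
  define \<delta> where "\<delta> = \<eta> * (LINT x|lborel. gauss_exp pi B x)"
  define G where "G = (\<lambda>n. sqrt (pi / B) * exp (- (ln (real (Suc n)))\<^sup>2 / (4 * B)))"
  define q where "q = (\<lambda>n. log_coeff n * real (Suc n) powr (- Re s))"
  have "Re (smoothed_log_term B \<eta> s n) \<ge> q n * G n / 2 - \<delta>" if "n < M" for n
  proof -
    have "q n \<le> 1 * real (Suc n) powr 0"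
      unfolding q_def using s abs_log_coeff_le[of n] by (intro mult_mono powr_mono) auto
    moreover have "q n \<ge> 0" unfolding q_def by (intro mult_nonneg_nonneg log_coeff_nonneg) auto
    moreover have "\<delta> \<ge> 0" using \<eta> by (simp add: \<delta>_def)
    ultimately have q: "q n \<ge> 0" "q n * \<delta> \<le> \<delta>" by (auto intro: mult_left_le_one_le)
    define e where "e = cis (- (Im s * ln (real (Suc n))))"
    have "Re (e * kernel_ft B \<eta> (ln (real (Suc n)))) \<ge> G n / 2 - \<delta>"
      unfolding e_def G_def \<delta>_def using phase[OF that] B \<eta>
      by (intro Re_mult_near_1_ge norm_kernel_ft_minus_gaussian_le) auto
    hence "q n * (G n / 2 - \<delta>) \<le> q n * Re (e * kernel_ft B \<eta> (ln (real (Suc n))))"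
      using q(1) by (rule mult_left_mono)
    also have "\<dots> = Re (smoothed_log_term B \<eta> s n)"
      unfolding smoothed_log_term_def Suc_powr_eq_cis q_def e_def
      by (simp add: mult.assoc del: of_nat_Suc)
    finally show ?thesis using q(2) by (simp add: right_diff_distrib)
  qed
  hence "(\<Sum>n<M. q n * G n / 2 - \<delta>) \<le> (\<Sum>n<M. Re (smoothed_log_term B \<eta> s n))"
    by (intro sum_mono) auto
  moreover have "(\<Sum>n<M. q n * G n / 2) = sqrt (pi / B) / 2 * gaussian_log_sum B (Re s) M"
    unfolding gaussian_log_sum_def sum_distrib_left by (intro sum.cong) (auto simp: G_def q_def)
  ultimately show ?thesis by (simp add: sum_subtractf \<delta>_def)
qed

lemma powr_mult_gaussian_ge_quarter:
  assumes n: "n < M" and \<epsilon>: "0 \<le> \<epsilon>" "\<epsilon> * ln (real M + 1) \<le> ln 2"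
    and B: "B \<ge> (ln (real M + 1))\<^sup>2" "B > 0"
  shows "real (Suc n) powr (- \<epsilon>) * exp (- (ln (real (Suc n)))\<^sup>2 / (4 * B)) \<ge> 1/4"
proof -
  define \<xi> where "\<xi> = ln (real (Suc n))"
  have \<xi>: "0 \<le> \<xi>" "\<xi> \<le> ln (real M + 1)" using n by (auto simp: \<xi>_def)
  hence "\<xi>\<^sup>2 \<le> B" using power_mono[OF \<xi>(2,1), of 2] B by linarith
  hence "\<xi>\<^sup>2 / (4 * B) \<le> 1/2" using B by (simp add: divide_le_eq)
  hence gauss: "exp (- \<xi>\<^sup>2 / (4 * B)) \<ge> 1/2"
    using exp_ge_add_one_self[of "- \<xi>\<^sup>2 / (4 * B)"] by simp
  have "\<epsilon> * \<xi> \<le> ln 2" using mult_left_mono[OF \<xi>(2) \<epsilon>(1)] \<epsilon>(2) by linarith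
  hence "exp (- (\<epsilon> * \<xi>)) \<ge> exp (- ln 2)" by simp
  hence shift: "real (Suc n) powr (- \<epsilon>) \<ge> 1/2"
    by (simp add: exp_minus powr_def \<xi>_def inverse_eq_divide)
  have "(1/2) * (1/2) \<le> real (Suc n) powr (- \<epsilon>) * exp (- \<xi>\<^sup>2 / (4 * B))"
    using gauss shift by (intro mult_mono) auto
  thus ?thesis by (simp add: \<xi>_def)
qed

text \<open>A narrow Gaussian (large \<open>B\<close>) leaves the first \<open>M\<^sub>0\<close> terms of the divergent series intact.\<close>

lemma gaussian_log_sum_unbounded:
  obtains B \<epsilon>\<^sub>0 M\<^sub>0 where "B > 0" "\<epsilon>\<^sub>0 > 0" and "\<And>M \<epsilon>. M \<ge> M\<^sub>0 \<Longrightarrow> 0 < \<epsilon> \<Longrightarrow> \<epsilon> \<le> \<epsilon>\<^sub>0 \<Longrightarrow>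
    gaussian_log_sum B (1/2 + \<epsilon>) M \<ge> K"
proof -
  obtain M\<^sub>0 where M\<^sub>0: "(\<Sum>n<M\<^sub>0. log_coeff n * real (Suc n) powr (- (1/2))) > 4 * K"
    using sum_log_coeff_unbounded[of "1/2"] by auto
  define l where "l = ln (real M\<^sub>0 + 1)"
  define B where "B = l\<^sup>2 + 1"
  have l: "l \<ge> 0" by (simp add: l_def)
  have B: "B > 0" "B \<ge> l\<^sup>2" by (simp_all add: B_def add_nonneg_pos)
  let ?a = "\<lambda>\<epsilon> n. log_coeff n * real (Suc n) powr (- (1/2 + \<epsilon>)) *
      exp (- (ln (real (Suc n)))\<^sup>2 / (4 * B))"
  have a_nonneg: "?a \<epsilon> n \<ge> 0" for \<epsilon> n by (intro mult_nonneg_nonneg log_coeff_nonneg) auto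
  show ?thesis
  proof
    show "B > 0" by fact
    show "ln 2 / (l + 1) > 0" using l by simp
    fix M \<epsilon> assume M: "M \<ge> M\<^sub>0" and \<epsilon>: "0 < \<epsilon>" "\<epsilon> \<le> ln 2 / (l + 1)"
    have "\<epsilon> * l \<le> ln 2 / (l + 1) * (l + 1)" using \<epsilon> l by (intro mult_mono) auto
    hence "\<epsilon> * l \<le> ln 2" using l by simp
    have "log_coeff n * real (Suc n) powr (- (1/2)) * (1/4) \<le> ?a \<epsilon> n" if "n < M\<^sub>0" for n
    proof -
      have "log_coeff n * real (Suc n) powr (- (1/2)) * (1/4) \<le>
          log_coeff n * real (Suc n) powr (- (1/2)) *
          (real (Suc n) powr (- \<epsilon>) * exp (- (ln (real (Suc n)))\<^sup>2 / (4 * B)))"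
        using that \<epsilon> \<open>\<epsilon> * l \<le> ln 2\<close> B unfolding l_def
        by (intro mult_left_mono powr_mult_gaussian_ge_quarter[where M=M\<^sub>0] mult_nonneg_nonneg
           log_coeff_nonneg) auto
      also have "\<dots> = log_coeff n * (real (Suc n) powr (- (1/2)) * real (Suc n) powr (- \<epsilon>)) *
          exp (- (ln (real (Suc n)))\<^sup>2 / (4 * B))" by (simp only: mult.assoc)
      finally show ?thesis by (simp add: powr_add[symmetric] del: of_nat_Suc)
    qed
    hence "(\<Sum>n<M\<^sub>0. log_coeff n * real (Suc n) powr (- (1/2)) * (1/4)) \<le> (\<Sum>n<M\<^sub>0. ?a \<epsilon> n)"
      by (intro sum_mono) auto
    also have "\<dots> \<le> (\<Sum>n<M. ?a \<epsilon> n)" using M a_nonneg by (intro sum_mono2) auto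
    finally show "gaussian_log_sum B (1/2 + \<epsilon>) M \<ge> K"
      using M\<^sub>0 unfolding gaussian_log_sum_def sum_distrib_right[symmetric] by linarith
  qed
qed

lemma relatively_dense_large_smoothed_log_zeta:
  obtains B \<eta> R \<epsilon>\<^sub>0 where "B > 0" "\<eta> > 0" "R \<ge> 0" "\<epsilon>\<^sub>0 > 0" and "\<And>T. \<exists>\<tau>. \<bar>\<tau> - T\<bar> \<le> R \<and>
    (\<forall>\<epsilon>. 0 < \<epsilon> \<longrightarrow> \<epsilon> \<le> \<epsilon>\<^sub>0 \<longrightarrow> Re (smoothed_log_zeta B \<eta> (Complex (1/2 + \<epsilon>) \<tau>)) \<ge> K * sqrt (pi / B))"
proof -
  obtain B \<epsilon>\<^sub>0 M\<^sub>0 where B: "B > 0" and \<epsilon>\<^sub>0: "\<epsilon>\<^sub>0 > 0" and main: "\<And>M \<epsilon>. M \<ge> M\<^sub>0 \<Longrightarrow> 0 < \<epsilon> \<Longrightarrow> \<epsilon> \<le> \<epsilon>\<^sub>0 \<Longrightarrow>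
      gaussian_log_sum B (1/2 + \<epsilon>) M \<ge> 2 * (K + 2)"
    using gaussian_log_sum_unbounded[of "2 * (K + 2)"] by blast
  define g where "g = sqrt (pi / B)"
  have g: "g > 0" using B by (simp add: g_def)
  obtain N where tail: "\<And>M \<eta> s. M \<ge> N \<Longrightarrow> 0 \<le> \<eta> \<Longrightarrow> \<eta> \<le> 1 \<Longrightarrow> Re s > 1/2 \<Longrightarrow>
      cmod (smoothed_log_zeta B \<eta> s - (\<Sum>n<M. smoothed_log_term B \<eta> s n)) \<le> g"
    using smoothed_log_zeta_tail_le[OF B g] by blast
  define M where "M = max M\<^sub>0 N"
  define J where "J = real M * (LINT x|lborel. gauss_exp pi B x)"
  have J: "J \<ge> 0" by (simp add: J_def)
  define \<eta> where "\<eta> = min 1 (g / (J + 1))"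
  have \<eta>: "0 < \<eta>" "\<eta> \<le> 1" using g J by (auto simp: \<eta>_def)
  have "\<eta> * J \<le> g / (J + 1) * (J + 1)" using \<eta> J by (intro mult_mono) (auto simp: \<eta>_def)
  hence \<eta>_J: "\<eta> * J \<le> g" using J by simp
  obtain R where R: "R \<ge> 0" "\<And>T. \<exists>\<tau>. \<bar>\<tau> - T\<bar> \<le> R \<and>
      (\<forall>n\<in>{..<M}. cmod (cis (\<tau> * - ln (real (Suc n))) - 1) \<le> 1/2)"
    using relatively_dense_cis_near_1[of "{..<M}" "1/2" "\<lambda>n. - ln (real (Suc n))"] by auto
  have "Re (smoothed_log_zeta B \<eta> (Complex (1/2 + \<epsilon>) \<tau>)) \<ge> K * g"
    if phase: "\<forall>n\<in>{..<M}. cmod (cis (\<tau> * - ln (real (Suc n))) - 1) \<le> 1/2"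
      and \<epsilon>: "0 < \<epsilon>" "\<epsilon> \<le> \<epsilon>\<^sub>0" for \<tau> \<epsilon>
  proof -
    let ?s = "Complex (1/2 + \<epsilon>) \<tau>"
    have "Re (\<Sum>n<M. smoothed_log_term B \<eta> ?s n) \<ge>
        g / 2 * gaussian_log_sum B (1/2 + \<epsilon>) M - \<eta> * J"
      using Re_sum_smoothed_log_term_ge[OF B less_imp_le[OF \<eta>(1)], of ?s M] phase \<epsilon>
      by (simp add: g_def J_def mult_ac del: of_nat_Suc)
    moreover have "g / 2 * (2 * (K + 2)) \<le> g / 2 * gaussian_log_sum B (1/2 + \<epsilon>) M"
      using main[of M \<epsilon>] \<epsilon> g by (intro mult_left_mono) (auto simp: M_def)
    moreover have "\<bar>Re (smoothed_log_zeta B \<eta> ?s - (\<Sum>n<M. smoothed_log_term B \<eta> ?s n))\<bar> \<le> g"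
      using tail[of M \<eta> ?s] \<eta> \<epsilon> by (intro order_trans[OF abs_Re_le_cmod]) (auto simp: M_def)
    ultimately show ?thesis using \<eta>_J by (simp add: algebra_simps)
  qed
  thus ?thesis using that[OF B \<eta>(1) R(1) \<epsilon>\<^sub>0] R(2) unfolding g_def by meson
qed

lemma (in log_depoled_zeta) eventually_zeta_gt_in_window:
  assumes A: "A \<ge> 0"
  obtains \<eta> R where "R \<ge> 0" and "\<forall>\<^sub>F T in at_top. \<exists>\<tau> t. \<bar>\<tau> - T\<bar> \<le> R \<and> \<bar>t - \<tau>\<bar> \<le> window \<eta> \<tau> \<and>
    cmod (zeta (Complex (1/2) t)) > A"
proof -
  obtain B \<eta> R \<epsilon>\<^sub>0 where pos: "B > 0" "\<eta> > 0" "R \<ge> 0" "\<epsilon>\<^sub>0 > 0"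
    and large: "\<And>T. \<exists>\<tau>. \<bar>\<tau> - T\<bar> \<le> R \<and> (\<forall>\<epsilon>. 0 < \<epsilon> \<longrightarrow> \<epsilon> \<le> \<epsilon>\<^sub>0 \<longrightarrow>
      Re (smoothed_log_zeta B \<eta> (Complex (1/2 + \<epsilon>) \<tau>)) \<ge> (ln (A + 1) + 1) * sqrt (pi / B))"
    using relatively_dense_large_smoothed_log_zeta[of "ln (A + 1) + 1"] by metis
  have "\<forall>\<^sub>F \<tau> in at_top. 0 < 1 / \<tau> ^ 3 \<and> 1 / \<tau> ^ 3 \<le> \<epsilon>\<^sub>0"
    using pos(4) by (intro eventually_conj; real_asymp)
  from eventually_conj[OF this eventually_Re_smoothed_log_zeta_less[OF A pos(1,2)]]
  obtain \<tau>\<^sub>0 where \<tau>\<^sub>0: "\<And>\<tau>. \<tau> \<ge> \<tau>\<^sub>0 \<Longrightarrow> 0 < 1 / \<tau> ^ 3 \<and> 1 / \<tau> ^ 3 \<le> \<epsilon>\<^sub>0"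
    "\<And>\<tau>. \<tau> \<ge> \<tau>\<^sub>0 \<Longrightarrow> (\<And>t. \<bar>t - \<tau>\<bar> \<le> window \<eta> \<tau> \<Longrightarrow> cmod (zeta (Complex (1/2) t)) \<le> A) \<Longrightarrow>
      Re (smoothed_log_zeta B \<eta> (Complex (1/2 + 1 / \<tau> ^ 3) \<tau>)) < (ln (A + 1) + 1) * sqrt (pi / B)"
    unfolding eventually_at_top_linorder by blast
  have "\<exists>\<tau> t. \<bar>\<tau> - T\<bar> \<le> R \<and> \<bar>t - \<tau>\<bar> \<le> window \<eta> \<tau> \<and> cmod (zeta (Complex (1/2) t)) > A"
    if T: "T \<ge> \<tau>\<^sub>0 + R" for T
  proof -
    obtain \<tau> where \<tau>: "\<bar>\<tau> - T\<bar> \<le> R" and ge: "\<And>\<epsilon>. 0 < \<epsilon> \<Longrightarrow> \<epsilon> \<le> \<epsilon>\<^sub>0 \<Longrightarrow>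
        Re (smoothed_log_zeta B \<eta> (Complex (1/2 + \<epsilon>) \<tau>)) \<ge> (ln (A + 1) + 1) * sqrt (pi / B)"
      using large by blast
    have "\<tau> \<ge> \<tau>\<^sub>0" using \<tau> T by linarith
    with ge[of "1 / \<tau> ^ 3"] \<tau>\<^sub>0(1)[of \<tau>] have
      "\<not> Re (smoothed_log_zeta B \<eta> (Complex (1/2 + 1 / \<tau> ^ 3) \<tau>)) <
          (ln (A + 1) + 1) * sqrt (pi / B)"
      by simp
    with \<tau>\<^sub>0(2)[OF \<open>\<tau> \<ge> \<tau>\<^sub>0\<close>] \<tau> show ?thesis by (meson not_le)
  qed
  hence "\<forall>\<^sub>F T in at_top. \<exists>\<tau> t. \<bar>\<tau> - T\<bar> \<le> R \<and> \<bar>t - \<tau>\<bar> \<le> window \<eta> \<tau> \<and>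
      cmod (zeta (Complex (1/2) t)) > A"
    by (rule eventually_at_top_linorderI)
  with pos(3) show ?thesis by (rule that)
qed

theorem theorem1:
  fixes A :: real
  assumes RH: "riemann_hypothesis"
    and "A \<ge> 1"
  shows "\<exists>c\<^sub>0::real. c\<^sub>0 > 0 \<and> (\<exists>T\<^sub>0::real. \<forall>T>T\<^sub>0.
           let H = 1 / pi * ln (ln (ln T)) + c\<^sub>0
           in \<exists>t::real. t \<in> {T - H<..<T + H} \<and>
                cmod (zeta (1 / 2 + \<i> * complex_of_real t)) > A)"
proof -
  obtain F where "log_depoled_zeta F" using ex_log_depoled_zeta[OF RH] .
  then interpret log_depoled_zeta F .
  have "A \<ge> 0" using assms(2) by simp
  obtain \<eta> R where R: "R \<ge> 0" and large: "\<forall>\<^sub>F T in at_top. \<exists>\<tau> t. \<bar>\<tau> - T\<bar> \<le> R \<and>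
      \<bar>t - \<tau>\<bar> \<le> window \<eta> \<tau> \<and> cmod (zeta (Complex (1/2) t)) > A"
    using eventually_zeta_gt_in_window[OF \<open>A \<ge> 0\<close>] by blast
  define c\<^sub>0 where "c\<^sub>0 = R + \<bar>ln (4 / \<eta>) / pi\<bar> + 1"
  have "\<forall>\<^sub>F T in at_top. let H = 1 / pi * ln (ln (ln T)) + c\<^sub>0
      in \<exists>t. t \<in> {T - H<..<T + H} \<and> cmod (zeta (1 / 2 + \<i> * complex_of_real t)) > A"
    using large eventually_window_le[of R \<eta>]
  proof eventually_elim
    case (elim T)
    then obtain \<tau> t where "\<bar>\<tau> - T\<bar> \<le> R" "\<bar>t - \<tau>\<bar> \<le> window \<eta> \<tau>"
      "window \<eta> \<tau> < 1 / pi * ln (ln (ln T)) + ln (4 / \<eta>) / pi + 1"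
      and t: "cmod (zeta (Complex (1/2) t)) > A"
      by blast
    hence "\<bar>t - T\<bar> < 1 / pi * ln (ln (ln T)) + c\<^sub>0" unfolding c\<^sub>0_def by linarith
    moreover have "1 / 2 + \<i> * complex_of_real t = Complex (1/2) t" by (simp add: complex_eq_iff)
    ultimately show ?case using t by (auto simp: Let_def abs_less_iff intro!: exI[of _ t])
  qed
  moreover have "c\<^sub>0 > 0" using R by (simp add: c\<^sub>0_def add_nonneg_pos)
  ultimately show ?thesis unfolding eventually_at_top_dense by blast
qed

end
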